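(* Let $C$ be a geometrically integral and regular curve over $K$ and $P\in C$ a closed point. If the differential degree satisfies $d(C,P)=1$, then $P$ is smooth (i.e. $C^{\overline{K}}$ is regular at $P^{\overline{K}}$).
   Context: $K$ is a non-perfect, separably closed field of characteristic $p>0$ with algebraic closure $\overline{K}$. $C^{\overline{K}}=C\times_{\operatorname{Spec}K}\operatorname{Spec}\overline{K}$, $P^{\overline{K}}$ is the unique point of $C^{\overline{K}}$ over $P$, with local ring $\overline{K}\mathcal{O}_{C,P}$; $\widetilde{C^{\overline{K}}}$ is the normalization of $C^{\overline{K}}$ and $\widetilde{P^{\overline{K}}}$ its unique point lying over $P$. The differential degree at $P$ is $d(C,P)=1+\dim_{\overline{K}}\operatorname{Coker}(\alpha)$, where $\alpha\colon\mathcal{O}_{\widetilde{C^{\overline{K}}},\widetilde{P^{\overline{K}}}}\,\Omega_{\overline{K}\mathcal{O}_{C,P}/\overline{K}}\to\Omega_{\mathcal{O}_{\widetilde{C^{\overline{K}}},\widetilde{P^{\overline{K}}}}/\overline{K}}$ is the natural homomorphism from the $\mathcal{O}_{\widetilde{C^{\overline{K}}},\widetilde{P^{\overline{K}}}}$-module generated by the Kähler differentials of $\overline{K}\mathcal{O}_{C,P}$ (equivalently, its image is the $\mathcal{O}_{\widetilde{C^{\overline{K}}},\widetilde{P^{\overline{K}}}}$-submodule generated by all $dx$, $x\in\overline{K}\mathcal{O}_{C,P}$). *)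

theory Defs
  imports
    "HOL-Analysis.Abstract_Topology"
    "HOL-Algebra.Algebraic_Closure_Type"
    "HOL-Algebra.Ring_Divisibility"
    "HOL-Algebra.Generated_Rings"
    "HOL-Algebra.QuotRing"
    "HOL-Computational_Algebra.Polynomial"
    "HOL-Library.Extended_Nat"
    "HOL-Library.Poly_Mapping"
begin

text \<open>
  All rings that occur as rings of functions live inside one ambient field, given by a type of
  class \<open>field\<close>, which contains both the function field of the curve and the algebraic closure
  of the ground field.  The ring structure of a subring is seen by \<open>HOL-Algebra\<close> as follows.
\<close>

abbreviation ambient :: "'l::field ring" where
  "ambient \<equiv> ring_of_type_algebra"

abbreviation subring_rec :: "'l::field set \<Rightarrow> 'l ring" where
  "subring_rec R \<equiv> ambient\<lparr>carrier := R\<rparr>"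


section \<open>Fields\<close>

definition perfect_subfield :: "'l::field set \<Rightarrow> bool" where
  "perfect_subfield K \<longleftrightarrow> CHAR('l) = 0 \<or> (\<forall>x\<in>K. \<exists>y\<in>K. y ^ CHAR('l) = x)"

text \<open>A polynomial over \<open>K\<close> is separable if it is coprime to its derivative; coprimality does not
  depend on whether it is tested over \<open>K\<close> or over the ambient field.\<close>

definition separably_closed :: "'l::field set \<Rightarrow> bool" where
  "separably_closed K \<longleftrightarrow>
     (\<forall>f :: 'l poly. (\<forall>i. Polynomial.coeff f i \<in> K) \<and> Polynomial.degree f > 0 \<and> coprime f (pderiv f)
        \<longrightarrow> (\<exists>x\<in>K. poly f x = 0))"


section \<open>Commutative algebra\<close>

definition krull_dim :: "('a, 'b) ring_scheme \<Rightarrow> enat" where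
  "krull_dim R = Sup {enat n | n. \<exists>\<pp>. (\<forall>i\<le>n. primeideal (\<pp> i) R) \<and> (\<forall>i<n. \<pp> i \<subset> \<pp> (Suc i))}"

definition regular_local_ring :: "('a, 'b) ring_scheme \<Rightarrow> bool" where
  "regular_local_ring R \<longleftrightarrow>
     cring R \<and> noetherian_ring R \<and> (\<exists>!\<mm>. maximalideal \<mm> R) \<and>
     (\<exists>S\<subseteq>carrier R. finite S \<and> maximalideal (Idl\<^bsub>R\<^esub> S) R \<and> enat (card S) = krull_dim R)"

definition nonunits :: "'l::field set \<Rightarrow> 'l set" where
  "nonunits R = {a \<in> R. a = 0 \<or> inverse a \<notin> R}"

definition localization :: "'l::field set \<Rightarrow> 'l set \<Rightarrow> 'l set" where
  "localization A \<pp> = {a / b | a b. a \<in> A \<and> b \<in> A - \<pp>}"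

definition integral_closure :: "'l::field set \<Rightarrow> 'l set \<Rightarrow> 'l set" where
  "integral_closure F R =
     {x \<in> F. \<exists>f :: 'l poly. (\<forall>i. Polynomial.coeff f i \<in> R) \<and> Polynomial.lead_coeff f = 1 \<and> poly f x = 0}"

definition spec_topology :: "'l::field set \<Rightarrow> 'l set topology" where
  "spec_topology A = topology_generated_by {{\<pp>. primeideal \<pp> (subring_rec A) \<and> f \<notin> \<pp>} | f. f \<in> A}"


subsection \<open>Tensor products of algebras\<close>

text \<open>\<open>A \<otimes>\<^sub>K B\<close> is the integral monoid ring of \<open>A \<times> B\<close> (formal integral combinations of symbols
  \<open>a \<otimes> b\<close>) modulo the ideal of the relations of \<open>K\<close>-bilinearity.\<close>

definition pair_ring :: "'l::field set \<Rightarrow> 'l set \<Rightarrow> ('l \<times> 'l \<Rightarrow>\<^sub>0 int) ring" where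
  "pair_ring A B =
     \<lparr>carrier = {w. Poly_Mapping.keys w \<subseteq> A \<times> B},
      monoid.mult = (\<lambda>v w. frag_extend (\<lambda>(a, b). frag_extend (\<lambda>(a', b'). frag_of (a * a', b * b')) w) v),
      one = frag_of (1, 1), zero = 0, add = (+)\<rparr>"

definition tensor_relations :: "'l::field set \<Rightarrow> 'l set \<Rightarrow> 'l set \<Rightarrow> ('l \<times> 'l \<Rightarrow>\<^sub>0 int) set" where
  "tensor_relations K A B =
     {frag_of (a + a', b) - frag_of (a, b) - frag_of (a', b) | a a' b. a \<in> A \<and> a' \<in> A \<and> b \<in> B} \<union>
     {frag_of (a, b + b') - frag_of (a, b) - frag_of (a, b') | a b b'. a \<in> A \<and> b \<in> B \<and> b' \<in> B} \<union>
     {frag_of (k * a, b) - frag_of (a, k * b) | k a b. k \<in> K \<and> a \<in> A \<and> b \<in> B}"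

definition tensor_ring :: "'l::field set \<Rightarrow> 'l set \<Rightarrow> 'l set \<Rightarrow> ('l \<times> 'l \<Rightarrow>\<^sub>0 int) set ring" where
  "tensor_ring K A B = pair_ring A B Quot (Idl\<^bsub>pair_ring A B\<^esub> (tensor_relations K A B))"


subsection \<open>Quotient modules and dimension\<close>

definition module_span :: "('a, 'c) ring_scheme \<Rightarrow> ('a, 'b) module \<Rightarrow> 'b set \<Rightarrow> 'b set" where
  "module_span R M G = \<Inter>{N. submodule N R M \<and> G \<subseteq> N}"

text \<open>The fields \<open>mult\<close> and \<open>one\<close> of the record type \<open>module\<close> are irrelevant for modules.\<close>

definition quot_module :: "('a, 'b) module \<Rightarrow> 'b set \<Rightarrow> ('a, 'b set) module" where
  "quot_module M N =
     \<lparr>carrier = a_rcosets\<^bsub>M\<^esub> N, monoid.mult = (\<lambda>_ _. N), one = N, zero = N, add = set_add M,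
      module.smult = (\<lambda>r Y. \<Union>x\<in>Y. N +>\<^bsub>M\<^esub> (r \<odot>\<^bsub>M\<^esub> x))\<rparr>"

definition lin_indep :: "'a::field set \<Rightarrow> ('a, 'b) module \<Rightarrow> 'b set \<Rightarrow> bool" where
  "lin_indep k M S \<longleftrightarrow>
     (\<forall>c. (\<forall>s\<in>S. c s \<in> k) \<and> finsum M (\<lambda>s. c s \<odot>\<^bsub>M\<^esub> s) S = \<zero>\<^bsub>M\<^esub> \<longrightarrow> (\<forall>s\<in>S. c s = 0))"

definition vs_dim :: "'a::field set \<Rightarrow> ('a, 'b) module \<Rightarrow> enat" where
  "vs_dim k M = Sup {enat (card S) | S. finite S \<and> S \<subseteq> carrier M \<and> lin_indep k M S}"


subsection \<open>Kaehler differentials\<close>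

text \<open>The free \<open>B\<close>-module on the symbols \<open>d x\<close>, \<open>x \<in> B\<close>; the element \<open>b \<cdot> d x\<close> is
  \<open>Poly_Mapping.single x b\<close>.\<close>

definition free_module :: "'l::field set \<Rightarrow> ('l, 'l \<Rightarrow>\<^sub>0 'l) module" where
  "free_module B =
     \<lparr>carrier = {w. Poly_Mapping.keys w \<subseteq> B \<and> (\<forall>x. Poly_Mapping.lookup w x \<in> B)},
      monoid.mult = (\<lambda>_ _. 0), one = 0, zero = 0, add = (+), module.smult = (\<lambda>b w. Poly_Mapping.map ((*) b) w)\<rparr>"

definition kaehler_relations :: "'l::field set \<Rightarrow> 'l set \<Rightarrow> ('l \<Rightarrow>\<^sub>0 'l) set" where
  "kaehler_relations k B =
     {Poly_Mapping.single (x + y) 1 - Poly_Mapping.single x 1 - Poly_Mapping.single y 1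
       | x y. x \<in> B \<and> y \<in> B} \<union>
     {Poly_Mapping.single (x * y) 1 - Poly_Mapping.single y x - Poly_Mapping.single x y
       | x y. x \<in> B \<and> y \<in> B} \<union>
     {Poly_Mapping.single c 1 | c. c \<in> k}"

definition kaehler_kernel :: "'l::field set \<Rightarrow> 'l set \<Rightarrow> ('l \<Rightarrow>\<^sub>0 'l) set" where
  "kaehler_kernel k B = module_span (subring_rec B) (free_module B) (kaehler_relations k B)"

text \<open>\<open>\<Omega>\<^bsub>B/k\<^esub>\<close> and its universal derivation.\<close>

definition kaehler :: "'l::field set \<Rightarrow> 'l set \<Rightarrow> ('l, ('l \<Rightarrow>\<^sub>0 'l) set) module" where
  "kaehler k B = quot_module (free_module B) (kaehler_kernel k B)"

definition kaehler_d :: "'l::field set \<Rightarrow> 'l set \<Rightarrow> 'l \<Rightarrow> ('l \<Rightarrow>\<^sub>0 'l) set" where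
  "kaehler_d k B x = kaehler_kernel k B +>\<^bsub>free_module B\<^esub> (Poly_Mapping.single x 1)"

text \<open>For \<open>A \<subseteq> B\<close>, the cokernel of \<open>B \<Omega>\<^bsub>A/k\<^esub> \<rightarrow> \<Omega>\<^bsub>B/k\<^esub>\<close>; the image of this map is the
  \<open>B\<close>-submodule generated by all \<open>dx\<close>, \<open>x \<in> A\<close>.\<close>

definition kaehler_coker ::
    "'l::field set \<Rightarrow> 'l set \<Rightarrow> 'l set \<Rightarrow> ('l, ('l \<Rightarrow>\<^sub>0 'l) set set) module" where
  "kaehler_coker k A B =
     quot_module (kaehler k B) (module_span (subring_rec B) (kaehler k B) (kaehler_d k B ` A))"


section \<open>Integral schemes\<close>

text \<open>
  On an integral scheme all local rings \<open>\<O>\<^sub>x\<close> are subrings of the function field, and the sections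
  over a nonempty open set \<open>U\<close> are the intersection of the \<open>\<O>\<^sub>x\<close>, \<open>x \<in> U\<close>.  Hence the space, the
  function field and the family of local rings determine the scheme.
\<close>

record ('x, 'l) int_scheme =
  top_space :: "'x topology"
  fun_field :: "'l set"
  stalk :: "'x \<Rightarrow> 'l set"

abbreviation points :: "('x, 'l) int_scheme \<Rightarrow> 'x set" where
  "points Y \<equiv> topspace (top_space Y)"

definition sections :: "('x, 'l::field) int_scheme \<Rightarrow> 'x set \<Rightarrow> 'l set" where
  "sections Y U = {f \<in> fun_field Y. \<forall>x\<in>U. f \<in> stalk Y x}"

text \<open>\<open>U\<close> is a nonempty open subscheme isomorphic to the spectrum of its ring of sections \<open>A\<close>, via
  \<open>x \<mapsto> {f \<in> A. f(x) = 0}\<close>.\<close>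

definition affine_open :: "('x, 'l::field) int_scheme \<Rightarrow> 'x set \<Rightarrow> bool" where
  "affine_open Y U \<longleftrightarrow>
     openin (top_space Y) U \<and> U \<noteq> {} \<and>
     homeomorphic_map (subtopology (top_space Y) U) (spec_topology (sections Y U))
       (\<lambda>x. nonunits (stalk Y x) \<inter> sections Y U) \<and>
     (\<forall>x\<in>U. stalk Y x = localization (sections Y U) (nonunits (stalk Y x) \<inter> sections Y U)) \<and>
     fun_field Y = localization (sections Y U) {0}"

definition integral_scheme :: "('x, 'l::field) int_scheme \<Rightarrow> bool" where
  "integral_scheme Y \<longleftrightarrow>
     subfield (fun_field Y) ambient \<and>
     (\<forall>x\<in>points Y. subring (stalk Y x) ambient \<and> stalk Y x \<subseteq> fun_field Y) \<and>
     points Y \<noteq> {} \<and>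
     (\<forall>U V. openin (top_space Y) U \<and> openin (top_space Y) V \<and> U \<noteq> {} \<and> V \<noteq> {} \<longrightarrow> U \<inter> V \<noteq> {}) \<and>
     (\<forall>x\<in>points Y. \<exists>U. affine_open Y U \<and> x \<in> U)"

definition scheme_over :: "'l::field set \<Rightarrow> ('x, 'l) int_scheme \<Rightarrow> bool" where
  "scheme_over K Y \<longleftrightarrow> (\<forall>x\<in>points Y. K \<subseteq> stalk Y x)"

text \<open>The diagonal is a closed immersion, read off on the affine open sets \<open>U \<times> V\<close>.\<close>

definition separated :: "('x, 'l::field) int_scheme \<Rightarrow> bool" where
  "separated Y \<longleftrightarrow>
     (\<forall>U V. affine_open Y U \<and> affine_open Y V \<longrightarrow>
        affine_open Y (U \<inter> V) \<and>
        sections Y (U \<inter> V) = generate_ring ambient (sections Y U \<union> sections Y V))"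

definition finite_type :: "'l::field set \<Rightarrow> ('x, 'l) int_scheme \<Rightarrow> bool" where
  "finite_type K Y \<longleftrightarrow>
     compact_space (top_space Y) \<and>
     (\<forall>U. affine_open Y U \<longrightarrow> (\<exists>S. finite S \<and> sections Y U = generate_ring ambient (K \<union> S)))"

definition irreducible_closed :: "'x topology \<Rightarrow> 'x set \<Rightarrow> bool" where
  "irreducible_closed T Z \<longleftrightarrow>
     closedin T Z \<and> Z \<noteq> {} \<and>
     (\<forall>A B. closedin T A \<and> closedin T B \<and> Z \<subseteq> A \<union> B \<longrightarrow> Z \<subseteq> A \<or> Z \<subseteq> B)"

definition top_dim :: "'x topology \<Rightarrow> enat" where
  "top_dim T = Sup {enat n | n. \<exists>Z. (\<forall>i\<le>n. irreducible_closed T (Z i)) \<and> (\<forall>i<n. Z i \<subset> Z (Suc i))}"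

definition integral_curve :: "'l::field set \<Rightarrow> ('x, 'l) int_scheme \<Rightarrow> bool" where
  "integral_curve K C \<longleftrightarrow>
     integral_scheme C \<and> scheme_over K C \<and> separated C \<and> finite_type K C \<and> top_dim (top_space C) = 1"

definition regular_at :: "('x, 'l::field) int_scheme \<Rightarrow> 'x \<Rightarrow> bool" where
  "regular_at Y x \<longleftrightarrow> regular_local_ring (subring_rec (stalk Y x))"

definition regular_scheme :: "('x, 'l::field) int_scheme \<Rightarrow> bool" where
  "regular_scheme Y \<longleftrightarrow> (\<forall>x\<in>points Y. regular_at Y x)"

text \<open>The fibre product \<open>Y \<times>\<^bsub>Spec K\<^esub> Spec Kbar\<close>, glued from the spectra of \<open>\<O>(U) \<otimes>\<^sub>K Kbar\<close>, is
  integral.\<close>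

definition geometrically_integral :: "'l::field set \<Rightarrow> 'l set \<Rightarrow> ('x, 'l) int_scheme \<Rightarrow> bool" where
  "geometrically_integral K Kbar Y \<longleftrightarrow>
     (\<forall>U. affine_open Y U \<longrightarrow> domain (tensor_ring K (sections Y U) Kbar))"


subsection \<open>Relative spectra, base change and normalization\<close>

text \<open>
  Let \<open>B\<close> assign to a subring \<open>R\<close> of the ambient field an overring of \<open>R\<close>, compatibly with
  localization in \<open>R\<close>.  The relative spectrum of the corresponding quasi-coherent algebra on \<open>Y\<close> is
  obtained by gluing the \<open>Spec B(\<O>(U))\<close> for affine open \<open>U\<close>.  A point of it over \<open>x\<close> is a prime of
  \<open>B(\<O>\<^sub>x)\<close> that contracts to the maximal ideal of \<open>\<O>\<^sub>x\<close>; the projection to \<open>Y\<close> is \<open>fst\<close>.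
\<close>

definition rel_spec_points ::
    "('l::field set \<Rightarrow> 'l set) \<Rightarrow> ('x, 'l) int_scheme \<Rightarrow> ('x \<times> 'l set) set" where
  "rel_spec_points B Y =
     {(x, \<qq>). x \<in> points Y \<and> primeideal \<qq> (subring_rec (B (stalk Y x))) \<and>
              \<qq> \<inter> stalk Y x = nonunits (stalk Y x)}"

definition rel_spec ::
    "('l::field set \<Rightarrow> 'l set) \<Rightarrow> ('x, 'l) int_scheme \<Rightarrow> ('x \<times> 'l set, 'l) int_scheme" where
  "rel_spec B Y =
     \<lparr>top_space = topology_generated_by
        {{(x, \<qq>) \<in> rel_spec_points B Y. x \<in> U \<and> f \<notin> \<qq>} | U f. affine_open Y U \<and> f \<in> B (sections Y U)},
      fun_field = B (fun_field Y),
      stalk = (\<lambda>(x, \<qq>). localization (B (stalk Y x)) \<qq>)\<rparr>"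

text \<open>
  When \<open>Y\<close> is geometrically integral over \<open>K\<close>, the multiplication map from \<open>R \<otimes>\<^sub>K Kbar\<close> to the
  ambient field is injective for \<open>R = \<O>(U)\<close> (its kernel is a prime lying over \<open>0\<close>, and
  \<open>R \<otimes>\<^sub>K Kbar\<close> is a domain integral over \<open>R\<close>), so that \<open>R \<otimes>\<^sub>K Kbar\<close> is the subring \<open>Kbar R\<close>.
\<close>

definition base_change :: "'l::field set \<Rightarrow> ('x, 'l) int_scheme \<Rightarrow> ('x \<times> 'l set, 'l) int_scheme" where
  "base_change Kbar Y = rel_spec (\<lambda>R. generate_ring ambient (Kbar \<union> R)) Y"

definition normalized_scheme :: "('x, 'l::field) int_scheme \<Rightarrow> ('x \<times> 'l set, 'l) int_scheme" where
  "normalized_scheme Y = rel_spec (integral_closure (fun_field Y)) Y"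


section \<open>The differential degree\<close>

text \<open>Uniqueness of the point of the base change over \<open>P\<close> uses that \<open>K\<close> is separably closed;
  uniqueness of the point of the normalization uses in addition that the curve is regular.\<close>

definition geom_point :: "'l::field set \<Rightarrow> ('x, 'l) int_scheme \<Rightarrow> 'x \<Rightarrow> 'x \<times> 'l set" where
  "geom_point Kbar C P = (THE Q. Q \<in> points (base_change Kbar C) \<and> fst Q = P)"

definition normal_point :: "('x, 'l::field) int_scheme \<Rightarrow> 'x \<Rightarrow> 'x \<times> 'l set" where
  "normal_point Y Q = (THE R. R \<in> points (normalized_scheme Y) \<and> fst R = Q)"

definition differential_degree :: "'l::field set \<Rightarrow> ('x, 'l) int_scheme \<Rightarrow> 'x \<Rightarrow> enat" where
  "differential_degree Kbar C P =
     (let C' = base_change Kbar C; P' = geom_point Kbar C P in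
      1 + vs_dim Kbar (kaehler_coker Kbar (stalk C' P') (stalk (normalized_scheme C') (normal_point C' P'))))"

end

theory Submission
  imports Defs
begin

text \<open>
  Let \<open>A\<close> be the local ring of the base change over \<open>P\<close> and \<open>B\<close> its normalization.  Since \<open>K\<close> is
  separably closed, \<open>Kbar\<close> is purely inseparable over \<open>K\<close>, so the base change is homeomorphic to \<open>C\<close> and
  \<open>B\<close> consists of the elements of the function field with some \<open>p\<close>-power iterate in the discrete
  valuation ring \<open>\<O>\<^bsub>C,P\<^esub>\<close>; in particular \<open>B\<close> is a valuation ring with residue field \<open>Kbar\<close>.

  As \<open>Kbar\<close> is perfect, \<open>A\<close> is finite over \<open>A\<^sup>p\<close>.  This gives a nonzero \<open>c\<close> with \<open>c z \<in> A\<close> whenever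
  \<open>z\<^sup>p \<in> A\<close>, and then \<open>c\<^sup>2 B \<subseteq> A\<close>.  Hence \<open>B\<close> is discrete, say with uniformizer \<open>t\<close>.  Differential
  degree \<open>1\<close> means that the differentials of \<open>A\<close> generate those of \<open>B\<close>, so the point derivation
  \<open>b \<mapsto> ((b - b(P)) / t)(P)\<close> does not vanish on \<open>A\<close>.  Therefore \<open>A\<close> contains a uniformizer \<open>x\<close> of \<open>B\<close>, and
  \<open>B \<subseteq> Kbar[x] + x\<^sup>N B \<subseteq> A + c\<^sup>2 B \<subseteq> A\<close>.
\<close>

section \<open>Subrings of a field\<close>

text \<open>One obstacle shapes the proof. Passing from the local ring of \<open>C\<close> at
  \<open>P\<close> to its ring \<open>B\<close> of p-power roots preserves valuation rings of rank
  at most one, but it need not preserve discreteness: adjoining roots can make the value group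
  p-divisible. Valuations are therefore handled through an archimedean axiom, and discreteness is
  recovered only once a conductor is known. A nonzero ideal of \<open>B\<close> that lies in
  \<open>A\<close> has finite codimension over \<open>Kbar\<close> in \<open>A\<close>, which leaves
  no room for infinitely many decreasing values. The residue field of \<open>B\<close> is
  \<open>Kbar\<close> because \<open>P\<close> is closed: Zariski's lemma makes the residue field of
  \<open>C\<close> at \<open>P\<close> algebraic over \<open>K\<close>. The points over
  \<open>P\<close> are given by unique descriptions, so their uniqueness and their local rings have
  to be computed. Both rest on one fact: if every element of \<open>T\<close> has a p-power iterate
  in \<open>S\<close>, then each prime of \<open>S\<close> lies under exactly one prime of
  \<open>T\<close>. The degenerate case in which \<open>B\<close> is a field has no uniformizer and
  is carried along separately.\<close>

lemma ambient_simps [simp]: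
  "carrier (ambient :: 'l::field ring) = UNIV"
  "x \<otimes>\<^bsub>(ambient :: 'l ring)\<^esub> y = x * y" "\<one>\<^bsub>(ambient :: 'l ring)\<^esub> = 1"
  "\<zero>\<^bsub>(ambient :: 'l ring)\<^esub> = 0" "x \<oplus>\<^bsub>(ambient :: 'l ring)\<^esub> y = x + y"
  by (simp_all add: ring_of_type_algebra_def)

lemma ambient_a_inv [simp]: "\<ominus>\<^bsub>(ambient :: 'l::field ring)\<^esub> x = - x"
proof -
  interpret ring "ambient :: 'l ring" by (rule ring_from_type_algebra)
  show ?thesis using minus_equality[of "-x" x] by simp
qed

text \<open>Subrings, and below ideals and primes, are restated as closure conditions on subsets of
  the field type. The arguments then run elementwise with the operations of the field, and the
  record structures appear only at the interface.\<close>

definition subr :: "'l::field set \<Rightarrow> bool" where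
  "subr S \<longleftrightarrow> 1 \<in> S \<and> (\<forall>x\<in>S. \<forall>y\<in>S. x - y \<in> S \<and> x * y \<in> S)"

lemma subr_one: "subr S \<Longrightarrow> 1 \<in> S"
  and subr_diff: "subr S \<Longrightarrow> x \<in> S \<Longrightarrow> y \<in> S \<Longrightarrow> x - y \<in> S"
  and subr_mult: "subr S \<Longrightarrow> x \<in> S \<Longrightarrow> y \<in> S \<Longrightarrow> x * y \<in> S"
  by (auto simp: subr_def)

lemma subr_zero: "subr S \<Longrightarrow> 0 \<in> S"
  using subr_diff[of S 1 1] subr_one by auto

lemma subr_uminus: "subr S \<Longrightarrow> x \<in> S \<Longrightarrow> - x \<in> S"
  using subr_diff[of S 0 x] subr_zero by auto

lemma subr_add: "subr S \<Longrightarrow> x \<in> S \<Longrightarrow> y \<in> S \<Longrightarrow> x + y \<in> S"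
  using subr_diff[of S x "-y"] subr_uminus by auto

lemma subr_power: "subr S \<Longrightarrow> x \<in> S \<Longrightarrow> x ^ n \<in> S"
  by (induction n) (auto intro: subr_one subr_mult)

lemma subr_sum: "subr S \<Longrightarrow> (\<And>i. i \<in> A \<Longrightarrow> f i \<in> S) \<Longrightarrow> sum f A \<in> S"
  by (induction A rule: infinite_finite_induct) (auto intro: subr_zero subr_add)

lemmas subr_intros = subr_one subr_zero subr_diff subr_mult subr_uminus subr_add subr_power

lemma subrI:
  assumes "1 \<in> S" "\<And>x y. x \<in> S \<Longrightarrow> y \<in> S \<Longrightarrow> x + y \<in> S" "\<And>x. x \<in> S \<Longrightarrow> - x \<in> S"
    "\<And>x y. x \<in> S \<Longrightarrow> y \<in> S \<Longrightarrow> x * y \<in> S"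
  shows "subr S"
  unfolding subr_def using assms by (metis uminus_add_conv_diff add.commute)

lemma subring_ambient_iff: "subring S ambient \<longleftrightarrow> subr S"
proof
  assume "subring S ambient"
  from subringE[OF this] show "subr S" by (intro subrI) auto
next
  assume S: "subr S"
  interpret ring "ambient :: 'a ring" by (rule ring_from_type_algebra)
  show "subring S ambient" by (rule subringI) (auto intro: subr_intros S)
qed

definition subf :: "'l::field set \<Rightarrow> bool" where
  "subf K \<longleftrightarrow> subr K \<and> (\<forall>x\<in>K. inverse x \<in> K)"

lemma subf_subr: "subf K \<Longrightarrow> subr K" by (simp add: subf_def)
lemma subf_inverse: "subf K \<Longrightarrow> x \<in> K \<Longrightarrow> inverse x \<in> K" by (simp add: subf_def)
lemma subf_divide: "subf K \<Longrightarrow> x \<in> K \<Longrightarrow> y \<in> K \<Longrightarrow> x / y \<in> K"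
  by (auto simp: divide_inverse intro: subr_mult subf_inverse subf_subr)

lemma subfield_imp_subf:
  assumes "subfield K ambient" shows "subf K"
proof -
  interpret field "ambient :: 'a ring" by (rule field_from_type_algebra)
  have s: "subr K" using subfieldE(1)[OF assms] by (rule subring_ambient_iff[THEN iffD1])
  moreover have "inverse x \<in> K" if "x \<in> K" for x
  proof (cases "x = 0")
    case True then show ?thesis using subr_zero[OF s] by simp
  next
    case False
    have "inv\<^bsub>ambient\<^esub> x = inverse x"
      using False by (intro comm_inv_char) auto
    then show ?thesis using subfield_m_inv(1)[OF assms, of x] that False by auto
  qed
  ultimately show ?thesis by (simp add: subf_def)
qed

definition ideal_in :: "'l::field set \<Rightarrow> 'l set \<Rightarrow> bool" where
  "ideal_in S I \<longleftrightarrow> I \<subseteq> S \<and> 0 \<in> I \<and> (\<forall>x\<in>I. \<forall>y\<in>I. x + y \<in> I) \<and> (\<forall>r\<in>S. \<forall>x\<in>I. r * x \<in> I)"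

lemma ideal_inD:
  assumes "ideal_in S I"
  shows "x \<in> I \<Longrightarrow> x \<in> S" "0 \<in> I" "x \<in> I \<Longrightarrow> y \<in> I \<Longrightarrow> x + y \<in> I" "r \<in> S \<Longrightarrow> x \<in> I \<Longrightarrow> r * x \<in> I"
   "r \<in> S \<Longrightarrow> x \<in> I \<Longrightarrow> x * r \<in> I"
  using assms by (auto simp: ideal_in_def mult.commute)

lemma ideal_in_uminus: "subr S \<Longrightarrow> ideal_in S I \<Longrightarrow> x \<in> I \<Longrightarrow> - x \<in> I"
  using ideal_inD(4)[of S I "-1" x] by (auto intro: subr_intros)

lemma ideal_in_diff: "subr S \<Longrightarrow> ideal_in S I \<Longrightarrow> x \<in> I \<Longrightarrow> y \<in> I \<Longrightarrow> x - y \<in> I"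
  using ideal_inD(3)[of S I x "-y"] ideal_in_uminus[of S I y] by auto

lemma cring_subring_rec: "subr S \<Longrightarrow> cring (subring_rec S)"
proof -
  assume S: "subr S"
  have "\<exists>y\<in>S. y + x = 0" if "x \<in> S" for x using that subr_uminus[OF S] by (intro bexI[of _ "- x"]) auto
  then show ?thesis
    by (intro cringI abelian_groupI comm_monoidI) (auto intro: subr_intros S simp: algebra_simps)
qed

lemma subring_rec_a_inv: "subr S \<Longrightarrow> x \<in> S \<Longrightarrow> \<ominus>\<^bsub>subring_rec S\<^esub> x = - x"
proof -
  assume S: "subr S" "x \<in> S"
  interpret cring "subring_rec S" by (rule cring_subring_rec[OF S(1)])
  show ?thesis using minus_equality[of "-x" x] S by (auto intro: subr_intros)
qed

lemma ideal_iff: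
  assumes S: "subr S" shows "ideal I (subring_rec S) \<longleftrightarrow> ideal_in S I"
proof
  assume "ideal I (subring_rec S)"
  then interpret ideal I "subring_rec S" .
  show "ideal_in S I"
    unfolding ideal_in_def using a_subset additive_subgroup.zero_closed[OF is_additive_subgroup]
      additive_subgroup.a_closed[OF is_additive_subgroup] I_l_closed by auto
next
  assume I: "ideal_in S I"
  interpret cring "subring_rec S" by (rule cring_subring_rec[OF S])
  have ainv: "inv\<^bsub>add_monoid (subring_rec S)\<^esub> x = - x" if "x \<in> S" for x
    using subring_rec_a_inv[OF S that] by (simp add: a_inv_def)
  show "ideal I (subring_rec S)"
  proof (rule idealI[OF ring_axioms])
    show "subgroup I (add_monoid (subring_rec S))"
      using ideal_inD[OF I] ideal_in_uminus[OF S I] by (intro subgroup.intro) (auto simp: ainv[simplified])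
  qed (use ideal_inD[OF I] in auto)
qed

definition prime_in :: "'l::field set \<Rightarrow> 'l set \<Rightarrow> bool" where
  "prime_in S q \<longleftrightarrow> ideal_in S q \<and> 1 \<notin> q \<and> (\<forall>a\<in>S. \<forall>b\<in>S. a * b \<in> q \<longrightarrow> a \<in> q \<or> b \<in> q)"

lemma prime_in_ideal: "prime_in S q \<Longrightarrow> ideal_in S q" by (simp add: prime_in_def)

lemma ideal_in_one: "ideal_in S I \<Longrightarrow> 1 \<in> I \<Longrightarrow> I = S"
  using ideal_inD(4)[of S I _ 1] ideal_inD(1)[of S I] by auto

lemma primeideal_iff:
  assumes S: "subr S" shows "primeideal q (subring_rec S) \<longleftrightarrow> prime_in S q"
proof
  assume "primeideal q (subring_rec S)"
  then interpret primeideal q "subring_rec S" .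
  have "ideal_in S q" using ideal_axioms ideal_iff[OF S] by auto
  then show "prime_in S q" unfolding prime_in_def
    using I_notcarr I_prime ideal_in_one[of S q] by auto
next
  assume I: "prime_in S q"
  show "primeideal q (subring_rec S)"
    using I subr_one[OF S] cring_subring_rec[OF S]
    by (intro primeidealI) (auto simp: prime_in_def ideal_iff S)
qed

lemma maximalideal_iff:
  assumes S: "subr S"
  shows "maximalideal M (subring_rec S) \<longleftrightarrow> ideal_in S M \<and> 1 \<notin> M \<and> (\<forall>J. ideal_in S J \<and> M \<subseteq> J \<and> 1 \<notin> J \<longrightarrow> J = M)"
proof
  assume "maximalideal M (subring_rec S)"
  then interpret maximalideal M "subring_rec S" .
  have "ideal_in S M" using ideal_axioms ideal_iff[OF S] by auto
  moreover have "J = M" if "ideal_in S J \<and> M \<subseteq> J \<and> 1 \<notin> J" for J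
    using I_maximal[of J] that ideal_iff[OF S, of J] ideal_inD(1)[of S J] subr_one[OF S] by auto
  ultimately show "ideal_in S M \<and> 1 \<notin> M \<and> (\<forall>J. ideal_in S J \<and> M \<subseteq> J \<and> 1 \<notin> J \<longrightarrow> J = M)"
    using I_notcarr ideal_in_one[of S M] by auto
next
  assume M: "ideal_in S M \<and> 1 \<notin> M \<and> (\<forall>J. ideal_in S J \<and> M \<subseteq> J \<and> 1 \<notin> J \<longrightarrow> J = M)"
  show "maximalideal M (subring_rec S)"
    using M subr_one[OF S] ideal_in_one[of S]
    by (intro maximalidealI) (auto simp: ideal_iff S)
qed

lemma generate_ring_subr: "subr (generate_ring ambient H)"
proof -
  interpret cring "ambient :: 'a ring" by (rule cring_from_type_algebra)
  show ?thesis by (rule subring_ambient_iff[THEN iffD1], rule generate_ring_is_subring) simp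
qed

lemma generate_ring_incl: "H \<subseteq> generate_ring ambient H"
  by (auto intro: generate_ring.incl)

lemma generate_ring_min: "subr S \<Longrightarrow> H \<subseteq> S \<Longrightarrow> generate_ring ambient H \<subseteq> S"
proof -
  interpret cring "ambient :: 'a ring" by (rule cring_from_type_algebra)
  show "subr S \<Longrightarrow> H \<subseteq> S \<Longrightarrow> ?thesis" by (rule generate_ring_min_subring1) (simp_all only: subring_ambient_iff ambient_simps subset_UNIV)
qed

section \<open>Additivity and injectivity of Frobenius powers\<close>

lemma frob_add:
  fixes x y :: "'l::field"
  assumes "prime p" "CHAR('l) = p"
  shows "(x + y) ^ p ^ n = x ^ p ^ n + y ^ p ^ n"
  using assms freshmans_dream' by blast

lemma frob_uminus:
  fixes x y :: "'l::field"
  assumes "prime p" "CHAR('l) = p"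
  shows "(- x) ^ p ^ n = - (x ^ p ^ n)"
  using frob_add[OF assms, of x "-x" n] prime_gt_0_nat[OF assms(1)]
  by (simp add: power_0_left minus_unique)

lemma frob_diff:
  fixes x y :: "'l::field"
  assumes "prime p" "CHAR('l) = p"
  shows "(x - y) ^ p ^ n = x ^ p ^ n - y ^ p ^ n"
  using frob_add[OF assms, of x "-y" n] frob_uminus[OF assms] by simp

lemma frob_inj:
  fixes x y :: "'l::field"
  assumes "prime p" "CHAR('l) = p" "x ^ p ^ n = y ^ p ^ n"
  shows "x = y"
  using frob_diff[OF assms(1,2), of x y n] assms(3) by simp

section \<open>Polynomials over a subfield\<close>

definition poly_in :: "'l::field set \<Rightarrow> 'l poly \<Rightarrow> bool" where
  "poly_in K f \<longleftrightarrow> (\<forall>i. Polynomial.coeff f i \<in> K)"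

lemma poly_in_intros:
  assumes K: "subr K"
  shows "poly_in K 0" "poly_in K 1" "poly_in K f \<Longrightarrow> poly_in K g \<Longrightarrow> poly_in K (f + g)"
    "poly_in K f \<Longrightarrow> poly_in K g \<Longrightarrow> poly_in K (f - g)"
    "poly_in K f \<Longrightarrow> poly_in K g \<Longrightarrow> poly_in K (f * g)" "poly_in K f \<Longrightarrow> poly_in K (- f)"
    "c \<in> K \<Longrightarrow> poly_in K f \<Longrightarrow> poly_in K (Polynomial.smult c f)"
    "c \<in> K \<Longrightarrow> poly_in K f \<Longrightarrow> poly_in K (pCons c f)"
    "c \<in> K \<Longrightarrow> poly_in K (Polynomial.monom c n)"
  using K by (auto simp: poly_in_def coeff_mult coeff_pCons split: nat.splits intro!: subr_intros subr_sum)

lemma subr_of_nat: "subr K \<Longrightarrow> of_nat n \<in> K"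
  by (induction n) (auto intro: subr_intros)

lemma poly_in_pderiv: "subr K \<Longrightarrow> poly_in K f \<Longrightarrow> poly_in K (pderiv f)"
  by (auto simp: poly_in_def coeff_pderiv simp del: of_nat_Suc intro!: subr_mult subr_of_nat)

lemma poly_in_sum: "subr K \<Longrightarrow> (\<And>i. i \<in> A \<Longrightarrow> poly_in K (f i)) \<Longrightarrow> poly_in K (sum f A)"
  by (induction A rule: infinite_finite_induct) (auto intro: poly_in_intros)

lemma poly_in_poly: "subr S \<Longrightarrow> K \<subseteq> S \<Longrightarrow> poly_in K f \<Longrightarrow> x \<in> S \<Longrightarrow> poly f x \<in> S"
  by (auto simp: poly_altdef poly_in_def intro!: subr_sum subr_mult subr_power)

lemma poly_in_mono: "K \<subseteq> S \<Longrightarrow> poly_in K f \<Longrightarrow> poly_in S f"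
  by (auto simp: poly_in_def)

text \<open>Long division: a monomial multiple of \<open>h\<close> cancels the leading term of
  \<open>f\<close>. Its coefficient is a quotient of two elements of \<open>K\<close>, so no
  coefficient leaves the subfield.\<close>

lemma poly_in_division:
  assumes K: "subf K" and h: "poly_in K h" "h \<noteq> 0"
  shows "poly_in K f \<Longrightarrow> \<exists>q r. poly_in K q \<and> poly_in K r \<and> f = h * q + r \<and> (r = 0 \<or> Polynomial.degree r < Polynomial.degree h)"
proof (induction "Polynomial.degree f" arbitrary: f rule: less_induct)
  case less
  note s = subf_subr[OF K]
  show ?case
  proof (cases "f = 0 \<or> Polynomial.degree f < Polynomial.degree h")
    case True then show ?thesis using less(2) poly_in_intros[OF s] by (intro exI[of _ 0] exI[of _ f]) auto
  next
    case False
    define c where "c = Polynomial.lead_coeff f / Polynomial.lead_coeff h"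
    define m where "m = Polynomial.monom c (Polynomial.degree f - Polynomial.degree h)"
    have c: "c \<in> K" unfolding c_def using less(2) h by (auto intro: subf_divide[OF K] simp: poly_in_def)
    have m: "poly_in K m" unfolding m_def by (intro poly_in_intros(9)[OF s] c)
    have c0: "c \<noteq> 0" using False h by (simp add: c_def)
    have m0: "m \<noteq> 0" using c0 by (simp add: m_def monom_eq_0_iff)
    have dm: "Polynomial.degree m = Polynomial.degree f - Polynomial.degree h" unfolding m_def by (rule degree_monom_eq[OF c0])
    define f' where "f' = f - h * m"
    have f': "poly_in K f'" unfolding f'_def by (intro poly_in_intros[OF s] less(2) h m)
    have dhm: "Polynomial.degree (h * m) = Polynomial.degree f" using False h m0 dm by (simp add: degree_mult_eq)
    have "Polynomial.lead_coeff m = c" by (simp add: m_def degree_monom_eq[OF c0])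
    then have "Polynomial.lead_coeff (h*m) = Polynomial.lead_coeff f"
      using h(2) by (simp add: lead_coeff_mult c_def)
    then have cz: "Polynomial.coeff f' (Polynomial.degree f) = 0" by (simp add: f'_def dhm)
    have dle: "Polynomial.degree f' \<le> Polynomial.degree f" unfolding f'_def by (rule degree_diff_le) (auto simp: dhm)
    show ?thesis
    proof (cases "f' = 0")
      case True
      then show ?thesis using m poly_in_intros(1)[OF s] by (intro exI[of _ m] exI[of _ 0]) (auto simp: f'_def)
    next
      case F: False
      have "Polynomial.degree f' < Polynomial.degree f" using cz dle F by (metis leading_coeff_0_iff le_neq_implies_less)
      from less(1)[OF this f'] obtain q r where qr: "poly_in K q" "poly_in K r" "f' = h * q + r" "r = 0 \<or> Polynomial.degree r < Polynomial.degree h" by blast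
      then show ?thesis using m
        by (intro exI[of _ "q + m"] exI[of _ r]) (auto simp: f'_def algebra_simps intro: poly_in_intros[OF s])
    qed
  qed
qed

lemma poly_in_root_factor:
  assumes K: "subf K" and f: "poly_in K f" and r: "r \<in> K" "poly f r = 0"
  obtains q where "poly_in K q" "f = [:-r, 1:] * q"
proof -
  note s = subf_subr[OF K]
  have l: "poly_in K [:-r, 1:]" by (intro poly_in_intros[OF s] subr_intros[OF s] r)
  obtain q t where qt: "poly_in K q" "f = [:-r,1:] * q + t" "t = 0 \<or> Polynomial.degree t < 1"
    using poly_in_division[OF K l _ f] by auto
  obtain c where "t = [:c:]" using qt(3) degree_eq_zeroE[of t] by force
  then have "t = 0" using arg_cong[OF qt(2), of "\<lambda>f. poly f r"] r(2) by simp
  then show thesis using that qt by simp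
qed

text \<open>A nonzero combination of \<open>f\<close> and \<open>g\<close> of least degree divides
  \<open>f\<close>, since the remainder is again a combination. The degree bound holds because a
  nonzero \<open>g\<close> itself competes for the minimum; for \<open>g = pderiv f\<close> it
  forces \<open>h\<close> to have smaller degree than \<open>f\<close>.\<close>

lemma poly_in_bezout:
  assumes K: "subf K" and f: "poly_in K f" "f \<noteq> 0" and g: "poly_in K g"
  obtains h u v k where "poly_in K h" "h \<noteq> 0" "poly_in K u" "poly_in K v" "h = u * f + v * g"
     "poly_in K k" "f = h * k" "Polynomial.degree h \<le> Polynomial.degree g \<or> g = 0"
proof -
  note s = subf_subr[OF K]
  define P where "P h \<longleftrightarrow> h \<noteq> 0 \<and> (\<exists>u v. poly_in K u \<and> poly_in K v \<and> h = u * f + v * g)" for h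
  have "P f" unfolding P_def using f poly_in_intros(1,2)[OF s]
    by (intro conjI exI[of _ 1] exI[of _ 0]) auto
  then obtain h where h: "P h" "\<And>h'. P h' \<Longrightarrow> Polynomial.degree h \<le> Polynomial.degree h'"
    using arg_min_nat_lemma[of P f Polynomial.degree] by metis
  then obtain u v where uv: "h \<noteq> 0" "poly_in K u" "poly_in K v" "h = u * f + v * g" unfolding P_def by auto
  have hK: "poly_in K h" unfolding uv(4) by (intro poly_in_intros[OF s] uv f g)
  obtain q r where qr: "poly_in K q" "poly_in K r" "f = h * q + r" "r = 0 \<or> Polynomial.degree r < Polynomial.degree h"
    using poly_in_division[OF K hK uv(1) f(1)] by blast
  have "r = (1 - q * u) * f + (- (q * v)) * g" using qr(3) uv(4) by (simp add: algebra_simps)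
  then have "P r" if "r \<noteq> 0" unfolding P_def using that qr uv poly_in_intros[OF s] by metis
  then have r: "r = 0" using h(2)[of r] qr(4) by fastforce
  have "P g" if "g \<noteq> 0" unfolding P_def using that g poly_in_intros(1,2)[OF s]
    by (intro conjI exI[of _ 1] exI[of _ 0]) auto
  then show thesis using that[OF hK uv(1-4) qr(1)] qr(3) r h(2)[of g] by auto
qed

text \<open>Induction on the degree with three cases. If the derivative vanishes, \<open>f\<close>
  is a polynomial in the p-th power of the variable and \<open>x ^ p\<close> is a root of a
  polynomial of smaller degree. If \<open>f\<close> is coprime to its derivative, it has a root in
  \<open>K\<close>, and a linear factor splits off. Otherwise the common factor splits
  \<open>f\<close> properly.\<close>

lemma separably_closed_radicial:
  fixes K :: "'l::field set"
  assumes K: "subf K" and sc: "separably_closed K" and p: "prime p" "CHAR('l) = p"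
  shows "poly_in K f \<Longrightarrow> f \<noteq> 0 \<Longrightarrow> poly f x = 0 \<Longrightarrow> \<exists>n. x ^ p ^ n \<in> K"
proof (induction "Polynomial.degree f" arbitrary: f x rule: less_induct)
  case less
  note s = subf_subr[OF K]
  have split: ?case if gh: "f = g * h" "poly_in K g" "poly_in K h" "Polynomial.degree g < Polynomial.degree f" "Polynomial.degree h < Polynomial.degree f" for g h
  proof -
    have "g \<noteq> 0" "h \<noteq> 0" using gh(1) less(3) by auto
    moreover have "poly g x = 0 \<or> poly h x = 0" using gh(1) less(4) by simp
    ultimately show ?case using less(1)[of g x] less(1)[of h x] gh by argo
  qed
  have d: "Polynomial.degree f > 0"
  proof (rule ccontr)
    assume "\<not> Polynomial.degree f > 0" then obtain c where "f = [:c:]" using degree_eq_zeroE by blast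
    then show False using less(3,4) by simp
  qed
  show ?case
  proof (cases "pderiv f = 0")
    case True
    have co: "Polynomial.coeff f j = 0" if "\<not> p dvd j" for j
    proof -
      obtain i where "j = Suc i" using \<open>\<not> p dvd j\<close> by (cases j) auto
      then have "of_nat j * Polynomial.coeff f j = 0" using True by (metis coeff_0 coeff_pderiv)
      then show ?thesis using that p(2) of_nat_eq_0_iff_char_dvd[of j, where 'a='l] by auto
    qed
    define d where "d = Polynomial.degree f"
    \<comment> \<open>The polynomial that gives \<open>f\<close> when evaluated at the p-th power of
      the variable. Summing up to \<open>d\<close> instead of \<open>d\<close> divided by
      \<open>p\<close> is harmless: the additional coefficients lie beyond the degree of
      \<open>f\<close> and are zero.\<close>
    define g where "g = (\<Sum>i\<le>d. Polynomial.monom (Polynomial.coeff f (i * p)) i)"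
    have g: "poly_in K g" unfolding g_def using less(2) by (intro poly_in_sum[OF s] poly_in_intros(9)[OF s]) (simp add: poly_in_def)
    have p0: "p > 1" using p prime_gt_1_nat by blast
    have cg: "Polynomial.coeff g i = Polynomial.coeff f (i * p)" for i
    proof -
      have "Polynomial.coeff g i = (\<Sum>k\<le>d. if k = i then Polynomial.coeff f (k * p) else 0)"
        by (simp add: g_def coeff_sum)
      also have "\<dots> = (if i \<le> d then Polynomial.coeff f (i * p) else 0)" by (simp add: sum.delta)
      also have "\<dots> = Polynomial.coeff f (i * p)"
      proof (cases "i \<le> d")
        case False
        then have "Polynomial.degree f < i * p" using p0
          by (intro order.strict_trans2[of _ i "i * p"]) (auto simp: d_def)
        then show ?thesis using False by (simp add: coeff_eq_0)
      qed simp
      finally show ?thesis .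
    qed
    have "poly f x = (\<Sum>j\<le>d * p. Polynomial.coeff f j * x ^ j)"
      unfolding poly_altdef d_def using p0
      by (intro sum.mono_neutral_left) (auto simp: coeff_eq_0 intro: order.trans[of _ "Polynomial.degree f"])
    also have "\<dots> = (\<Sum>j\<in>(\<lambda>i. i * p) ` {..d}. Polynomial.coeff f j * x ^ j)"
    proof (rule sum.mono_neutral_right)
      show "\<forall>j\<in>{..d * p} - (\<lambda>i. i * p) ` {..d}. Polynomial.coeff f j * x ^ j = 0"
      proof
        fix j assume j: "j \<in> {..d * p} - (\<lambda>i. i * p) ` {..d}"
        have "\<not> p dvd j"
        proof
          assume "p dvd j"
          then obtain k where "j = k * p" by (metis dvdE mult.commute)
          then show False using j p0 by auto
        qed
        then show "Polynomial.coeff f j * x ^ j = 0" by (simp add: co)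
      qed
    qed auto
    also have "\<dots> = (\<Sum>i\<le>d. Polynomial.coeff f (i * p) * x ^ (i * p))"
      using p0 by (subst sum.reindex) (auto simp: inj_on_def)
    also have "\<dots> = poly g (x ^ p)"
      by (simp add: g_def poly_sum poly_monom power_mult[symmetric] mult.commute)
    finally have gx: "poly g (x ^ p) = 0" using less(4) by simp
    have "p dvd d" using co[of d] less(3) by (auto simp: d_def)
    then obtain e where e: "d = e * p" by (metis dvdE mult.commute)
    have g0: "g \<noteq> 0" using cg[of e] e less(3) d_def leading_coeff_0_iff by (metis coeff_0)
    have "e < d" using e d p0 d_def by auto
    moreover have "Polynomial.degree g \<le> e"
    proof (rule degree_le, intro allI impI)
      fix i assume "e < i"
      then have "d < i * p" using e p0 by simp
      then show "Polynomial.coeff g i = 0" by (simp add: cg d_def coeff_eq_0)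
    qed
    ultimately have "Polynomial.degree g < Polynomial.degree f" by (simp add: d_def)
    from less(1)[OF this g g0 gx] obtain n where "(x ^ p) ^ p ^ n \<in> K" by auto
    then have "x ^ p ^ Suc n \<in> K" by (simp add: power_mult[symmetric])
    then show ?thesis by (rule exI)
  next
    case False
    have f': "poly_in K (pderiv f)" by (rule poly_in_pderiv[OF s less(2)])
    obtain h u v k where h: "poly_in K h" "h \<noteq> 0" "poly_in K u" "poly_in K v" "h = u * f + v * pderiv f"
     "poly_in K k" "f = h * k" "Polynomial.degree h \<le> Polynomial.degree (pderiv f)"
      using poly_in_bezout[OF K less(2,3) f'] False by metis
    have dh: "Polynomial.degree h < Polynomial.degree f" proof -
      have "Polynomial.degree (pderiv f) \<le> Polynomial.degree f - 1"
        by (rule degree_le) (auto simp: coeff_pderiv coeff_eq_0)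
      then show ?thesis using h(8) d by linarith
    qed
    have k0: "k \<noteq> 0" using h(7) less(3) by auto
    show ?thesis
    proof (cases "Polynomial.degree h = 0")
      case True
      then have uh: "is_unit h" using h(2) by (simp add: is_unit_iff_degree)
      \<comment> \<open>The Bezout identity over \<open>K\<close> also certifies coprimality over
        the ambient field, which is where \<open>separably_closed\<close> tests it.\<close>
      have "coprime f (pderiv f)"
      proof (rule coprimeI)
        fix c assume "c dvd f" "c dvd pderiv f"
        then have "c dvd h" unfolding h(5) by (intro dvd_add dvd_mult)
        then show "is_unit c" using uh by (rule dvd_trans)
      qed
      then obtain r where r: "r \<in> K" "poly f r = 0" using sc less(2) d unfolding separably_closed_def poly_in_def by blast
      obtain q where q: "poly_in K q" and f: "f = [:-r,1:] * q"
        using poly_in_root_factor[OF K less(2) r] by metis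
      have q0: "q \<noteq> 0" using f less(3) by auto
      have "poly [:-r,1:] x = 0 \<or> poly q x = 0" using less(4) arg_cong[OF f, of "\<lambda>f. poly f x"] by (simp only: poly_mult mult_eq_0_iff)
      then show ?thesis
      proof
        assume "poly [:-r,1:] x = 0" then have "x = r" by simp
        then show ?thesis using r by (intro exI[of _ 0]) simp
      next
        assume "poly q x = 0"
        moreover have "Polynomial.degree q < Polynomial.degree f" unfolding f using q0 by (subst degree_mult_eq) auto
        ultimately show ?thesis by (intro less(1)[of q x] q q0)
      qed
    next
      case False
      then have "Polynomial.degree k < Polynomial.degree f" using h(2) k0 arg_cong[OF h(7), of Polynomial.degree] by (simp add: degree_mult_eq)
      then show ?thesis by (rule split[OF h(7) h(1) h(6) dh])
    qed
  qed
qed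

text \<open>Bridge between the two kinds of polynomials: coefficient lists evaluated in a ring
  record have the leading coefficient first, the polynomials of the type class have the constant
  term first, hence the reversal.\<close>

lemma subring_rec_eval:
  assumes S: "subr S" and xs: "set xs \<subseteq> S" and a: "a \<in> S"
  shows "ring.eval (subring_rec S) xs a = poly (Poly (rev xs)) a"
proof -
  interpret cring "subring_rec S" by (rule cring_subring_rec[OF S])
  have pw: "a [^]\<^bsub>subring_rec S\<^esub> n = a ^ n" for n :: nat
    by (induction n) (auto simp: mult.commute)
  show ?thesis using xs
    by (induction xs) (auto simp: Poly_append poly_monom pw)
qed

lemma algebraic_closure_root_over:
  fixes K Kbar :: "'l::field set"
  assumes "algebraic_closure (subring_rec Kbar) K" "subf Kbar" "x \<in> Kbar"
  obtains f where "poly_in K f" "f \<noteq> 0" "poly f x = 0"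
proof -
  interpret algebraic_closure "subring_rec Kbar" K by fact
  have sk: "subfield K (subring_rec Kbar)" by (rule subfield_axioms)
  have Ks: "K \<subseteq> Kbar" using subfieldE(3)[OF sk] by simp
  have zK: "0 \<in> K" using subringE(2)[OF subfieldE(1)[OF sk]] by simp
  have "(algebraic over K) x" using algebraic_extension[of x] assms(3) by simp
  then obtain P where P: "P \<in> carrier (K[X]\<^bsub>subring_rec Kbar\<^esub>)" "P \<noteq> []" "eval P x = 0"
    using algebraicE[OF subfieldE(1)[OF sk], of x] assms(3) by (auto simp: over_def)
  have Pp: "set P \<subseteq> K" "hd P \<noteq> 0" using P(1,2) by (auto simp: univ_poly_def polynomial_def)
  show thesis
  proof (rule that[of "Poly (rev P)"])
    show "poly_in K (Poly (rev P))"
      unfolding poly_in_def using Pp zK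
      by (auto simp: coeff_Poly_eq nth_default_def) (metis Pp(1) length_rev nth_mem set_rev subsetD)
    show "Poly (rev P) \<noteq> 0"
      using P(2) Pp(2) by (auto simp: Poly_eq_0) (metis hd_in_set in_set_replicate set_rev)
    show "poly (Poly (rev P)) x = 0"
      using subring_rec_eval[OF subf_subr[OF assms(2)] _ assms(3), of P] Pp(1) Ks P(3) by auto
  qed
qed

lemma algebraic_closure_root:
  fixes K Kbar :: "'l::field set"
  assumes "algebraic_closure (subring_rec Kbar) K" and Kb: "subf Kbar" and f: "poly_in Kbar f" "Polynomial.degree f > 0"
  obtains x where "x \<in> Kbar" "poly f x = 0"
proof -
  interpret algebraic_closure "subring_rec Kbar" K by fact
  define P where "P = rev (coeffs f)"
  have f0: "f \<noteq> 0" using f by auto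
  have sP: "set P \<subseteq> Kbar" using f(1) by (auto simp: P_def poly_in_def set_coeffs_subset_singleton_0_iff coeffs_def)
  have deg: "Polynomials.degree P = Polynomial.degree f"
    by (auto simp: P_def degree_eq_length_coeffs)
  have carrier_P: "P \<in> carrier (poly_ring (subring_rec Kbar))"
    using sP f0 by (auto simp: univ_poly_def polynomial_def P_def hd_rev last_coeffs_eq_coeff_degree)
  hence "splitted P"
    using roots_over_carrier by blast
  hence "roots P \<noteq> {#}"
    unfolding splitted_def using deg f by auto
  then obtain x where "x \<in># roots P"
    by blast
  hence x: "is_root P x"
    using roots_mem_iff_is_root[OF carrier_P] by auto
  hence "x \<in> Kbar" by (auto simp: is_root_def)
  moreover have "poly f x = 0"
    using subring_rec_eval[OF subf_subr[OF Kb] sP \<open>x \<in> Kbar\<close>] x by (simp add: is_root_def P_def)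
  ultimately show thesis using that by blast
qed

section \<open>Submodules and finite spans\<close>

definition submod :: "'l::field set \<Rightarrow> 'l set \<Rightarrow> bool" where
  "submod E M \<longleftrightarrow> 0 \<in> M \<and> (\<forall>x\<in>M. \<forall>y\<in>M. x + y \<in> M) \<and> (\<forall>e\<in>E. \<forall>x\<in>M. e * x \<in> M)"

lemma submodD:
  assumes "submod E M"
  shows "0 \<in> M" "x \<in> M \<Longrightarrow> y \<in> M \<Longrightarrow> x + y \<in> M" "e \<in> E \<Longrightarrow> x \<in> M \<Longrightarrow> e * x \<in> M"
  using assms by (auto simp: submod_def)

lemma submod_diff: "subr E \<Longrightarrow> submod E M \<Longrightarrow> x \<in> M \<Longrightarrow> y \<in> M \<Longrightarrow> x - y \<in> M"
  using submodD(2)[of E M x "-1 * y"] submodD(3)[of E M "-1" y] by (auto intro: subr_intros)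

lemma submod_mono: "submod E M \<Longrightarrow> E' \<subseteq> E \<Longrightarrow> submod E' M"
  by (auto simp: submod_def)

lemma ideal_in_submod: "ideal_in S I \<Longrightarrow> submod S I"
  by (auto simp: ideal_in_def submod_def)

text \<open>The summand \<open>M\<close> replaces the passage to a quotient by \<open>M\<close>. It
  is \<open>{0}\<close> for finiteness over p-th powers, the maximal ideal in Zariski's lemma, and
  an ideal generated by a conductor multiple in the quotient of \<open>A\<close>.\<close>

fun lspan :: "'l::field set \<Rightarrow> 'l set \<Rightarrow> 'l list \<Rightarrow> 'l set" where
  "lspan E M [] = M"
| "lspan E M (s # ss) = {e * s + z | e z. e \<in> E \<and> z \<in> lspan E M ss}"

lemma lspan_submod:
  assumes "subr E" "submod E M" shows "submod E (lspan E M ss)"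
proof (induction ss)
  case Nil then show ?case using assms by simp
next
  case (Cons s ss)
  note D = submodD[OF Cons]
  have "0 \<in> lspan E M (s # ss)" using D(1) subr_zero[OF assms(1)] by force
  moreover have "x + y \<in> lspan E M (s # ss)" if "x \<in> lspan E M (s # ss)" "y \<in> lspan E M (s # ss)" for x y
  proof -
    from that obtain e z e' z' where *: "x = e * s + z" "y = e' * s + z'" "e \<in> E" "e' \<in> E" "z \<in> lspan E M ss" "z' \<in> lspan E M ss" by auto
    have "x + y = (e + e') * s + (z + z')" using * by (simp add: algebra_simps)
    moreover have "e + e' \<in> E" "z + z' \<in> lspan E M ss" using * D subr_add[OF assms(1)] by auto
    ultimately show ?thesis unfolding lspan.simps by blast
  qed
  moreover have "r * x \<in> lspan E M (s # ss)" if "r \<in> E" "x \<in> lspan E M (s # ss)" for r x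
  proof -
    from that obtain e z where *: "x = e * s + z" "e \<in> E" "z \<in> lspan E M ss" by auto
    have "r * x = (r * e) * s + r * z" using * by (simp add: algebra_simps)
    moreover have "r * e \<in> E" "r * z \<in> lspan E M ss" using * D that subr_mult[OF assms(1)] by auto
    ultimately show ?thesis unfolding lspan.simps by blast
  qed
  ultimately show ?case unfolding submod_def by blast
qed

lemma lspan_base: "subr E \<Longrightarrow> M \<subseteq> lspan E M ss"
proof (induction ss)
  case (Cons s ss) then show ?case using subr_zero[of E] by force
qed simp

lemma lspan_mem:
  assumes "subr E" "submod E M" shows "s \<in> set ss \<Longrightarrow> s \<in> lspan E M ss"
proof (induction ss)
  case (Cons t ss)
  have z: "0 \<in> lspan E M ss" using submodD(1)[OF lspan_submod[OF assms]] .
  show ?case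
  proof (cases "s = t")
    case True then show ?thesis using z subr_one[OF assms(1)] by force
  next
    case False then show ?thesis using Cons subr_zero[OF assms(1)] by force
  qed
qed simp

lemma lspan_least: "submod E N \<Longrightarrow> M \<subseteq> N \<Longrightarrow> set ss \<subseteq> N \<Longrightarrow> lspan E M ss \<subseteq> N"
proof (induction ss)
  case (Cons s ss) then show ?case using submodD(2,3)[OF Cons(2)] by auto
qed simp

lemma lspan_mono: "subr E \<Longrightarrow> submod E M \<Longrightarrow> set ss \<subseteq> set ts \<Longrightarrow> lspan E M ss \<subseteq> lspan E M ts"
  by (intro lspan_least lspan_submod lspan_base) (auto intro: lspan_mem)

lemma lspan_mult_closed:
  assumes "submod E W" "\<And>s. s \<in> set ss \<Longrightarrow> a * s \<in> W" "\<And>x. x \<in> M \<Longrightarrow> a * x \<in> W" "z \<in> lspan E M ss"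
  shows "a * z \<in> W"
proof -
  have "submod E {z. a * z \<in> W}"
    using submodD[OF assms(1)] by (auto simp: submod_def distrib_left mult.left_commute)
  then have "lspan E M ss \<subseteq> {z. a * z \<in> W}" by (rule lspan_least) (use assms in auto)
  then show ?thesis using assms(4) by auto
qed

lemma lspan_clear:
  assumes E: "subr E" and frac: "\<And>q. q \<in> Q \<Longrightarrow> \<exists>e\<in>E. e \<noteq> 0 \<and> e * q \<in> E" and M: "submod E M"
  shows "z \<in> lspan Q M ss \<Longrightarrow> \<exists>d\<in>E. d \<noteq> 0 \<and> d * z \<in> lspan E M ss"
proof (induction ss arbitrary: z)
  case Nil then show ?case using subr_one[OF E] by (intro bexI[of _ 1]) auto
next
  case (Cons s ss)
  then obtain q y where z: "z = q * s + y" "q \<in> Q" "y \<in> lspan Q M ss" by auto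
  obtain d where d: "d \<in> E" "d \<noteq> 0" "d * y \<in> lspan E M ss" using Cons(1)[OF z(3)] by auto
  obtain e where e: "e \<in> E" "e \<noteq> 0" "e * q \<in> E" using frac[OF z(2)] by auto
  have "(d * e) * z = (d * (e * q)) * s + e * (d * y)" using z by (simp add: algebra_simps)
  moreover have "d * (e * q) \<in> E" using d e subr_mult[OF E] by auto
  moreover have "e * (d * y) \<in> lspan E M ss" using submodD(3)[OF lspan_submod[OF E M]] d e by auto
  ultimately have "(d * e) * z \<in> lspan E M (s # ss)" by auto
  then show ?case using d e subr_mult[OF E] by (intro bexI[of _ "d * e"]) auto
qed

text \<open>The list \<open>ss\<close> may consist of arbitrary elements of the ambient field, so
  induction removes them one by one. If \<open>s\<close> lies in the \<open>Q\<close>-span of the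
  rest, its denominator is cleared. If not, \<open>s\<close> occurs with coefficient zero in every
  element of \<open>Q\<close>, for otherwise \<open>s\<close> could be solved for; the entry
  \<open>1\<close> at the end ensures that elements of \<open>Q\<close> are themselves in that
  span.\<close>

lemma common_denominator:
  assumes E: "subr E" and Q: "subf Q" "E \<subseteq> Q" and frac: "\<And>q. q \<in> Q \<Longrightarrow> \<exists>e\<in>E. e \<noteq> 0 \<and> e * q \<in> E"
    and M: "submod Q M" "\<And>x. x \<in> M \<Longrightarrow> x \<in> Q \<Longrightarrow> x = 0"
  shows "\<exists>c\<in>E. c \<noteq> 0 \<and> (\<forall>z\<in>Q \<inter> lspan E M (ss @ [1]). c * z \<in> E)"
proof (induction ss)
  case Nil
  have "z \<in> E" if z: "z \<in> Q" "z \<in> lspan E M [1]" for z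
  proof -
    obtain e m where em: "z = e + m" "e \<in> E" "m \<in> M" using z by auto
    have "m \<in> Q" using subr_diff[OF subf_subr[OF Q(1)] z(1), of e] em Q(2) by auto
    then show ?thesis using M(2)[of m] em by auto
  qed
  then show ?case using subr_one[OF E] by (intro bexI[of _ 1]) auto
next
  case (Cons s ss)
  then obtain c where c: "c \<in> E" "c \<noteq> 0" "\<And>z. z \<in> Q \<Longrightarrow> z \<in> lspan E M (ss @ [1]) \<Longrightarrow> c * z \<in> E" by auto
  note ME = submod_mono[OF M(1) Q(2)]
  note sE = lspan_submod[OF E ME] and sQ = lspan_submod[OF subf_subr[OF Q(1)] M(1)]
  show ?case
  proof (cases "s \<in> lspan Q M (ss @ [1])")
    case True
    obtain d where d: "d \<in> E" "d \<noteq> 0" "d * s \<in> lspan E M (ss @ [1])" using lspan_clear[OF E frac ME True] by auto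
    have "(c * d) * z \<in> E" if z: "z \<in> Q" "z \<in> lspan E M (s # ss @ [1])" for z
    proof -
      obtain e y where y: "z = e * s + y" "e \<in> E" "y \<in> lspan E M (ss @ [1])" using z by auto
      have "d * z = e * (d * s) + d * y" using y by (simp add: algebra_simps)
      then have "d * z \<in> lspan E M (ss @ [1])" using submodD[OF sE] d y by auto
      moreover have "d * z \<in> Q" using d z Q subr_mult[OF subf_subr] by auto
      ultimately show ?thesis using c(3)[of "d * z"] by (simp add: mult.assoc)
    qed
    then show ?thesis using c d subr_mult[OF E] by (intro bexI[of _ "c * d"]) auto
  next
    case False
    have "c * z \<in> E" if z: "z \<in> Q" "z \<in> lspan E M (s # ss @ [1])" for z
    proof -
      obtain e y where y: "z = e * s + y" "e \<in> E" "y \<in> lspan E M (ss @ [1])" using z by auto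
      have yQ: "y \<in> lspan Q M (ss @ [1])"
        using y(3) lspan_least[OF submod_mono[OF sQ Q(2)] lspan_base[OF subf_subr[OF Q(1)]], of "ss @ [1]"]
          lspan_mem[OF subf_subr[OF Q(1)] M(1)] by blast
      have o: "1 \<in> lspan Q M (ss @ [1])" by (rule lspan_mem[OF subf_subr[OF Q(1)] M(1)]) simp
      have "e = 0"
      proof (rule ccontr)
        assume e: "e \<noteq> 0"
        have "s = (z / e) * 1 - inverse e * y" using y e by (simp add: field_simps)
        moreover have "(z / e) * 1 \<in> lspan Q M (ss @ [1])" "inverse e * y \<in> lspan Q M (ss @ [1])"
          using submodD(3)[OF sQ _ o, of "z / e"] submodD(3)[OF sQ _ yQ, of "inverse e"] z y Q
          by (auto intro: subf_divide subf_inverse)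
        ultimately have "s \<in> lspan Q M (ss @ [1])" using submod_diff[OF subf_subr[OF Q(1)] sQ] by metis
        then show False using False by simp
      qed
      then show ?thesis using y c z by simp
    qed
    then show ?thesis using c by auto
  qed
qed

text \<open>The list consists of products of powers \<open>a ^ i\<close> with \<open>i < N\<close>,
  built one generator at a time. Multiplication by \<open>a\<close> either raises an exponent below
  the bound or reaches \<open>a ^ N\<close>, which the relation rewrites in lower powers. That
  \<open>M\<close> is stable under all of \<open>T\<close> keeps the error terms in
  \<open>M\<close>.\<close>

lemma finite_monomial_span:
  assumes T: "subr T" and E: "subr E" "E \<subseteq> T" and M: "submod T M"
  shows "set as \<subseteq> T \<Longrightarrow> (\<And>a. a \<in> set as \<Longrightarrow> \<exists>N>0. a ^ N \<in> lspan E M (map ((^) a) [0..<N])) \<Longrightarrow>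
    \<exists>ms. 1 \<in> set ms \<and> set ms \<subseteq> T \<and> (\<forall>a\<in>set as. \<forall>z\<in>lspan E M ms. a * z \<in> lspan E M ms)"
proof (induction as)
  case Nil then show ?case using subr_one[OF T] by (intro exI[of _ "[1]"]) auto
next
  case (Cons a as)
  note ME = submod_mono[OF M E(2)]
  obtain ms where ms: "1 \<in> set ms" "set ms \<subseteq> T" "\<And>b z. b \<in> set as \<Longrightarrow> z \<in> lspan E M ms \<Longrightarrow> b * z \<in> lspan E M ms"
    using Cons by auto
  obtain N where N: "N > 0" "a ^ N \<in> lspan E M (map ((^) a) [0..<N])" using Cons(3)[of a] by auto
  have aT: "a \<in> T" using Cons(2) by simp
  define ms' where "ms' = concat (map (\<lambda>m. map (\<lambda>i. m * a ^ i) [0..<N]) ms)"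
  have set': "set ms' = {m * a ^ i | m i. m \<in> set ms \<and> i < N}" by (force simp: ms'_def)
  define W where "W = lspan E M ms'"
  have W: "submod E W" "M \<subseteq> W" unfolding W_def by (intro lspan_submod lspan_base E ME)+
  have memW: "m * a ^ i \<in> W" if "m \<in> set ms" "i < N" for m i
    unfolding W_def by (rule lspan_mem[OF E(1) ME]) (use that set' in auto)
  have MM: "t * x \<in> W" if "t \<in> T" "x \<in> M" for t x using submodD(3)[OF M that] W(2) by auto
  have pw: "a ^ i * z \<in> W" if "z \<in> lspan E M ms" "i < N" for z i
    by (rule lspan_mult_closed[OF W(1) _ _ that(1)]) (use that memW MM subr_power[OF T aT] in \<open>auto simp: mult.commute[of "a ^ i"]\<close>, metis mult.commute)
  have "1 \<in> set ms'" unfolding set' using ms(1) N(1) by (intro CollectI exI[of _ 1] exI[of _ 0]) auto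
  moreover have "set ms' \<subseteq> T" unfolding set' using ms(2) aT by (auto intro!: subr_intros T)
  moreover have "b * z \<in> W" if b: "b \<in> set (a # as)" and z: "z \<in> W" for b z
  proof (rule lspan_mult_closed[OF W(1) _ _ z[unfolded W_def]])
    show "b * x \<in> W" if "x \<in> M" for x using MM that b Cons(2) by auto
    fix s assume "s \<in> set ms'"
    then obtain m i where s: "s = m * a ^ i" "m \<in> set ms" "i < N" unfolding set' by auto
    show "b * s \<in> W"
    proof (cases "b \<in> set as")
      case True
      have "b * m \<in> lspan E M ms" using ms(3)[OF True lspan_mem[OF E(1) ME s(2)]] .
      then have "a ^ i * (b * m) \<in> W" using pw s by auto
      then show ?thesis unfolding s by (simp add: algebra_simps)
    next
      case False
      then have ba: "b = a" using b by simp
      show ?thesis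
      proof (cases "Suc i < N")
        case True then show ?thesis using memW[OF s(2) True] unfolding s ba by (simp add: algebra_simps)
      next
        case False
        then have i: "Suc i = N" using s by simp
        have "m * a ^ N \<in> W"
          by (rule lspan_mult_closed[OF W(1) _ _ N(2)]) (use memW s ms(2) MM in auto)
        then show ?thesis unfolding s ba i[symmetric] by (simp add: algebra_simps)
      qed
    qed
  qed
  ultimately show ?case unfolding W_def by blast
qed

text \<open>Turns a statement about generators into one about the whole ring: once the generators
  multiply \<open>W\<close> into itself, everything they generate does, and \<open>1 \<in> W\<close>
  then places the ring inside \<open>W\<close>.\<close>

lemma multiplier_subr:
  assumes T: "subr T" and E: "subr E" and W: "submod E W"
  shows "subr {r \<in> T. \<forall>z\<in>W. r * z \<in> W}"
proof (rule subrI)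
  show "x + y \<in> {r \<in> T. \<forall>z\<in>W. r * z \<in> W}" if "x \<in> {r \<in> T. \<forall>z\<in>W. r * z \<in> W}" "y \<in> {r \<in> T. \<forall>z\<in>W. r * z \<in> W}" for x y
    using that submodD[OF W] subr_add[OF T] by (auto simp: distrib_right)
  show "- x \<in> {r \<in> T. \<forall>z\<in>W. r * z \<in> W}" if "x \<in> {r \<in> T. \<forall>z\<in>W. r * z \<in> W}" for x
    using that submod_diff[OF E W submodD(1)[OF W]] subr_uminus[OF T] by auto
qed (use subr_one[OF T] subr_mult[OF T] in \<open>auto simp: mult.assoc\<close>)

section \<open>Frobenius conductors\<close>

definition frob_image :: "nat \<Rightarrow> 'l::field set \<Rightarrow> 'l set" where
  "frob_image p A = (\<lambda>x. x ^ p) ` A"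

lemma frob_image_subr:
  fixes A :: "'l::field set"
  assumes p: "prime p" "CHAR('l) = p" and A: "subr A"
  shows "subr (frob_image p A)" "frob_image p A \<subseteq> A"
proof -
  have "x ^ p - y ^ p = (x - y) ^ p" for x y :: 'l using frob_diff[OF p, of x y 1] by simp
  then show "subr (frob_image p A)" unfolding subr_def frob_image_def
    using subr_intros[OF A] by (auto simp: power_mult_distrib[symmetric] image_iff) (metis power_one)+
  show "frob_image p A \<subseteq> A" using subr_power[OF A] by (auto simp: frob_image_def)
qed

text \<open>The conductor is uniform in \<open>n\<close>: if \<open>c\<close> works for \<open>n = 1\<close>, then \<open>c\<^sup>2\<close> works for all \<open>n\<close>, because
  \<open>c\<^sup>2 z\<^sup>p \<in> A\<close> implies \<open>(c z)\<^sup>p \<in> A\<close>.\<close>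

lemma frobenius_conductor:
  fixes A L :: "'l::field set"
  assumes p: "prime p" "CHAR('l) = p" and A: "subr A" and L: "subf L" "A \<subseteq> L"
    and frac: "\<And>q. q \<in> L \<Longrightarrow> \<exists>e\<in>A. e \<noteq> 0 \<and> e * q \<in> A"
    and fin: "A \<subseteq> lspan (frob_image p A) {0} ms"
  shows "\<exists>c\<in>A. c \<noteq> 0 \<and> (\<forall>z\<in>L. \<forall>n. z ^ p ^ n \<in> A \<longrightarrow> c * z \<in> A)"
proof -
  define E where "E = frob_image p A"
  define Q where "Q = frob_image p L"
  have E: "subr E" "E \<subseteq> A" unfolding E_def using frob_image_subr[OF p A] by auto
  have Qs: "subr Q" unfolding Q_def using frob_image_subr[OF p subf_subr[OF L(1)]] by auto
  have Q: "subf Q" unfolding subf_def using Qs subf_inverse[OF L(1)]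
    by (auto simp: Q_def frob_image_def power_inverse[symmetric])
  have EQ: "E \<subseteq> Q" using L(2) by (auto simp: E_def Q_def frob_image_def)
  have fr: "\<exists>e\<in>E. e \<noteq> 0 \<and> e * q \<in> E" if q: "q \<in> Q" for q
  proof -
    obtain l where l: "l \<in> L" "q = l ^ p" using q unfolding Q_def frob_image_def by blast
    obtain e where e: "e \<in> A" "e \<noteq> 0" "e * l \<in> A" using frac[OF l(1)] by auto
    then show ?thesis using l by (intro bexI[of _ "e ^ p"]) (auto simp: E_def frob_image_def power_mult_distrib[symmetric])
  qed
  have z: "submod Q {0}" by (auto simp: submod_def)
  \<comment> \<open>The denominator is sought inside the ring of p-th powers, so it is itself some
    \<open>c ^ p\<close>. Thus \<open>(c * z) ^ p\<close> is the p-th power of an element of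
    \<open>A\<close>, and injectivity of Frobenius gives \<open>c * z \<in> A\<close>.\<close>
  obtain c' where c': "c' \<in> E" "c' \<noteq> 0" "\<forall>z\<in>Q \<inter> lspan E {0} (ms @ [1]). c' * z \<in> E"
    using common_denominator[OF E(1) Q EQ fr z, of ms] by auto
  obtain c where c: "c' = c ^ p" "c \<in> A" using c'(1) by (auto simp: E_def frob_image_def)
  have c0: "c \<noteq> 0" using c c' prime_gt_0_nat[OF p(1)] by (auto simp: power_0_left)
  have ms: "A \<subseteq> lspan E {0} (ms @ [1])"
    using fin lspan_mono[OF E(1) submod_mono[OF z EQ], of ms "ms @ [1]"] by (auto simp: E_def)
  have one: "c * z \<in> A" if z: "z \<in> L" "z ^ p \<in> A" for z
  proof -
    have "z ^ p \<in> Q" using z by (auto simp: Q_def frob_image_def)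
    then have "c' * z ^ p \<in> E" using c' ms z by auto
    then obtain y where y: "y \<in> A" "(c * z) ^ p = y ^ p" by (auto simp: E_def frob_image_def c(1) power_mult_distrib)
    then have "c * z = y" using frob_inj[OF p, of "c * z" 1 y] by simp
    then show ?thesis using y by simp
  qed
  have p2: "p \<ge> 2" using prime_ge_2_nat[OF p(1)] .
  have main: "z \<in> L \<Longrightarrow> z ^ p ^ n \<in> A \<Longrightarrow> c ^ 2 * z \<in> A" for n z
  proof (induction n arbitrary: z)
    case 0 then show ?case using subr_mult[OF A subr_power[OF A c(2)]] by auto
  next
    case (Suc n)
    have "c ^ 2 * z ^ p \<in> A" using Suc(1)[of "z ^ p"] Suc(2,3) subr_power[OF subf_subr[OF L(1)]]
      by (auto simp: power_mult[symmetric])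
    then have "c ^ (p - 2) * (c ^ 2 * z ^ p) \<in> A" using subr_mult[OF A subr_power[OF A c(2)]] by auto
    also have "c ^ (p - 2) * (c ^ 2 * z ^ p) = (c * z) ^ p"
    proof -
      have "c ^ p = c ^ (p - 2) * c ^ 2" using p2 by (metis le_add_diff_inverse2 power_add)
      then show ?thesis by (simp add: power_mult_distrib mult.assoc)
    qed
    finally have "(c * z) ^ p \<in> A" .
    moreover have "c * z \<in> L" using subr_mult[OF subf_subr[OF L(1)]] c(2) L(2) Suc(2) by auto
    ultimately show ?case using one[of "c * z"] by (simp add: power2_eq_square mult.assoc)
  qed
  have "c ^ 2 \<noteq> 0" using c0 by simp
  then show ?thesis by (intro bexI[of _ "c ^ 2"] conjI ballI allI impI main subr_power[OF A c(2)])
qed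

section \<open>Radicial extensions\<close>

definition radicial :: "nat \<Rightarrow> 'l::field set \<Rightarrow> 'l set \<Rightarrow> bool" where
  "radicial p S T \<longleftrightarrow> S \<subseteq> T \<and> (\<forall>x\<in>T. \<exists>n. x ^ p ^ n \<in> S)"

definition rad_ideal :: "nat \<Rightarrow> 'l::field set \<Rightarrow> 'l set \<Rightarrow> 'l set" where
  "rad_ideal p T I = {x \<in> T. \<exists>n. x ^ p ^ n \<in> I}"

text \<open>Brings two elements to a common exponent, at which the Frobenius power is
  additive.\<close>

lemma power_lift:
  assumes "\<And>x. x \<in> S \<Longrightarrow> x ^ p \<in> S" "x ^ p ^ n \<in> S" "n \<le> m"
  shows "(x::'l::field) ^ p ^ m \<in> S"
proof -
  have "x ^ p ^ (n + k) \<in> S" for k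
  proof (induction k)
    case (Suc k)
    have "x ^ p ^ (n + Suc k) = (x ^ p ^ (n + k)) ^ p" by (simp add: power_mult[symmetric] mult.commute)
    then show ?case using assms(1)[OF Suc] by simp
  qed (use assms in simp)
  from this[of "m - n"] show ?thesis using assms(3) by simp
qed

lemma ideal_in_power: "subr S \<Longrightarrow> ideal_in S I \<Longrightarrow> x \<in> I \<Longrightarrow> k > 0 \<Longrightarrow> x ^ k \<in> I"
  by (cases k) (auto intro!: ideal_inD(5) subr_power dest: ideal_inD(1))

lemma subr_power_root:
  fixes S :: "'l::field set"
  assumes p: "prime p" "CHAR('l) = p" and S: "subr S"
  shows "subr {x. \<exists>n. x ^ p ^ n \<in> S}"
proof (rule subrI)
  note lift = power_lift[of S p, OF subr_power[OF S]]
  have common: "\<exists>N. x ^ p ^ N \<in> S \<and> y ^ p ^ N \<in> S" if "x ^ p ^ n \<in> S" "y ^ p ^ m \<in> S" for x y n m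
    using lift[OF _ that(1), of "n + m"] lift[OF _ that(2), of "n + m"] by auto
  show "x + y \<in> {x. \<exists>n. x ^ p ^ n \<in> S}" if "x \<in> {x. \<exists>n. x ^ p ^ n \<in> S}" "y \<in> {x. \<exists>n. x ^ p ^ n \<in> S}" for x y
    using that common[of x _ y] subr_add[OF S] by (auto simp: frob_add[OF p]) metis
  show "x * y \<in> {x. \<exists>n. x ^ p ^ n \<in> S}" if "x \<in> {x. \<exists>n. x ^ p ^ n \<in> S}" "y \<in> {x. \<exists>n. x ^ p ^ n \<in> S}" for x y
    using that common[of x _ y] subr_mult[OF S] by (auto simp: power_mult_distrib) metis
qed (use subr_one[OF S] subr_uminus[OF S] in \<open>auto simp: frob_uminus[OF p]\<close>)

text \<open>The elements of the ambient field with some p-power iterate in \<open>S\<close> form a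
  ring, and this ring contains both \<open>Kbar\<close> and \<open>S\<close>.\<close>

lemma radicial_generate:
  fixes S :: "'l::field set"
  assumes p: "prime p" "CHAR('l) = p" and S: "subr S" and K: "radicial p K Kbar" "K \<subseteq> S"
  shows "radicial p S (generate_ring ambient (Kbar \<union> S))"
proof -
  have "\<exists>n. x ^ p ^ n \<in> S" if "x \<in> S" for x using that by (intro exI[of _ 0]) simp
  then have "Kbar \<union> S \<subseteq> {x. \<exists>n. x ^ p ^ n \<in> S}" using K unfolding radicial_def by blast
  then have "generate_ring ambient (Kbar \<union> S) \<subseteq> {x. \<exists>n. x ^ p ^ n \<in> S}"
    by (intro generate_ring_min subr_power_root[OF p S])
  then show ?thesis using generate_ring_incl[of "Kbar \<union> S"] by (auto simp: radicial_def)
qed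

lemma prime_in_power:
  assumes "subr T" "prime_in T q" "x \<in> T" "x ^ k \<in> q" shows "x \<in> q"
  using assms(4)
proof (induction k)
  case 0 then show ?case using assms(2) by (simp add: prime_in_def)
next
  case (Suc k)
  then have "x \<in> q \<or> x ^ k \<in> q" using assms(2,3) subr_power[OF assms(1,3)] by (auto simp: prime_in_def)
  then show ?case using Suc by auto
qed

text \<open>A prime \<open>q\<close> over \<open>P\<close> is forced: \<open>x \<in> q\<close>
  implies that some \<open>x ^ p ^ n\<close> lies in \<open>q\<close> and in \<open>S\<close>, hence
  in \<open>P\<close>, and conversely primality extracts the root. This bijection of spectra is the
  source of every uniqueness statement about points below.\<close>

lemma radicial_prime:
  fixes S T :: "'l::field set"
  assumes p: "prime p" "CHAR('l) = p" and S: "subr S" and T: "subr T" and rad: "radicial p S T" and P: "prime_in S P"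
  shows "prime_in T (rad_ideal p T P)" "rad_ideal p T P \<inter> S = P"
    "prime_in T q \<Longrightarrow> q \<inter> S = P \<Longrightarrow> q = rad_ideal p T P"
proof -
  have PS: "P \<subseteq> S" "S \<subseteq> T" using ideal_inD(1)[OF prime_in_ideal[OF P]] rad by (auto simp: radicial_def)
  have p0: "p > 0" using p by (simp add: prime_gt_0_nat)
  note lift = power_lift[of P p, OF ideal_in_power[OF S prime_in_ideal[OF P] _ p0]]
    and liftS = power_lift[of S p, OF subr_power[OF S]]
  show sub: "rad_ideal p T P \<inter> S = P"
  proof
    show "rad_ideal p T P \<inter> S \<subseteq> P" using prime_in_power[OF S P] by (auto simp: rad_ideal_def)
    show "P \<subseteq> rad_ideal p T P \<inter> S" using PS by (auto simp: rad_ideal_def intro!: exI[of _ 0])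
  qed
  have ad: "x + y \<in> rad_ideal p T P" if xy: "x \<in> rad_ideal p T P" "y \<in> rad_ideal p T P" for x y
  proof -
    obtain n m where nm: "x ^ p ^ n \<in> P" "y ^ p ^ m \<in> P" using xy by (auto simp: rad_ideal_def)
    have "x ^ p ^ (n + m) \<in> P" "y ^ p ^ (n + m) \<in> P" using lift[OF _ nm(1)] lift[OF _ nm(2)] by auto
    then have "(x + y) ^ p ^ (n + m) \<in> P" using ideal_inD(3)[OF prime_in_ideal[OF P]] by (simp add: frob_add[OF p])
    then show ?thesis using xy subr_add[OF T] by (auto simp: rad_ideal_def)
  qed
  have mu: "r * x \<in> rad_ideal p T P" if xy: "x \<in> rad_ideal p T P" "r \<in> T" for x r
  proof -
    obtain n where nm: "x ^ p ^ n \<in> P" using xy by (auto simp: rad_ideal_def)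
    obtain m where m: "r ^ p ^ m \<in> S" using xy(2) rad by (auto simp: radicial_def)
    have "x ^ p ^ (n + m) \<in> P" "r ^ p ^ (n + m) \<in> S" using lift[OF _ nm(1)] liftS[OF _ m(1)] by auto
    then have "(r * x) ^ p ^ (n + m) \<in> P" using ideal_inD(4)[OF prime_in_ideal[OF P]] by (simp add: power_mult_distrib)
    then show ?thesis using xy subr_mult[OF T] by (auto simp: rad_ideal_def)
  qed
  have pr: "a \<in> rad_ideal p T P \<or> b \<in> rad_ideal p T P" if ab: "a \<in> T" "b \<in> T" "a * b \<in> rad_ideal p T P" for a b
  proof -
    obtain n where nm: "(a * b) ^ p ^ n \<in> P" using ab by (auto simp: rad_ideal_def)
    obtain i j where ij: "a ^ p ^ i \<in> S" "b ^ p ^ j \<in> S" using ab rad unfolding radicial_def by blast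
    let ?N = "n + i + j"
    have "a ^ p ^ ?N \<in> S" "b ^ p ^ ?N \<in> S" "(a * b) ^ p ^ ?N \<in> P"
      using lift[OF _ nm(1), of ?N] liftS[OF _ ij(1), of ?N] liftS[OF _ ij(2), of ?N] by auto
    then have "a ^ p ^ ?N \<in> P \<or> b ^ p ^ ?N \<in> P" using P by (auto simp: prime_in_def power_mult_distrib)
    then show ?thesis using ab by (auto simp: rad_ideal_def)
  qed
  have "0 \<in> rad_ideal p T P" using ideal_inD(2)[OF prime_in_ideal[OF P]] sub by auto
  moreover have "1 \<notin> rad_ideal p T P" using P by (auto simp: rad_ideal_def prime_in_def)
  ultimately show "prime_in T (rad_ideal p T P)"
    using ad mu pr by (auto simp: prime_in_def ideal_in_def rad_ideal_def)
  show "q = rad_ideal p T P" if q: "prime_in T q" "q \<inter> S = P"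
  proof
    have iq: "ideal_in T q" using q(1) by (rule prime_in_ideal)
    show "q \<subseteq> rad_ideal p T P"
    proof
      fix x assume x: "x \<in> q"
      then have xT: "x \<in> T" using ideal_inD(1)[OF iq] by auto
      then obtain n where "x ^ p ^ n \<in> S" using rad by (auto simp: radicial_def)
      moreover have "x ^ p ^ n \<in> q" using ideal_in_power[OF T iq x] p0 by simp
      ultimately show "x \<in> rad_ideal p T P" using xT q(2) by (auto simp: rad_ideal_def)
    qed
    show "rad_ideal p T P \<subseteq> q" using prime_in_power[OF T q(1)] q(2) by (auto simp: rad_ideal_def)
  qed
qed

section \<open>Local rings and localization\<close>

definition local_in :: "'l::field set \<Rightarrow> bool" where
  "local_in S \<longleftrightarrow> subr S \<and> ideal_in S (nonunits S)"

lemma nonunits_mult: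
  assumes "subr S" "a \<in> S" "b \<in> S" "a * b \<in> nonunits S" shows "a \<in> nonunits S \<or> b \<in> nonunits S"
  using assms subr_mult[OF assms(1), of "inverse a" "inverse b"] by (auto simp: nonunits_def)

lemma local_prime: "local_in S \<Longrightarrow> prime_in S (nonunits S)"
  using nonunits_mult[of S] subr_one[of S] by (auto simp: local_in_def prime_in_def) (auto simp: nonunits_def)

lemma localizationI: "x = a / b \<Longrightarrow> a \<in> A \<Longrightarrow> b \<in> A - P \<Longrightarrow> x \<in> localization A P"
  unfolding localization_def by blast

lemma localization_subr:
  assumes "subr A" "prime_in A P" shows "subr (localization A P)"
proof (rule subrI)
  have o: "1 \<in> A - P" using assms by (auto simp: prime_in_def subr_one)
  then show "1 \<in> localization A P" by (auto simp: localization_def intro!: exI[of _ 1])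
  have mul: "b * d \<in> A - P" if "b \<in> A - P" "d \<in> A - P" for b d
    using that assms subr_mult[OF assms(1)] by (auto simp: prime_in_def)
  have nz: "b \<noteq> 0" if "b \<in> A - P" for b using that ideal_inD(2)[OF prime_in_ideal[OF assms(2)]] by auto
  fix x assume "x \<in> localization A P"
  then obtain a b where x: "x = a / b" "a \<in> A" "b \<in> A - P" by (auto simp: localization_def)
  show "- x \<in> localization A P" using x subr_uminus[OF assms(1)]
    by (intro localizationI[of _ "-a" b]) auto
  fix y assume "y \<in> localization A P"
  then obtain c d where y: "y = c / d" "c \<in> A" "d \<in> A - P" by (auto simp: localization_def)
  have "x + y = (a * d + c * b) / (b * d)" using x y nz[OF x(3)] nz[OF y(3)] by (simp add: field_simps)
  then show "x + y \<in> localization A P" using mul[OF x(3) y(3)] x y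
    by (intro localizationI[of _ "a * d + c * b" "b * d"]) (auto intro!: subr_intros assms)
  have "x * y = (a * c) / (b * d)" using x y by simp
  then show "x * y \<in> localization A P" using mul[OF x(3) y(3)] x y
    by (intro localizationI[of _ "a * c" "b * d"]) (auto intro!: subr_intros assms)
qed

lemma localization_incl: "prime_in A P \<Longrightarrow> subr A \<Longrightarrow> A \<subseteq> localization A P"
proof
  fix x assume "prime_in A P" "x \<in> A" "subr A"
  then show "x \<in> localization A P" unfolding localization_def
    by (intro CollectI exI[of _ x] exI[of _ 1]) (auto intro: subr_one simp: prime_in_def)
qed

lemma localization_nonunits:
  assumes A: "subr A" and P: "prime_in A P"
  shows "nonunits (localization A P) = {a / b | a b. a \<in> P \<and> b \<in> A - P}"
proof -
  have nz: "b \<noteq> 0" if "b \<in> A - P" for b using that ideal_inD(2)[OF prime_in_ideal[OF P]] by auto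
  have PA: "P \<subseteq> A" using ideal_inD(1)[OF prime_in_ideal[OF P]] by auto
  show ?thesis
  proof (intro equalityI subsetI)
    fix x assume x: "x \<in> nonunits (localization A P)"
    then obtain a b where ab: "x = a / b" "a \<in> A" "b \<in> A - P" by (auto simp: nonunits_def localization_def)
    have "a \<in> P"
    proof (rule ccontr)
      assume a: "a \<notin> P"
      then have "inverse x \<in> localization A P" using ab by (intro localizationI[of _ b a]) auto
      moreover have "x \<noteq> 0" using ab a nz[of a] nz[of b] by auto
      ultimately show False using x by (simp add: nonunits_def)
    qed
    then show "x \<in> {a / b | a b. a \<in> P \<and> b \<in> A - P}" using ab by auto
  next
    fix x assume "x \<in> {a / b | a b. a \<in> P \<and> b \<in> A - P}"
    then obtain a b where ab: "x = a / b" "a \<in> P" "b \<in> A - P" by auto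
    have "x \<in> localization A P" using ab PA by (auto simp: localization_def)
    moreover have "inverse x \<notin> localization A P" if "x \<noteq> 0"
    proof
      assume "inverse x \<in> localization A P"
      then obtain c d where cd: "inverse x = c / d" "c \<in> A" "d \<in> A - P" by (auto simp: localization_def)
      have "b * d = c * a" proof -
        have "(a / b) * (c / d) = 1" using that unfolding cd(1)[symmetric] ab(1)[symmetric] by simp
        then show ?thesis using nz[OF ab(3)] nz[OF cd(3)] by (simp add: divide_simps mult.commute)
      qed
      moreover have "c * a \<in> P" using ideal_inD(4)[OF prime_in_ideal[OF P] cd(2) ab(2)] .
      ultimately show False using P ab cd by (auto simp: prime_in_def)
    qed
    ultimately show "x \<in> nonunits (localization A P)" by (auto simp: nonunits_def)
  qed
qed

lemma localization_local:
  assumes A: "subr A" and P: "prime_in A P"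
  shows "local_in (localization A P)" "nonunits (localization A P) \<inter> A = P"
proof -
  have nz: "b \<noteq> 0" if "b \<in> A - P" for b using that ideal_inD(2)[OF prime_in_ideal[OF P]] by auto
  note iP = prime_in_ideal[OF P]
  have o: "1 \<in> A - P" using A P by (auto simp: prime_in_def subr_one)
  have mul: "b * d \<in> A - P" if "b \<in> A - P" "d \<in> A - P" for b d
    using that P subr_mult[OF A] by (auto simp: prime_in_def)
  note N = localization_nonunits[OF A P]
  have "x + y \<in> nonunits (localization A P)" if xy: "x \<in> nonunits (localization A P)" "y \<in> nonunits (localization A P)" for x y
  proof -
    obtain a b c d where *: "x = a / b" "a \<in> P" "b \<in> A - P" "y = c / d" "c \<in> P" "d \<in> A - P" using xy unfolding N by blast
    have "x + y = (a * d + c * b) / (b * d)" using * nz[OF *(3)] nz[OF *(6)] by (simp add: field_simps)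
    moreover have "a * d + c * b \<in> P" using * ideal_inD[OF iP] by auto
    ultimately show ?thesis unfolding N using mul[OF *(3,6)] by blast
  qed
  moreover have "r * x \<in> nonunits (localization A P)" if xy: "r \<in> localization A P" "x \<in> nonunits (localization A P)" for r x
  proof -
    obtain a b c d where *: "x = a / b" "a \<in> P" "b \<in> A - P" "r = c / d" "c \<in> A" "d \<in> A - P" using xy[unfolded N] by (auto simp: localization_def)
    have "r * x = (c * a) / (d * b)" using * by simp
    moreover have "c * a \<in> P" using * ideal_inD[OF iP] by auto
    ultimately show ?thesis unfolding N using mul[OF *(6,3)] by blast
  qed
  moreover have "0 \<in> nonunits (localization A P)" using subr_zero[OF localization_subr[OF A P]] by (auto simp: nonunits_def)
  ultimately show "local_in (localization A P)"
    using localization_subr[OF A P] by (auto simp: local_in_def ideal_in_def) (auto simp: nonunits_def)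
  show "nonunits (localization A P) \<inter> A = P"
  proof
    show "nonunits (localization A P) \<inter> A \<subseteq> P"
    proof
      fix x assume "x \<in> nonunits (localization A P) \<inter> A"
      then obtain a b where *: "x = a / b" "a \<in> P" "b \<in> A - P" "x \<in> A" using N by auto
      then have "x * b \<in> P" using nz[OF *(3)] by simp
      then show "x \<in> P" using P * by (auto simp: prime_in_def)
    qed
    show "P \<subseteq> nonunits (localization A P) \<inter> A" unfolding N using o ideal_inD(1)[OF iP] by force
  qed
qed

text \<open>If a p-power of \<open>x\<close> is a unit of \<open>S\<close>, then \<open>x\<close> is
  a unit of \<open>T\<close>, with inverse \<open>x ^ (p ^ n - 1)\<close> times the inverse of
  \<open>x ^ p ^ n\<close>. The last conclusion serves the local rings of a relative spectrum, which
  are defined as localizations of rings that are local already.\<close>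

lemma radicial_local:
  fixes S T :: "'l::field set"
  assumes p: "prime p" "CHAR('l) = p" and S: "local_in S" and T: "subr T" and rad: "radicial p S T"
  shows "rad_ideal p T (nonunits S) = nonunits T" "local_in T" "localization T (nonunits T) = T"
proof -
  have sS: "subr S" using S by (simp add: local_in_def)
  note pr = radicial_prime[OF p sS T rad local_prime[OF S]]
  have ST: "S \<subseteq> T" using rad by (simp add: radicial_def)
  have p0: "p > 0" using p by (simp add: prime_gt_0_nat)
  show 1: "rad_ideal p T (nonunits S) = nonunits T"
  proof (intro equalityI subsetI)
    fix x assume x: "x \<in> rad_ideal p T (nonunits S)"
    then have xT: "x \<in> T" by (simp add: rad_ideal_def)
    have "inverse x \<notin> T" if "x \<noteq> 0"
    proof
      assume "inverse x \<in> T"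
      then have "inverse x * x \<in> rad_ideal p T (nonunits S)" using ideal_inD(4)[OF prime_in_ideal[OF pr(1)]] x by auto
      then show False using that pr(1) by (auto simp: prime_in_def)
    qed
    then show "x \<in> nonunits T" using xT by (auto simp: nonunits_def)
  next
    fix x assume x: "x \<in> nonunits T"
    then have xT: "x \<in> T" by (simp add: nonunits_def)
    obtain n where n: "x ^ p ^ n \<in> S" using rad xT by (auto simp: radicial_def)
    have "x ^ p ^ n \<in> nonunits S"
    proof (rule ccontr)
      assume "x ^ p ^ n \<notin> nonunits S"
      then have *: "inverse (x ^ p ^ n) \<in> T" "x ^ p ^ n \<noteq> 0" using n ST by (auto simp: nonunits_def)
      then have x0: "x \<noteq> 0" using p0 by (auto simp: power_0_left)
      have "p ^ n = Suc (p ^ n - 1)" using p0 by simp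
      then have "x ^ p ^ n = x * x ^ (p ^ n - 1)" by (metis power_Suc)
      then have "x ^ (p ^ n - 1) * inverse (x ^ p ^ n) = inverse x"
        using x0 by simp
      then have "inverse x \<in> T" using subr_mult[OF T subr_power[OF T xT] *(1)] by metis
      then show False using x x0 by (simp add: nonunits_def)
    qed
    then show "x \<in> rad_ideal p T (nonunits S)" using xT by (auto simp: rad_ideal_def)
  qed
  show 2: "local_in T" using T prime_in_ideal[OF pr(1)] 1 by (simp add: local_in_def)
  show "localization T (nonunits T) = T"
  proof
    show "localization T (nonunits T) \<subseteq> T"
    proof
      fix x assume "x \<in> localization T (nonunits T)"
      then obtain a b where "x = a / b" "a \<in> T" "b \<in> T" "b \<notin> nonunits T" by (auto simp: localization_def)
      then show "x \<in> T" using subr_mult[OF T, of a "inverse b"] by (auto simp: nonunits_def divide_inverse)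
    qed
    show "T \<subseteq> localization T (nonunits T)" using localization_incl[OF local_prime[OF 2] T] .
  qed
qed

section \<open>Spectra and base change\<close>

text \<open>Used in the contrapositive: an ideal of denominators contains \<open>1\<close> as soon
  as no prime contains it.\<close>

lemma ex_prime_above:
  assumes S: "subr S" and I: "ideal_in S I" "1 \<notin> I"
  obtains P where "prime_in S P" "I \<subseteq> P"
proof -
  define \<A> where "\<A> = {J. ideal_in S J \<and> 1 \<notin> J \<and> I \<subseteq> J}"
  have "\<exists>M\<in>\<A>. \<forall>V0\<in>\<A>. M \<subseteq> V0 \<longrightarrow> V0 = M"
  proof (rule subset_Zorn_nonempty)
    show "\<A> \<noteq> {}" using I by (auto simp: \<A>_def)
  next
    fix \<C> assume c: "\<C> \<noteq> {}" "subset.chain \<A> \<C>"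
    have sub: "\<C> \<subseteq> \<A>" using c(2) by (auto simp: subset_chain_def)
    have "x + y \<in> \<Union>\<C>" if xy: "x \<in> \<Union>\<C>" "y \<in> \<Union>\<C>" for x y
    proof -
      obtain V0 Y where XY: "V0 \<in> \<C>" "Y \<in> \<C>" "x \<in> V0" "y \<in> Y" using xy by auto
      then have "V0 \<subseteq> Y \<or> Y \<subseteq> V0" using c(2) by (auto simp: subset_chain_def)
      then obtain Z where Z: "Z \<in> \<C>" "x \<in> Z" "y \<in> Z" using XY by auto
      then have "x + y \<in> Z" using sub ideal_inD(3)[of S Z x y] by (auto simp: \<A>_def)
      then show ?thesis using Z by auto
    qed
    moreover have el: "ideal_in S J \<and> 1 \<notin> J \<and> I \<subseteq> J" if "J \<in> \<C>" for J using sub that by (auto simp: \<A>_def)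
    have "x \<in> S" if "x \<in> \<Union>\<C>" for x using that el ideal_inD(1) by blast
    moreover have "r * x \<in> \<Union>\<C>" if "x \<in> \<Union>\<C>" "r \<in> S" for x r using that el ideal_inD(4) by blast
    moreover have "0 \<in> \<Union>\<C>" using c(1) el ideal_inD(2) by blast
    ultimately have "ideal_in S (\<Union>\<C>)" unfolding ideal_in_def by blast
    then show "\<Union>\<C> \<in> \<A>" using c(1) el unfolding \<A>_def by blast
  qed
  then obtain M where M: "M \<in> \<A>" "\<And>V0. V0 \<in> \<A> \<Longrightarrow> M \<subseteq> V0 \<Longrightarrow> V0 = M" by auto
  have "maximalideal M (subring_rec S)"
    unfolding maximalideal_iff[OF S] using M by (auto simp: \<A>_def)
  then have "prime_in S M"
    using cring.maximalideal_prime[OF cring_subring_rec[OF S]] primeideal_iff[OF S] by auto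
  then show thesis using that M(1) by (auto simp: \<A>_def)
qed

lemma prime_in_contract:
  assumes "subr S" "S \<subseteq> T" "prime_in T q" shows "prime_in S (q \<inter> S)"
  using assms(2,3) subr_add[OF assms(1)] subr_mult[OF assms(1)] subr_zero[OF assms(1)]
  by (auto simp: prime_in_def ideal_in_def subset_iff)

section \<open>The Zariski topology on the primes of a subring\<close>

lemma spec_topspace: "subr A \<Longrightarrow> topspace (spec_topology A) = {q. prime_in A q}"
  using subr_one[of A] by (auto simp: spec_topology_def primeideal_iff prime_in_def)

lemma spec_basic_open: "subr A \<Longrightarrow> f \<in> A \<Longrightarrow> openin (spec_topology A) {q. prime_in A q \<and> f \<notin> q}"
  unfolding spec_topology_def by (rule topology_generated_by_Basis) (auto simp: primeideal_iff)

text \<open>The sets where one function does not vanish are given only as generators of the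
  topology. They form a basis because the locus of \<open>g * h\<close> is the intersection of the
  loci of \<open>g\<close> and \<open>h\<close>.\<close>

lemma spec_basis:
  assumes A: "subr A" and V: "openin (spec_topology A) V" "q \<in> V"
  shows "\<exists>g\<in>A. g \<notin> q \<and> (\<forall>r. prime_in A r \<longrightarrow> g \<notin> r \<longrightarrow> r \<in> V)"
proof -
  have "generate_topology_on {{q. primeideal q (subring_rec A) \<and> f \<notin> q} | f. f \<in> A} V"
    using V(1) unfolding spec_topology_def by (rule openin_topology_generated_by)
  then show ?thesis using V(2)
  proof (induction arbitrary: q rule: generate_topology_on.induct)
    case Empty then show ?case by simp
  next
    case (Int a b)
    have q: "prime_in A q"
    proof -
      have "openin (spec_topology A) (a \<inter> b)" unfolding spec_topology_def openin_topology_generated_by_iff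
        using Int.hyps by (rule generate_topology_on.Int)
      then show ?thesis using openin_subset[of "spec_topology A"] Int.prems spec_topspace[OF A] by blast
    qed
    obtain g where g: "g \<in> A" "g \<notin> q" "\<And>r. prime_in A r \<Longrightarrow> g \<notin> r \<Longrightarrow> r \<in> a"
      using Int.IH(1)[of q] Int.prems by auto
    obtain h where h: "h \<in> A" "h \<notin> q" "\<And>r. prime_in A r \<Longrightarrow> h \<notin> r \<Longrightarrow> r \<in> b"
      using Int.IH(2)[of q] Int.prems by auto
    have "g \<notin> r \<and> h \<notin> r" if "prime_in A r" "g * h \<notin> r" for r
      using ideal_inD(4,5)[OF prime_in_ideal[OF that(1)]] that(2) g(1) h(1) by auto
    then have "r \<in> a \<inter> b" if "prime_in A r" "g * h \<notin> r" for r using g(3) h(3) that by blast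
    moreover have "g * h \<notin> q" using q g h by (auto simp: prime_in_def)
    ultimately show ?case using subr_mult[OF A g(1) h(1)] by blast
  next
    case (UN \<K>)
    then obtain k where k: "k \<in> \<K>" "q \<in> k" by auto
    then show ?case using UN.IH[OF k] by blast
  next
    case (Basis s) then show ?case using primeideal_iff[OF A] by auto
  qed
qed

lemma radicial_subf:
  assumes "radicial p S T" "subf S" "subr T" "p > 0" shows "subf T"
  unfolding subf_def
proof (intro conjI ballI)
  show "subr T" by fact
  fix x assume x: "x \<in> T"
  then obtain n where n: "x ^ p ^ n \<in> S" using assms(1) by (auto simp: radicial_def)
  have "inverse (x ^ p ^ n) \<in> T" using subf_inverse[OF assms(2) n] assms(1) by (auto simp: radicial_def)
  then have "x ^ (p ^ n - 1) * inverse (x ^ p ^ n) \<in> T" using subr_mult[OF assms(3) subr_power[OF assms(3) x]] by auto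
  moreover have "p ^ n = Suc (p ^ n - 1)" using assms(4) by simp
  then have "x ^ p ^ n = x * x ^ (p ^ n - 1)" by (metis power_Suc)
  then have "x ^ (p ^ n - 1) * inverse (x ^ p ^ n) = inverse x" by (cases "x = 0") auto
  ultimately show "inverse x \<in> T" by simp
qed

text \<open>The extension of the ground field is recorded as radicial over \<open>K\<close>; this is
  what makes the projection from the base change to \<open>C\<close> a homeomorphism.\<close>

locale base_change_setting =
  fixes p :: nat and K Kbar :: "'l::field set" and C :: "('x, 'l) int_scheme"
  assumes p: "prime p" "CHAR('l) = p" and Kbar: "subf Kbar" "radicial p K Kbar"
    and C: "integral_scheme C" "scheme_over K C"
begin

definition bc :: "'l set \<Rightarrow> 'l set" where "bc S = generate_ring ambient (Kbar \<union> S)"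

lemma p0: "p > 0" using p by (simp add: prime_gt_0_nat)

lemma bc_subr [simp]: "subr (bc S)" unfolding bc_def by (rule generate_ring_subr)

lemma bc_incl: "S \<subseteq> bc S" "Kbar \<subseteq> bc S"
  using generate_ring_incl[of "Kbar \<union> S"] by (auto simp: bc_def)

lemma bc_least: "subr T \<Longrightarrow> S \<subseteq> T \<Longrightarrow> Kbar \<subseteq> T \<Longrightarrow> bc S \<subseteq> T"
  unfolding bc_def by (rule generate_ring_min) auto

lemma bc_mono: "S \<subseteq> T \<Longrightarrow> bc S \<subseteq> bc T"
  using bc_incl[of T] by (intro bc_least) auto

lemma bc_radicial: "subr S \<Longrightarrow> K \<subseteq> S \<Longrightarrow> radicial p S (bc S)"
  unfolding bc_def by (rule radicial_generate[OF p _ Kbar(2)])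

text \<open>Base change commutes with localization: the elements that acquire a denominator from
  \<open>R - P\<close> form a ring containing \<open>Kbar\<close> and the localization, hence all of
  its base change.\<close>

lemma bc_localization:
  assumes R: "subr R" and P: "prime_in R P" and y: "y \<in> bc (localization R P)"
  shows "\<exists>s\<in>R - P. s * y \<in> bc R"
proof -
  let ?T = "{y. \<exists>s\<in>R - P. s * y \<in> bc R}"
  have mul: "s * t \<in> R - P" if "s \<in> R - P" "t \<in> R - P" for s t
    using that P subr_mult[OF R] by (auto simp: prime_in_def)
  have RR: "s \<in> bc R" if "s \<in> R - P" for s using that bc_incl by auto
  have o: "1 \<in> R - P" using R P by (auto simp: prime_in_def subr_one)
  have "subr ?T"
  proof (rule subrI)
    show "1 \<in> ?T" using o by (auto intro: subr_intros intro!: bexI[of _ 1])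
  next
    fix x y assume "x \<in> ?T" "y \<in> ?T"
    then obtain s t where st: "s \<in> R - P" "s * x \<in> bc R" "t \<in> R - P" "t * y \<in> bc R" by auto
    have "t * (s * x) + s * (t * y) \<in> bc R" "(s * x) * (t * y) \<in> bc R" using st RR by (auto intro!: subr_intros)
    then show "x + y \<in> ?T" "x * y \<in> ?T" using mul[OF st(1,3)]
      by (auto intro!: bexI[of _ "s * t"] simp: algebra_simps)
  next
    fix x assume "x \<in> ?T"
    then obtain s where "s \<in> R - P" "s * x \<in> bc R" by auto
    then show "- x \<in> ?T" using subr_uminus[of "bc R" "s * x"] by (auto intro!: bexI[of _ s])
  qed
  moreover have "localization R P \<subseteq> ?T"
  proof
    fix x assume "x \<in> localization R P"
    then obtain a b where ab: "x = a / b" "a \<in> R" "b \<in> R - P" by (auto simp: localization_def)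
    moreover have "b \<noteq> 0" using ab ideal_inD(2)[OF prime_in_ideal[OF P]] by auto
    ultimately show "x \<in> ?T" using bc_incl(1)[of R] by (auto intro!: bexI[of _ b])
  qed
  moreover have "Kbar \<subseteq> ?T" using o bc_incl(2)[of R] by (auto intro!: bexI[of _ 1])
  ultimately show ?thesis using bc_least[of ?T "localization R P"] y by auto
qed

lemma fun_field_subf: "subf (fun_field C)"
  using C by (auto simp: integral_scheme_def intro: subfield_imp_subf)

lemma stalk_subr: "x \<in> points C \<Longrightarrow> subr (stalk C x)"
  and stalk_fun_field: "x \<in> points C \<Longrightarrow> stalk C x \<subseteq> fun_field C"
  and ex_affine: "x \<in> points C \<Longrightarrow> \<exists>U. affine_open C U \<and> x \<in> U"
  using C(1) by (auto simp: integral_scheme_def subring_ambient_iff)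

lemma stalk_over: "x \<in> points C \<Longrightarrow> K \<subseteq> stalk C x"
  using C(2) by (auto simp: scheme_over_def)

lemma affine_points: "affine_open C U \<Longrightarrow> U \<subseteq> points C"
  unfolding affine_open_def by (auto dest: openin_subset)

lemma sections_subr:
  assumes "U \<subseteq> points C" shows "subr (sections C U)"
  using assms stalk_subr subf_subr[OF fun_field_subf]
  by (auto simp: sections_def subr_def subset_iff)

lemma sections_over:
  assumes "affine_open C U" shows "K \<subseteq> sections C U"
proof -
  obtain x where "x \<in> U" using assms by (auto simp: affine_open_def)
  then show ?thesis using affine_points[OF assms] stalk_over stalk_fun_field by (fastforce simp: sections_def)
qed

text \<open>The point \<open>x\<close> as a prime ideal of \<open>\<O>(U)\<close>.\<close>

definition pr :: "'x set \<Rightarrow> 'x \<Rightarrow> 'l set" where "pr U x = nonunits (stalk C x) \<inter> sections C U"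

lemma affine_homeo:
  assumes U: "affine_open C U"
  shows "homeomorphic_map (subtopology (top_space C) U) (spec_topology (sections C U)) (pr U)"
    "inj_on (pr U) U" "pr U ` U = {q. prime_in (sections C U) q}"
proof -
  show h: "homeomorphic_map (subtopology (top_space C) U) (spec_topology (sections C U)) (pr U)"
    using U unfolding affine_open_def pr_def[abs_def] by simp
  have t: "topspace (subtopology (top_space C) U) = U" using affine_points[OF U] by auto
  show "inj_on (pr U) U" using homeomorphic_imp_injective_map[OF h] t by simp
  show "pr U ` U = {q. prime_in (sections C U) q}"
    using homeomorphic_imp_surjective_map[OF h] t spec_topspace[OF sections_subr[OF affine_points[OF U]]] by simp
qed

lemma affine_stalk:
  assumes U: "affine_open C U" "x \<in> U"
  shows "prime_in (sections C U) (pr U x)" "stalk C x = localization (sections C U) (pr U x)" "local_in (stalk C x)"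
proof -
  show 1: "prime_in (sections C U) (pr U x)" using affine_homeo(3)[OF U(1)] U(2) by auto
  show 2: "stalk C x = localization (sections C U) (pr U x)" using U by (auto simp: affine_open_def pr_def)
  show "local_in (stalk C x)" using localization_local(1)[OF sections_subr[OF affine_points[OF U(1)]] 1] 2 by simp
qed

lemma stalk_local: "x \<in> points C \<Longrightarrow> local_in (stalk C x)"
  using ex_affine affine_stalk(3) by blast

text \<open>The unique point of the base change over \<open>x\<close>.\<close>

definition pt :: "'x \<Rightarrow> 'x \<times> 'l set" where "pt x = (x, nonunits (bc (stalk C x)))"

abbreviation "C' \<equiv> base_change Kbar C"

lemma C'_def: "C' = rel_spec bc C" by (simp add: base_change_def bc_def[abs_def])

lemma stalk_bc:
  assumes x: "x \<in> points C"
  shows "radicial p (stalk C x) (bc (stalk C x))"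
    "rad_ideal p (bc (stalk C x)) (nonunits (stalk C x)) = nonunits (bc (stalk C x))"
    "local_in (bc (stalk C x))" "localization (bc (stalk C x)) (nonunits (bc (stalk C x))) = bc (stalk C x)"
    "nonunits (bc (stalk C x)) \<inter> stalk C x = nonunits (stalk C x)"
proof -
  show 1: "radicial p (stalk C x) (bc (stalk C x))" by (rule bc_radicial[OF stalk_subr[OF x] stalk_over[OF x]])
  show 2: "rad_ideal p (bc (stalk C x)) (nonunits (stalk C x)) = nonunits (bc (stalk C x))"
    "local_in (bc (stalk C x))" "localization (bc (stalk C x)) (nonunits (bc (stalk C x))) = bc (stalk C x)"
    using radicial_local[OF p stalk_local[OF x] bc_subr 1] by auto
  show "nonunits (bc (stalk C x)) \<inter> stalk C x = nonunits (stalk C x)"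
    using radicial_prime(2)[OF p stalk_subr[OF x] bc_subr 1 local_prime[OF stalk_local[OF x]]] 2(1) by simp
qed

lemma rel_points: "rel_spec_points bc C = pt ` points C"
proof (intro equalityI subsetI)
  fix z assume "z \<in> rel_spec_points bc C"
  then obtain x q where z: "z = (x, q)" "x \<in> points C" "prime_in (bc (stalk C x)) q" "q \<inter> stalk C x = nonunits (stalk C x)"
    by (auto simp: rel_spec_points_def primeideal_iff)
  have "q = nonunits (bc (stalk C x))"
    using radicial_prime(3)[OF p stalk_subr[OF z(2)] bc_subr stalk_bc(1)[OF z(2)] local_prime[OF stalk_local[OF z(2)]] z(3,4)]
      stalk_bc(2)[OF z(2)] by simp
  then show "z \<in> pt ` points C" using z by (auto simp: pt_def)
next
  fix z assume "z \<in> pt ` points C"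
  then show "z \<in> rel_spec_points bc C"
    using stalk_bc(5) local_prime[OF stalk_bc(3)] by (auto simp: rel_spec_points_def primeideal_iff pt_def)
qed

text \<open>The topology is given by generators, so a point counts only if some generator covers it.
  The function \<open>1\<close> on an affine neighbourhood does so.\<close>

lemma C'_points: "points C' = pt ` points C"
proof
  show "points C' \<subseteq> pt ` points C" unfolding C'_def rel_points[symmetric] by (auto simp: rel_spec_def)
  show "pt ` points C \<subseteq> points C'"
  proof
    fix z assume z: "z \<in> pt ` points C"
    then obtain x where x: "x \<in> points C" "z = pt x" by auto
    obtain U where U: "affine_open C U" "x \<in> U" using ex_affine[OF x(1)] by auto
    have "1 \<notin> nonunits (bc (stalk C x))" using local_prime[OF stalk_bc(3)[OF x(1)]] by (auto simp: prime_in_def)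
    then have "z \<in> {(x, q) \<in> rel_spec_points bc C. x \<in> U \<and> 1 \<notin> q}" using x U z rel_points by (auto simp: pt_def)
    moreover have "1 \<in> bc (sections C U)" by (rule subr_one) simp
    ultimately show "z \<in> points C'" unfolding C'_def using U by (auto simp: rel_spec_def)
  qed
qed

lemma pt_inj: "inj pt" by (auto simp: pt_def inj_def)

lemma fst_pt [simp]: "fst (pt x) = x" by (simp add: pt_def)

lemma geom_point_eq: "P \<in> points C \<Longrightarrow> geom_point Kbar C P = pt P"
  unfolding geom_point_def C'_points by (rule the_equality) auto

lemma stalk_C': "x \<in> points C \<Longrightarrow> stalk C' (pt x) = bc (stalk C x)"
  unfolding C'_def by (simp add: rel_spec_def pt_def stalk_bc(4))

lemma fun_field_C': "fun_field C' = bc (fun_field C)"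
  unfolding C'_def by (simp add: rel_spec_def)

lemma nonunits_bc_iff:
  assumes x: "x \<in> points C" and f: "f \<in> bc (stalk C x)" "f ^ p ^ n \<in> stalk C x"
  shows "f \<in> nonunits (bc (stalk C x)) \<longleftrightarrow> f ^ p ^ n \<in> nonunits (stalk C x)"
proof
  assume "f \<in> nonunits (bc (stalk C x))"
  then have "f ^ p ^ n \<in> nonunits (bc (stalk C x))"
    by (rule ideal_in_power[OF bc_subr prime_in_ideal[OF local_prime[OF stalk_bc(3)[OF x]]]]) (simp add: p0)
  then show "f ^ p ^ n \<in> nonunits (stalk C x)" using stalk_bc(5)[OF x] f(2) by auto
next
  assume "f ^ p ^ n \<in> nonunits (stalk C x)"
  then show "f \<in> nonunits (bc (stalk C x))" using stalk_bc(2)[OF x] f(1) by (auto simp: rad_ideal_def)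
qed

text \<open>A function and its p-power iterates vanish at the same points, and some
  \<open>f ^ p ^ n\<close> is already a section of \<open>C\<close>. Basic open sets of the base
  change therefore come from basic open sets of \<open>C\<close>.\<close>

lemma C'_basic:
  assumes U: "affine_open C U" and f: "f \<in> bc (sections C U)"
  shows "\<exists>g\<in>sections C U. {(x, q) \<in> rel_spec_points bc C. x \<in> U \<and> f \<notin> q} = pt ` {x \<in> U. g \<notin> pr U x}"
proof -
  have UP: "U \<subseteq> points C" using affine_points[OF U] .
  have "radicial p (sections C U) (bc (sections C U))" by (rule bc_radicial[OF sections_subr[OF UP] sections_over[OF U]])
  then obtain n where n: "f ^ p ^ n \<in> sections C U" using f by (auto simp: radicial_def)
  have "f \<in> nonunits (bc (stalk C x)) \<longleftrightarrow> f ^ p ^ n \<in> pr U x" if x: "x \<in> U" for x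
  proof -
    have "sections C U \<subseteq> stalk C x" using x by (auto simp: sections_def)
    then have "f \<in> bc (stalk C x)" "f ^ p ^ n \<in> stalk C x" using f n bc_mono by blast+
    then show ?thesis using nonunits_bc_iff[of x f n] UP x n by (auto simp: pr_def)
  qed
  then have "{(x, q) \<in> rel_spec_points bc C. x \<in> U \<and> f \<notin> q} = pt ` {x \<in> U. f ^ p ^ n \<notin> pr U x}"
    unfolding rel_points using UP by (auto simp: pt_def)
  then show ?thesis using n by auto
qed

lemma C_basic_open:
  assumes U: "affine_open C U" and g: "g \<in> sections C U"
  shows "openin (top_space C) {x \<in> U. g \<notin> pr U x}"
proof -
  have UP: "U \<subseteq> points C" using affine_points[OF U] .
  note h = affine_homeo[OF U]
  have "openin (subtopology (top_space C) U) {x \<in> topspace (subtopology (top_space C) U). pr U x \<in> {q. prime_in (sections C U) q \<and> g \<notin> q}}"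
    using homeomorphic_imp_continuous_map[OF h(1)] spec_basic_open[OF sections_subr[OF UP] g]
    by (rule openin_continuous_map_preimage)
  also have "{x \<in> topspace (subtopology (top_space C) U). pr U x \<in> {q. prime_in (sections C U) q \<and> g \<notin> q}} = {x \<in> U. g \<notin> pr U x}"
    using UP h(3) by auto
  finally show ?thesis using U by (auto simp: affine_open_def openin_open_subtopology)
qed

lemma C_basis:
  assumes U: "affine_open C U" and W: "openin (top_space C) W" and x: "x \<in> W" "x \<in> U"
  shows "\<exists>g\<in>sections C U. g \<notin> pr U x \<and> {y \<in> U. g \<notin> pr U y} \<subseteq> W"
proof -
  have UP: "U \<subseteq> points C" using affine_points[OF U] .
  note h = affine_homeo[OF U]
  have "openin (subtopology (top_space C) U) (U \<inter> W)" using W by (rule openin_subtopology_Int2)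
  then have "openin (spec_topology (sections C U)) (pr U ` (U \<inter> W))"
    using homeomorphic_imp_open_map[OF h(1)] by (auto simp: open_map_def)
  from spec_basis[OF sections_subr[OF UP] this, of "pr U x"] obtain g where g: "g \<in> sections C U" "g \<notin> pr U x"
     "\<And>r. prime_in (sections C U) r \<Longrightarrow> g \<notin> r \<Longrightarrow> r \<in> pr U ` (U \<inter> W)" using x by auto
  have "y \<in> W" if y: "y \<in> U" "g \<notin> pr U y" for y
  proof -
    have "pr U y \<in> pr U ` (U \<inter> W)" using g(3)[of "pr U y"] y h(3) by auto
    then obtain z where "pr U y = pr U z" "z \<in> U" "z \<in> W" by auto
    then show ?thesis using inj_onD[OF h(2), of y z] y by auto
  qed
  then show ?thesis using g by auto
qed

lemma openin_C': "openin (top_space C') V0 \<longleftrightarrow> (\<exists>W. openin (top_space C) W \<and> V0 = pt ` W)"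
proof
  let ?G = "{{(x, q) \<in> rel_spec_points bc C. x \<in> U \<and> f \<notin> q} | U f. affine_open C U \<and> f \<in> bc (sections C U)}"
  have top: "top_space C' = topology_generated_by ?G" unfolding C'_def by (simp add: rel_spec_def)
  {
    assume "openin (top_space C') V0"
    then have "generate_topology_on ?G V0" unfolding top by (rule openin_topology_generated_by)
    then show "\<exists>W. openin (top_space C) W \<and> V0 = pt ` W"
    proof (induction rule: generate_topology_on.induct)
      case Empty then show ?case by (intro exI[of _ "{}"]) auto
    next
      case (Int a b)
      then obtain V W where "openin (top_space C) V" "a = pt ` V" "openin (top_space C) W" "b = pt ` W" by auto
      then show ?case using image_Int[OF pt_inj, of V W] by (intro exI[of _ "V \<inter> W"]) auto
    next
      case (UN \<K>)
      then obtain w where w: "\<And>k. k \<in> \<K> \<Longrightarrow> openin (top_space C) (w k) \<and> k = pt ` w k" by metis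
      then have "\<Union>\<K> = pt ` (\<Union>k\<in>\<K>. w k)" unfolding image_UN by auto
      then show ?case using w by (intro exI[of _ "\<Union>k\<in>\<K>. w k"]) auto
    next
      case (Basis s)
      then obtain U f where *: "affine_open C U" "f \<in> bc (sections C U)" "s = {(x, q) \<in> rel_spec_points bc C. x \<in> U \<and> f \<notin> q}" by auto
      show ?case using C'_basic[OF *(1,2)] C_basic_open[OF *(1)] *(3) by auto
    qed
  next
    assume "\<exists>W. openin (top_space C) W \<and> V0 = pt ` W"
    then obtain W where W: "openin (top_space C) W" "V0 = pt ` W" by auto
    show "openin (top_space C') V0"
    proof (subst openin_subopen, intro ballI)
      fix z assume "z \<in> V0"
      then obtain x where x: "x \<in> W" "z = pt x" using W by auto
      then have xC: "x \<in> points C" using openin_subset[OF W(1)] by auto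
      obtain U where U: "affine_open C U" "x \<in> U" using ex_affine[OF xC] by auto
      obtain g where g: "g \<in> sections C U" "g \<notin> pr U x" "{y \<in> U. g \<notin> pr U y} \<subseteq> W"
        using C_basis[OF U(1) W(1) x(1) U(2)] by auto
      let ?T = "{(x, q) \<in> rel_spec_points bc C. x \<in> U \<and> g \<notin> q}"
      have UP: "U \<subseteq> points C" using affine_points[OF U(1)] .
      have "g \<in> nonunits (bc (stalk C y)) \<longleftrightarrow> g \<in> pr U y" if "y \<in> U" for y
      proof -
        have gy: "g \<in> stalk C y" using that g(1) by (auto simp: sections_def)
        then have "g \<in> bc (stalk C y)" using bc_incl(1) by auto
        then show ?thesis using nonunits_bc_iff[of y g 0] gy that UP g(1) by (auto simp: pr_def)
      qed
      then have T: "?T = pt ` {y \<in> U. g \<notin> pr U y}" unfolding rel_points using UP by (auto simp: pt_def)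
      have "openin (top_space C') ?T" unfolding top
        by (rule topology_generated_by_Basis) (use U g bc_incl in blast)
      moreover have "z \<in> ?T" unfolding T using x U g by auto
      moreover have "?T \<subseteq> V0" unfolding T W(2) using g(3) by auto
      ultimately show "\<exists>T. openin (top_space C') T \<and> z \<in> T \<and> T \<subseteq> V0" by blast
    qed
  }
qed

text \<open>The normalization is a relative spectrum over the base change, so its points are covered
  by sets indexed by affine open sets of the base change. This lemma supplies such a set around each
  point.\<close>

lemma affine_open_C':
  assumes U: "affine_open C U"
  shows "affine_open C' (pt ` U)"
proof -
  define R where "R = sections C U"
  have UP: "U \<subseteq> points C" using affine_points[OF U] .
  have R: "subr R" "K \<subseteq> R" unfolding R_def using sections_subr[OF UP] sections_over[OF U] by auto
  have rad: "radicial p R (bc R)" by (rule bc_radicial[OF R])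
  note h = affine_homeo[OF U, folded R_def]
  have st: "prime_in R (pr U x)" "stalk C x = localization R (pr U x)" "R \<subseteq> stalk C x" if "x \<in> U" for x
    using affine_stalk[OF U that] that by (auto simp: R_def sections_def)
  have den: "\<exists>s\<in>R - pr U x. s * y \<in> bc R" if "x \<in> U" "y \<in> bc (stalk C x)" for x y
    using bc_localization[OF R(1) st(1)[OF that(1)], of y] that st(2) by auto
  have sec: "sections C' (pt ` U) = bc R"
  proof (intro equalityI subsetI)
    fix f assume f: "f \<in> bc R"
    have "R \<subseteq> fun_field C" by (auto simp: R_def sections_def)
    then have "f \<in> bc (fun_field C)" using bc_mono f by blast
    moreover have "f \<in> stalk C' (pt x)" if "x \<in> U" for x
      using bc_mono[OF st(3)[OF that]] stalk_C'[of x] f UP that by auto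
    ultimately show "f \<in> sections C' (pt ` U)" unfolding sections_def fun_field_C' by auto
  next
    fix f assume "f \<in> sections C' (pt ` U)"
    then have f: "\<And>x. x \<in> U \<Longrightarrow> f \<in> bc (stalk C x)" using UP stalk_C' by (auto simp: sections_def)
    \<comment> \<open>The ideal of denominators of \<open>f\<close> in \<open>R\<close>. Since
      \<open>f\<close> is regular at every \<open>x \<in> U\<close>, some element of
      \<open>I\<close> lies outside \<open>pr U x\<close>, so no prime contains
      \<open>I\<close>.\<close>
    define I where "I = {d \<in> R. d * f \<in> bc R}"
    have I: "ideal_in R I" unfolding ideal_in_def I_def
      using subr_intros[OF R(1)] subr_intros[OF bc_subr[of R]] bc_incl(1)[of R] by (auto simp: distrib_right mult.assoc)
    have "1 \<in> I"
    proof (rule ccontr)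
      assume "1 \<notin> I"
      then obtain q where q: "prime_in R q" "I \<subseteq> q" using ex_prime_above[OF R(1) I] by auto
      then have "q \<in> pr U ` U" using h(3) by simp
      then obtain x where x: "x \<in> U" "q = pr U x" by (rule imageE)
      obtain s where "s \<in> R - pr U x" "s * f \<in> bc R" using den[OF x(1) f[OF x(1)]] by auto
      then show False using q x by (auto simp: I_def)
    qed
    then show "f \<in> bc R" by (simp add: I_def)
  qed
  define \<phi> where "\<phi> = (\<lambda>z. nonunits (stalk C' z) \<inter> bc R)"
  have phi: "prime_in (bc R) (\<phi> (pt x))" "\<phi> (pt x) \<inter> R = pr U x" if x: "x \<in> U" for x
  proof -
    have xP: "x \<in> points C" using x UP by auto
    have e: "\<phi> (pt x) = nonunits (bc (stalk C x)) \<inter> bc R" by (simp add: \<phi>_def stalk_C'[OF xP])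
    show "prime_in (bc R) (\<phi> (pt x))" unfolding e
      by (rule prime_in_contract[OF bc_subr bc_mono[OF st(3)[OF x]] local_prime[OF stalk_bc(3)[OF xP]]])
    have "R \<subseteq> bc R" "R \<subseteq> stalk C x" using bc_incl st(3)[OF x] by auto
    then show "\<phi> (pt x) \<inter> R = pr U x" unfolding e using stalk_bc(5)[OF xP] by (auto simp: pr_def R_def[symmetric])
  qed
  have surj: "\<exists>x\<in>U. q = \<phi> (pt x) \<and> q \<inter> R = pr U x" if q: "prime_in (bc R) q" for q
  proof -
    have "prime_in R (q \<inter> R)" by (rule prime_in_contract[OF R(1) bc_incl(1) q])
    then obtain x where x: "x \<in> U" "q \<inter> R = pr U x" using h(3) by auto
    note u = radicial_prime(3)[OF p R(1) bc_subr rad st(1)[OF x(1)]]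
    have "q = \<phi> (pt x)" using u[OF q x(2)] u[OF phi[OF x(1)]] by simp
    then show ?thesis using x by auto
  qed
  have "openin (top_space C) U" using U by (simp add: affine_open_def)
  then have oU: "openin (top_space C') (pt ` U)" unfolding openin_C' by auto
  have tsub: "topspace (subtopology (top_space C') (pt ` U)) = pt ` U" using UP C'_points by auto
  have homeo: "homeomorphic_map (subtopology (top_space C') (pt ` U)) (spec_topology (bc R)) \<phi>"
  proof (rule bijective_open_imp_homeomorphic_map)
    show "\<phi> ` topspace (subtopology (top_space C') (pt ` U)) = topspace (spec_topology (bc R))"
      unfolding tsub spec_topspace[OF bc_subr] using phi(1) surj by blast
    show "inj_on \<phi> (topspace (subtopology (top_space C') (pt ` U)))"
      unfolding tsub
    proof (rule inj_onI)
      fix y z assume "y \<in> pt ` U" "z \<in> pt ` U" and e: "\<phi> y = \<phi> z"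
      then obtain a b where ab: "y = pt a" "z = pt b" "a \<in> U" "b \<in> U" by auto
      then have "pr U a = pr U b" using phi(2)[of a] phi(2)[of b] e by simp
      then show "y = z" using inj_onD[OF h(2)] ab by auto
    qed
    show "continuous_map (subtopology (top_space C') (pt ` U)) (spec_topology (bc R)) \<phi>"
      unfolding spec_topology_def
    proof (rule continuous_on_generated_topo)
      fix V assume "V \<in> {{q. primeideal q (subring_rec (bc R)) \<and> f \<notin> q} |f. f \<in> bc R}"
      then obtain f where f: "f \<in> bc R" "V = {q. prime_in (bc R) q \<and> f \<notin> q}" by (auto simp: primeideal_iff)
      obtain g where g: "g \<in> R" "{(x, q) \<in> rel_spec_points bc C. x \<in> U \<and> f \<notin> q} = pt ` {x \<in> U. g \<notin> pr U x}"
        using C'_basic[OF U f(1)[unfolded R_def]] unfolding R_def by blast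
      have "\<phi> -` V \<inter> pt ` U = {(x, q) \<in> rel_spec_points bc C. x \<in> U \<and> f \<notin> q}"
      proof -
        have "\<phi> (pt x) \<in> V \<longleftrightarrow> f \<notin> nonunits (bc (stalk C x))" if "x \<in> U" for x
          using phi(1)[OF that] f UP that by (auto simp: \<phi>_def stalk_C')
        then have "\<phi> -` V \<inter> pt ` U = pt ` {x \<in> U. f \<notin> nonunits (bc (stalk C x))}" by auto
        also have "\<dots> = {(x, q) \<in> rel_spec_points bc C. x \<in> U \<and> f \<notin> q}"
          unfolding rel_points using UP by (auto simp: pt_def)
        finally show ?thesis .
      qed
      then have "\<phi> -` V \<inter> topspace (subtopology (top_space C') (pt ` U)) = pt ` {x \<in> U. g \<notin> pr U x}" using g tsub by simp
      moreover have "openin (top_space C') (pt ` {x \<in> U. g \<notin> pr U x})"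
        unfolding openin_C' using C_basic_open[OF U] g(1) R_def by auto
      ultimately show "openin (subtopology (top_space C') (pt ` U)) (\<phi> -` V \<inter> topspace (subtopology (top_space C') (pt ` U)))"
        using openin_open_subtopology[OF oU] by auto
    next
      show "\<phi> ` topspace (subtopology (top_space C') (pt ` U)) \<subseteq> \<Union>{{q. primeideal q (subring_rec (bc R)) \<and> f \<notin> q} |f. f \<in> bc R}"
      proof -
        have "\<Union>{{q. primeideal q (subring_rec (bc R)) \<and> f \<notin> q} |f. f \<in> bc R} = {q. prime_in (bc R) q}"
          unfolding spec_topspace[OF bc_subr, symmetric] by (simp add: spec_topology_def)
        then show ?thesis unfolding tsub using phi(1) by auto
      qed
    qed
    show "open_map (subtopology (top_space C') (pt ` U)) (spec_topology (bc R)) \<phi>"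
      unfolding open_map_def
    proof (intro allI impI)
      fix V0 assume "openin (subtopology (top_space C') (pt ` U)) V0"
      then have "openin (top_space C') V0" "V0 \<subseteq> pt ` U" using openin_open_subtopology[OF oU] by auto
      then obtain W where W: "openin (top_space C) W" "V0 = pt ` W" "W \<subseteq> U"
        unfolding openin_C' using pt_inj by (auto simp: inj_image_subset_iff)
      show "openin (spec_topology (bc R)) (\<phi> ` V0)"
      proof (subst openin_subopen, intro ballI)
        fix q assume "q \<in> \<phi> ` V0"
        then obtain x where x: "x \<in> W" "q = \<phi> (pt x)" using W by auto
        then have xU: "x \<in> U" using W by auto
        obtain g where g: "g \<in> R" "g \<notin> pr U x" "{y \<in> U. g \<notin> pr U y} \<subseteq> W"
          using C_basis[OF U W(1) x(1) xU] unfolding R_def by auto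
        have gb: "g \<in> bc R" using g bc_incl by auto
        have "openin (spec_topology (bc R)) {q. prime_in (bc R) q \<and> g \<notin> q}" by (rule spec_basic_open[OF bc_subr gb])
        moreover have "q \<in> {q. prime_in (bc R) q \<and> g \<notin> q}" using x phi[OF xU] g by auto
        moreover have "{q. prime_in (bc R) q \<and> g \<notin> q} \<subseteq> \<phi> ` V0"
        proof
          fix r assume r: "r \<in> {q. prime_in (bc R) q \<and> g \<notin> q}"
          then obtain y where y: "y \<in> U" "r = \<phi> (pt y)" "r \<inter> R = pr U y" using surj by blast
          then have "g \<notin> pr U y" using r g by auto
          then show "r \<in> \<phi> ` V0" using y g W by auto
        qed
        ultimately show "\<exists>T. openin (spec_topology (bc R)) T \<and> q \<in> T \<and> T \<subseteq> \<phi> ` V0" by blast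
      qed
    qed
  qed
  have loc: "stalk C' z = localization (bc R) (nonunits (stalk C' z) \<inter> bc R)" if "z \<in> pt ` U" for z
  proof -
    obtain x where x: "x \<in> U" "z = pt x" using \<open>z \<in> pt ` U\<close> by auto
    have xP: "x \<in> points C" using x UP by auto
    have sz: "stalk C' z = bc (stalk C x)" using x stalk_C'[OF xP] by simp
    have sub: "bc R \<subseteq> bc (stalk C x)" by (rule bc_mono[OF st(3)[OF x(1)]])
    show ?thesis unfolding sz
    proof (intro equalityI subsetI)
      fix y assume y: "y \<in> bc (stalk C x)"
      obtain s where s: "s \<in> R - pr U x" "s * y \<in> bc R" using den[OF x(1) y] by auto
      have "s \<in> bc R - (nonunits (bc (stalk C x)) \<inter> bc R)" using s phi(2)[OF x(1)] bc_incl(1)[of R] by (auto simp: \<phi>_def stalk_C'[OF xP])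
      moreover have "s \<noteq> 0" using s ideal_inD(2)[OF prime_in_ideal[OF st(1)[OF x(1)]]] by auto
      ultimately show "y \<in> localization (bc R) (nonunits (bc (stalk C x)) \<inter> bc R)"
        using s by (intro localizationI[of y "s * y" s]) auto
    next
      fix y assume "y \<in> localization (bc R) (nonunits (bc (stalk C x)) \<inter> bc R)"
      then obtain a b where "y = a / b" "a \<in> bc R" "b \<in> bc R" "b \<notin> nonunits (bc (stalk C x))" by (auto simp: localization_def)
      then show "y \<in> bc (stalk C x)" using sub subr_mult[OF bc_subr, of a _ "inverse b"]
        by (auto simp: nonunits_def divide_inverse subset_iff)
    qed
  qed
  have ff: "fun_field C' = localization (bc R) {0}"
  proof -
    have F: "fun_field C = localization R {0}" using U by (simp add: affine_open_def R_def)
    have z: "prime_in R {0}" using R(1) by (auto simp: prime_in_def ideal_in_def subr_zero)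
    have RF: "R \<subseteq> fun_field C" by (auto simp: R_def sections_def)
    have "radicial p (fun_field C) (bc (fun_field C))"
      by (rule bc_radicial) (use fun_field_subf R RF in \<open>auto simp: subf_def\<close>)
    then have sf: "subf (bc (fun_field C))" by (rule radicial_subf[OF _ fun_field_subf bc_subr p0])
    show ?thesis unfolding fun_field_C'
    proof (intro equalityI subsetI)
      fix y assume "y \<in> bc (fun_field C)"
      then obtain s where s: "s \<in> R - {0}" "s * y \<in> bc R" using bc_localization[OF R(1) z, of y] F by auto
      then show "y \<in> localization (bc R) {0}" using bc_incl(1)[of R] by (intro localizationI[of y "s * y" s]) auto
    next
      fix y assume "y \<in> localization (bc R) {0}"
      then obtain a b where "y = a / b" "a \<in> bc R" "b \<in> bc R" by (auto simp: localization_def)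
      then show "y \<in> bc (fun_field C)" using bc_mono[OF RF] subf_divide[OF sf] by auto
    qed
  qed
  show ?thesis unfolding affine_open_def sec
    using oU U homeo loc ff by (auto simp: \<phi>_def[abs_def] affine_open_def)
qed

end

section \<open>Residue fields are algebraic\<close>

text \<open>Algebraicity of a residue class, expressed without forming the residue field. When
  \<open>Q\<close> is a subfield of the local ring and \<open>M\<close> its set of nonunits,
  \<open>Q\<close> meets \<open>M\<close> only in \<open>0\<close>, so a nonzero polynomial over
  \<open>Q\<close> remains nonzero modulo \<open>M\<close>.\<close>

definition alg_mod :: "'l::field set \<Rightarrow> 'l set \<Rightarrow> 'l \<Rightarrow> bool" where
  "alg_mod Q M x \<longleftrightarrow> (\<exists>g. poly_in Q g \<and> g \<noteq> 0 \<and> poly g x \<in> M)"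

definition poly_ring_at :: "'l::field set \<Rightarrow> 'l \<Rightarrow> 'l set" where
  "poly_ring_at Q b = {poly g b | g. poly_in Q g}"

lemma alg_mod_mono: "Q \<subseteq> Q' \<Longrightarrow> alg_mod Q M x \<Longrightarrow> alg_mod Q' M x"
  unfolding alg_mod_def using poly_in_mono by blast

lemma poly_ring_at_subr:
  assumes Q: "subr Q" shows "subr (poly_ring_at Q b)" "Q \<subseteq> poly_ring_at Q b" "b \<in> poly_ring_at Q b"
proof -
  note i = poly_in_intros[OF Q]
  show "subr (poly_ring_at Q b)"
  proof (rule subrI)
    show "1 \<in> poly_ring_at Q b" unfolding poly_ring_at_def using i(2) by (intro CollectI exI[of _ 1]) auto
  next
    fix x y assume "x \<in> poly_ring_at Q b" "y \<in> poly_ring_at Q b"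
    then obtain g h where gh: "x = poly g b" "y = poly h b" "poly_in Q g" "poly_in Q h" by (auto simp: poly_ring_at_def)
    show "x + y \<in> poly_ring_at Q b" unfolding poly_ring_at_def using i(3) gh by (intro CollectI exI[of _ "g + h"]) auto
    show "x * y \<in> poly_ring_at Q b" unfolding poly_ring_at_def using i(5) gh by (intro CollectI exI[of _ "g * h"]) auto
  next
    fix x assume "x \<in> poly_ring_at Q b"
    then obtain g where g: "x = poly g b" "poly_in Q g" by (auto simp: poly_ring_at_def)
    show "- x \<in> poly_ring_at Q b" unfolding poly_ring_at_def using i(6) g by (intro CollectI exI[of _ "- g"]) auto
  qed
  show "Q \<subseteq> poly_ring_at Q b"
  proof
    fix c assume "c \<in> Q"
    then have "poly_in Q [:c:]" using i(1,8) by blast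
    then show "c \<in> poly_ring_at Q b" unfolding poly_ring_at_def by (intro CollectI exI[of _ "[:c:]"]) auto
  qed
  have "poly_in Q [:0,1:]" by (intro i subr_one subr_zero Q)
  then show "b \<in> poly_ring_at Q b" unfolding poly_ring_at_def by (intro CollectI exI[of _ "[:0,1:]"]) auto
qed

lemma local_unit: "x \<in> R \<Longrightarrow> x \<notin> nonunits R \<Longrightarrow> inverse x \<in> R"
  by (auto simp: nonunits_def)

lemma zero_prime: "subr R \<Longrightarrow> prime_in R {0}"
  by (auto simp: prime_in_def ideal_in_def subr_zero)

lemma fraction_field_subf:
  assumes E: "subr E" shows "subf (localization E {0})"
  unfolding subf_def
proof (intro conjI ballI)
  show "subr (localization E {0})" by (rule localization_subr[OF E zero_prime[OF E]])
  fix x assume x: "x \<in> localization E {0}"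
  then obtain a b where ab: "x = a / b" "a \<in> E" "b \<in> E - {0}" by (auto simp: localization_def)
  show "inverse x \<in> localization E {0}"
  proof (cases "a = 0")
    case True then show ?thesis using x ab by simp
  next
    case False then show ?thesis using ab by (intro localizationI[of _ b a]) auto
  qed
qed

text \<open>Transcendence modulo the maximal ideal says that every nonzero element of
  \<open>Q[b]\<close> is a unit of \<open>R\<close>. Its fraction field is therefore available
  inside \<open>R\<close>, with no passage to the residue field.\<close>

lemma transcendental_fraction_field:
  assumes R: "local_in R" and Q: "subf Q" "Q \<subseteq> R" and b: "b \<in> R" "\<not> alg_mod Q (nonunits R) b"
  defines "E \<equiv> poly_ring_at Q b"
  shows "subr E" "E \<subseteq> R" "subf (localization E {0})" "Q \<subseteq> localization E {0}" "localization E {0} \<subseteq> R" "b \<in> localization E {0}"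
proof -
  have sR: "subr R" using R by (simp add: local_in_def)
  show E: "subr E" unfolding E_def by (rule poly_ring_at_subr(1)[OF subf_subr[OF Q(1)]])
  show ER: "E \<subseteq> R" unfolding E_def poly_ring_at_def using poly_in_poly[OF sR Q(2)] b(1) by auto
  show "subf (localization E {0})" by (rule fraction_field_subf[OF E])
  have EL: "E \<subseteq> localization E {0}" by (rule localization_incl[OF zero_prime[OF E] E])
  then show "Q \<subseteq> localization E {0}" "b \<in> localization E {0}"
    using poly_ring_at_subr(2,3)[OF subf_subr[OF Q(1)], of b] by (auto simp: E_def)
  have "inverse e \<in> R" if e: "e \<in> E" "e \<noteq> 0" for e
  proof -
    obtain g where g: "e = poly g b" "poly_in Q g" using e(1) by (auto simp: E_def poly_ring_at_def)
    then have "e \<notin> nonunits R" using b(2) e(2) by (auto simp: alg_mod_def)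
    then show ?thesis using e ER local_unit by auto
  qed
  then show "localization E {0} \<subseteq> R" using ER subr_mult[OF sR]
    by (auto simp: localization_def divide_inverse)
qed

text \<open>Whenever the next element is transcendental modulo the maximal ideal, the base field is
  enlarged by it. Only the last enlargement is recorded, because the contradiction in Zariski's
  lemma comes from a single transcendental element over its immediate base field.\<close>

lemma transcendence_selection:
  assumes R: "local_in R" and K: "subf K" "K \<subseteq> R"
  shows "set bs \<subseteq> R \<Longrightarrow> \<exists>Q. subf Q \<and> K \<subseteq> Q \<and> Q \<subseteq> R \<and> (\<forall>b\<in>set bs. alg_mod Q (nonunits R) b) \<and>
    (Q = K \<or> (\<exists>Q0 b. subf Q0 \<and> K \<subseteq> Q0 \<and> Q0 \<subseteq> R \<and> b \<in> R \<and> \<not> alg_mod Q0 (nonunits R) b \<and> Q = localization (poly_ring_at Q0 b) {0}))"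
proof (induction bs)
  case Nil then show ?case using K by auto
next
  case (Cons b bs)
  have bsR: "set bs \<subseteq> R" using Cons(2) by simp
  obtain Q where Q: "subf Q" "K \<subseteq> Q" "Q \<subseteq> R" "\<And>b. b \<in> set bs \<Longrightarrow> alg_mod Q (nonunits R) b"
    and QQ: "Q = K \<or> (\<exists>Q0 b. subf Q0 \<and> K \<subseteq> Q0 \<and> Q0 \<subseteq> R \<and> b \<in> R \<and> \<not> alg_mod Q0 (nonunits R) b \<and> Q = localization (poly_ring_at Q0 b) {0})"
    using Cons(1)[OF bsR] by blast
  have bR: "b \<in> R" using Cons by simp
  show ?case
  proof (cases "alg_mod Q (nonunits R) b")
    case True then show ?thesis using Q QQ by (intro exI[of _ Q]) auto
  next
    case False
    define Q' where "Q' = localization (poly_ring_at Q b) {0}"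
    note t = transcendental_fraction_field[OF R Q(1,3) bR False, folded Q'_def]
    have "poly_in Q' [:-b, 1:]" by (intro poly_in_intros subr_intros subf_subr t)
    moreover have "poly [:-b, 1:] b \<in> nonunits R" using R by (auto simp: local_in_def nonunits_def subr_zero)
    moreover have "[:-b, 1:] \<noteq> 0" by simp
    ultimately have bb: "alg_mod Q' (nonunits R) b" unfolding alg_mod_def by blast
    have al: "alg_mod Q' (nonunits R) c" if "c \<in> set (b # bs)" for c
      using that Q(4)[of c] alg_mod_mono[OF t(4), of "nonunits R" c] bb by (cases "c = b") auto
    have "\<exists>Q0 b. subf Q0 \<and> K \<subseteq> Q0 \<and> Q0 \<subseteq> R \<and> b \<in> R \<and> \<not> alg_mod Q0 (nonunits R) b \<and> Q' = localization (poly_ring_at Q0 b) {0}"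
      using Q bR False by (intro exI[of _ Q] exI[of _ b]) (auto simp: Q'_def)
    moreover have "K \<subseteq> Q'" using Q(2) t(4) by auto
    ultimately have "subf Q' \<and> K \<subseteq> Q' \<and> Q' \<subseteq> R \<and> (\<forall>b\<in>set (b # bs). alg_mod Q' (nonunits R) b) \<and>
      (Q' = K \<or> (\<exists>Q0 b. subf Q0 \<and> K \<subseteq> Q0 \<and> Q0 \<subseteq> R \<and> b \<in> R \<and> \<not> alg_mod Q0 (nonunits R) b \<and> Q' = localization (poly_ring_at Q0 b) {0}))"
      using t(3,5) al by blast
    then show ?thesis by (rule exI)
  qed
qed

text \<open>Division by the leading coefficient gives the relation that
  \<open>finite_monomial_span\<close> asks for. The exponent is positive because a nonzero constant
  of \<open>Q\<close> is a unit of \<open>R\<close> and hence not in the maximal ideal.\<close>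

lemma alg_mod_power:
  assumes R: "local_in R" and Q: "subf Q" "Q \<subseteq> R" and a: "alg_mod Q (nonunits R) a"
  shows "\<exists>N>0. a ^ N \<in> lspan Q (nonunits R) (map ((^) a) [0..<N])"
proof -
  let ?M = "nonunits R"
  obtain g where g: "poly_in Q g" "g \<noteq> 0" "poly g a \<in> ?M" using a by (auto simp: alg_mod_def)
  define N where "N = Polynomial.degree g"
  define c where "c = Polynomial.lead_coeff g"
  have c: "c \<noteq> 0" "c \<in> Q" using g by (auto simp: c_def poly_in_def)
  have ic: "inverse c \<in> Q" by (rule subf_inverse[OF Q(1) c(2)])
  have sub: "submod R ?M" using R by (auto simp: local_in_def intro: ideal_in_submod)
  have M: "submod Q ?M" by (rule submod_mono[OF sub Q(2)])
  have "c \<notin> ?M" using c ic Q(2) by (auto simp: nonunits_def)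
  have "N > 0"
  proof (rule ccontr)
    assume "\<not> N > 0"
    then obtain d where "g = [:d:]" using degree_eq_zeroE by (auto simp: N_def)
    then have "poly g a = c" by (simp add: c_def)
    then show False using \<open>c \<notin> ?M\<close> g by simp
  qed
  let ?L = "lspan Q ?M (map ((^) a) [0..<N])"
  note sL = lspan_submod[OF subf_subr[OF Q(1)] M]
  have "poly g a = c * a ^ N + (\<Sum>i<N. Polynomial.coeff g i * a ^ i)"
    by (simp add: poly_altdef N_def c_def lessThan_Suc_atMost[symmetric])
  then have eq: "a ^ N = inverse c * poly g a - inverse c * (\<Sum>i<N. Polynomial.coeff g i * a ^ i)"
    using c by (simp add: field_simps)
  have "poly g a \<in> ?L" using g(3) lspan_base[OF subf_subr[OF Q(1)]] by blast
  moreover have "(\<Sum>i\<in>I. Polynomial.coeff g i * a ^ i) \<in> ?L" if "finite I" "I \<subseteq> {..<N}" for I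
    using that
  proof (induction I rule: finite_induct)
    case empty then show ?case using submodD(1)[OF sL] by simp
  next
    case (insert i I)
    have "a ^ i \<in> ?L" by (rule lspan_mem[OF subf_subr[OF Q(1)] M]) (use insert in auto)
    then have "Polynomial.coeff g i * a ^ i \<in> ?L" using submodD(3)[OF sL] g(1) by (auto simp: poly_in_def)
    then show ?case using insert submodD(2)[OF sL] by auto
  qed
  then have "(\<Sum>i<N. Polynomial.coeff g i * a ^ i) \<in> ?L" by auto
  ultimately have "a ^ N \<in> ?L" unfolding eq
    by (intro submod_diff[OF subf_subr[OF Q(1)] sL] submodD(3)[OF sL] ic)
  then show ?thesis using \<open>N > 0\<close> by blast
qed

lemma clear_list:
  assumes E: "subr E" and frac: "\<And>q. q \<in> Q \<Longrightarrow> \<exists>e\<in>E. e \<noteq> 0 \<and> e * q \<in> E" and M: "submod E M"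
  shows "set xs \<subseteq> lspan Q M ss \<Longrightarrow> \<exists>d\<in>E. d \<noteq> 0 \<and> (\<forall>x\<in>set xs. d * x \<in> lspan E M ss)"
proof (induction xs)
  case Nil then show ?case using subr_one[OF E] by (intro bexI[of _ 1]) auto
next
  case (Cons x xs)
  then obtain d where d: "d \<in> E" "d \<noteq> 0" "\<And>x. x \<in> set xs \<Longrightarrow> d * x \<in> lspan E M ss" by auto
  have "x \<in> lspan Q M ss" using Cons(2) by simp
  from lspan_clear[OF E frac M this] obtain e where e: "e \<in> E" "e \<noteq> 0" "e * x \<in> lspan E M ss" by auto
  have "(d * e) * y \<in> lspan E M ss" if "y \<in> set (x # xs)" for y
  proof (cases "y = x")
    case True then show ?thesis using submodD(3)[OF lspan_submod[OF E M] d(1) e(3)] by (simp add: mult.assoc)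
  next
    case False
    then have "d * y \<in> lspan E M ss" using that d by auto
    from submodD(3)[OF lspan_submod[OF E M] e(1) this] show ?thesis by (simp add: mult_ac)
  qed
  then show ?case using d e subr_mult[OF E] by (intro bexI[of _ "d * e"]) auto
qed

text \<open>Denominators in a simple transcendental extension cannot be bounded by the powers of one
  element \<open>u\<close>, since \<open>1 + u b\<close> is coprime to \<open>u\<close>.\<close>

lemma transcendental_unbounded_denominators:
  fixes b :: "'l::field"
  assumes Q: "subf Q" and tr: "\<And>g. poly_in Q g \<Longrightarrow> poly g b = 0 \<Longrightarrow> g = 0"
    and c: "c \<in> poly_ring_at Q b" "c \<noteq> 0" and f: "f \<in> poly_ring_at Q b" "f \<noteq> 0"
  obtains z where "z \<in> localization (poly_ring_at Q b) {0}" "\<And>N. c * f ^ N * z \<notin> poly_ring_at Q b"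
proof -
  note s = subf_subr[OF Q]
  note i = poly_in_intros[OF s]
  obtain gc gf where gc: "c = poly gc b" "poly_in Q gc" and gf: "f = poly gf b" "poly_in Q gf"
    using c f by (auto simp: poly_ring_at_def)
  \<comment> \<open>The factor \<open>gc\<close> is included so that \<open>gc * gf ^ N\<close>
    divides \<open>u ^ Suc N\<close>, and one polynomial \<open>w\<close> coprime to
    \<open>u\<close> serves for all \<open>N\<close>.\<close>
  define u where "u = gc * gf"
  define w where "w = 1 + pCons 0 u"
  have uQ: "poly_in Q u" unfolding u_def by (intro i gc gf)
  have wQ: "poly_in Q w" unfolding w_def by (intro i uQ subr_zero s)
  have u0: "u \<noteq> 0" using c f gc gf by (auto simp: u_def)
  have dw: "Polynomial.degree w > 0"
  proof -
    have "Polynomial.degree (pCons 0 u) = Suc (Polynomial.degree u)" using u0 by simp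
    then show ?thesis unfolding w_def by (subst degree_add_eq_right) auto
  qed
  then have w0: "w \<noteq> 0" by auto
  have cop: "is_unit w" if "w dvd u ^ k" for k
    using that
  proof (induction k)
    case (Suc k)
    have "(w - [:0,1:] * u) * u ^ k = u ^ k" by (simp add: w_def)
    then have "u ^ k = w * u ^ k - [:0,1:] * u ^ Suc k" by (simp only: left_diff_distrib power_Suc mult.assoc)
    moreover have "w dvd w * u ^ k - [:0,1:] * u ^ Suc k" using Suc(2) by (intro dvd_diff dvd_mult dvd_triv_left)
    ultimately show ?case using Suc(1) by simp
  qed simp
  define z where "z = 1 / poly w b"
  have wb: "poly w b \<noteq> 0" using tr[OF wQ] w0 by auto
  have "z \<in> localization (poly_ring_at Q b) {0}" unfolding z_def
    using wb wQ subr_one[OF poly_ring_at_subr(1)[OF s]]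
    by (intro localizationI[of _ 1 "poly w b"]) (auto simp: poly_ring_at_def)
  moreover have "c * f ^ N * z \<notin> poly_ring_at Q b" for N
  proof
    assume "c * f ^ N * z \<in> poly_ring_at Q b"
    then obtain h where h: "c * f ^ N * z = poly h b" "poly_in Q h" by (auto simp: poly_ring_at_def)
    have pw: "poly_in Q (gf ^ N)" by (induction N) (use i gf in auto)
    have "poly (gc * gf ^ N - w * h) b = 0" using h(1) wb gc gf by (simp add: z_def field_simps)
    moreover have "poly_in Q (gc * gf ^ N - w * h)" by (intro i gc pw wQ h)
    ultimately have "gc * gf ^ N = w * h" using tr by fastforce
    then have "w dvd gc * gf ^ N" by simp
    also have "gc * gf ^ N dvd u ^ Suc N"
    proof -
      have "u ^ Suc N = (gc * gf ^ N) * (gc ^ N * gf)" by (simp add: u_def power_mult_distrib mult_ac)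
      then show ?thesis by (metis dvd_triv_left)
    qed
    finally have "w dvd u ^ Suc N" .
    then have "is_unit w" by (rule cop)
    then show False using dw by (simp add: is_unit_iff_degree w0)
  qed
  ultimately show thesis using that by blast
qed

text \<open>Gaussian elimination on the spanning list, modulo \<open>M\<close>: a vector with
  nonzero coefficient at \<open>s\<close> serves as pivot and removes \<open>s\<close> from all
  others, at the cost of one vector and one list entry.\<close>

lemma linear_dependence:
  assumes K: "subf K" and M: "submod K M"
  shows "finite I \<Longrightarrow> length ms < card I \<Longrightarrow> (\<And>i. i \<in> I \<Longrightarrow> v i \<in> lspan K M ms) \<Longrightarrow>
    \<exists>c. (\<forall>i\<in>I. c i \<in> K) \<and> (\<exists>i\<in>I. c i \<noteq> 0) \<and> (\<Sum>i\<in>I. c i * v i) \<in> M"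
proof (induction ms arbitrary: I v)
  case Nil
  note s = subf_subr[OF K]
  obtain j where j: "j \<in> I" using Nil(2) by fastforce
  have "(\<Sum>i\<in>I. (if i = j then 1 else 0) * v i) = (\<Sum>i\<in>I. if i = j then v i else 0)" by (rule sum.cong) auto
  then have "(\<Sum>i\<in>I. (if i = j then 1 else 0) * v i) = v j" using j Nil(1) by simp
  then show ?case using Nil(3)[OF j] j subr_one[OF s] subr_zero[OF s]
    by (intro exI[of _ "\<lambda>i. if i = j then 1 else 0"]) auto
next
  case (Cons s ms)
  note sK = subf_subr[OF K]
  note sL = lspan_submod[OF sK M, of ms]
  have "\<forall>i\<in>I. \<exists>e z. e \<in> K \<and> z \<in> lspan K M ms \<and> v i = e * s + z" using Cons(4) by fastforce
  then obtain e z where ez: "\<And>i. i \<in> I \<Longrightarrow> e i \<in> K \<and> z i \<in> lspan K M ms \<and> v i = e i * s + z i" by metis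
  show ?case
  proof (cases "\<forall>i\<in>I. e i = 0")
    case True
    then have "v i \<in> lspan K M ms" if "i \<in> I" for i using ez[OF that] that by auto
    then show ?thesis using Cons(1)[of I v] Cons(2,3) by simp
  next
    case False
    then obtain j where j: "j \<in> I" "e j \<noteq> 0" by auto
    define w where "w i = v i - (e i / e j) * v j" for i
    have "w i \<in> lspan K M ms" if "i \<in> I - {j}" for i
    proof -
      have "w i = z i - (e i / e j) * z j" using ez[of i] ez[of j] that j by (auto simp: w_def field_simps)
      moreover have "(e i / e j) * z j \<in> lspan K M ms"
        by (rule submodD(3)[OF sL subf_divide[OF K]]) (use ez that j in auto)
      ultimately show ?thesis using submod_diff[OF sK sL] ez that by auto
    qed
    moreover have "length ms < card (I - {j})" using Cons(2,3) j by simp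
    ultimately obtain c where c: "\<forall>i\<in>I-{j}. c i \<in> K" "\<exists>i\<in>I-{j}. c i \<noteq> 0" "(\<Sum>i\<in>I-{j}. c i * w i) \<in> M"
      using Cons(1)[of "I - {j}" w] Cons(2) by auto
    define d where "d i = (if i = j then - (\<Sum>i\<in>I-{j}. c i * (e i / e j)) else c i)" for i
    have "(\<Sum>i\<in>I. d i * v i) = d j * v j + (\<Sum>i\<in>I-{j}. d i * v i)" using Cons(2) j by (simp add: sum.remove)
    also have "(\<Sum>i\<in>I-{j}. d i * v i) = (\<Sum>i\<in>I-{j}. c i * v i)" by (rule sum.cong) (auto simp: d_def)
    also have "d j * v j = - (\<Sum>i\<in>I-{j}. c i * ((e i / e j) * v j))" by (simp add: d_def sum_distrib_right mult.assoc)
    also have "\<dots> + (\<Sum>i\<in>I-{j}. c i * v i) = (\<Sum>i\<in>I-{j}. c i * w i)"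
      by (simp add: w_def right_diff_distrib sum_subtractf)
    finally have "(\<Sum>i\<in>I. d i * v i) \<in> M" using c(3) by simp
    moreover have "d i \<in> K" if "i \<in> I" for i
      using that c(1) ez j by (auto simp: d_def intro!: subr_uminus[OF sK] subr_sum[OF sK] subr_mult[OF sK] subf_divide[OF K])
    moreover have "\<exists>i\<in>I. d i \<noteq> 0" using c(2) by (auto simp: d_def)
    ultimately show ?thesis by blast
  qed
qed

text \<open>Zariski's lemma, phrased modulo the maximal ideal.  Otherwise \<open>R\<close> is, modulo its maximal ideal,
  finite over \<open>Q0(b)\<close> with \<open>b\<close> transcendental, and being finitely generated it needs only powers of
  one \<open>f\<close> as denominators over \<open>Q0[b]\<close>.\<close>

lemma residue_field_algebraic:
  assumes R: "local_in R" and K: "subf K" "K \<subseteq> R" and as: "set as \<subseteq> R"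
    and gen: "\<And>x. x \<in> R \<Longrightarrow> \<exists>y\<in>generate_ring ambient (K \<union> set as). x - y \<in> nonunits R"
    and x: "x \<in> R"
  shows "alg_mod K (nonunits R) x"
proof -
  let ?M = "nonunits R"
  have sR: "subr R" and iM: "ideal_in R ?M" using R by (auto simp: local_in_def)
  have sub: "submod R ?M" by (rule ideal_in_submod[OF iM])
  obtain Q where Q: "subf Q" "K \<subseteq> Q" "Q \<subseteq> R" "\<And>b. b \<in> set as \<Longrightarrow> alg_mod Q ?M b"
    and QQ: "Q = K \<or> (\<exists>Q0 b. subf Q0 \<and> K \<subseteq> Q0 \<and> Q0 \<subseteq> R \<and> b \<in> R \<and> \<not> alg_mod Q0 ?M b \<and> Q = localization (poly_ring_at Q0 b) {0})"
    using transcendence_selection[OF R K as] by auto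
  note sQ = subf_subr[OF Q(1)]
  have MQ: "submod Q ?M" by (rule submod_mono[OF sub Q(3)])
  obtain ms where ms: "1 \<in> set ms" "set ms \<subseteq> R" "\<And>a z. a \<in> set as \<Longrightarrow> z \<in> lspan Q ?M ms \<Longrightarrow> a * z \<in> lspan Q ?M ms"
    using finite_monomial_span[OF sR sQ Q(3) sub as] alg_mod_power[OF R Q(1,3,4)] by metis
  have all: "z \<in> lspan Q ?M ms" if z: "z \<in> R" for z
  proof -
    let ?W = "lspan Q ?M ms"
    note sW = lspan_submod[OF sQ MQ, of ms]
    have "generate_ring ambient (K \<union> set as) \<subseteq> {r \<in> R. \<forall>z\<in>?W. r * z \<in> ?W}"
      by (rule generate_ring_min[OF multiplier_subr[OF sR sQ sW]]) (use K as ms(3) Q(2) submodD(3)[OF sW] in auto)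
    moreover have "1 \<in> ?W" by (rule lspan_mem[OF sQ MQ ms(1)])
    ultimately have sub: "generate_ring ambient (K \<union> set as) \<subseteq> ?W" by force
    obtain y where y: "y \<in> generate_ring ambient (K \<union> set as)" "z - y \<in> ?M" using gen[OF z] by auto
    have "z - y \<in> ?W" "y \<in> ?W" using y sub lspan_base[OF sQ] by auto
    then have "(z - y) + y \<in> ?W" by (rule submodD(2)[OF sW])
    then show ?thesis by simp
  qed
  show ?thesis
  proof (cases "Q = K")
    case True
    \<comment> \<open>The index set starts at \<open>0\<close>, so there is one more power of
      \<open>x\<close> than there are spanning elements.\<close>
    let ?I = "{..length ms}"
    have "\<exists>c. (\<forall>i\<in>?I. c i \<in> K) \<and> (\<exists>i\<in>?I. c i \<noteq> 0) \<and> (\<Sum>i\<in>?I. c i * x ^ i) \<in> ?M"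
      by (rule linear_dependence) (use K MQ True all subr_power[OF sR x] in auto)
    then obtain c where c: "\<And>i. i \<in> ?I \<Longrightarrow> c i \<in> K" "\<exists>i\<in>?I. c i \<noteq> 0" "(\<Sum>i\<in>?I. c i * x ^ i) \<in> ?M"
      by blast
    define g where "g = (\<Sum>i\<in>?I. Polynomial.monom (c i) i)"
    have cg: "Polynomial.coeff g i = c i" if "i \<in> ?I" for i
      using that by (simp add: g_def coeff_sum)
    have "poly_in K g" unfolding g_def by (intro poly_in_sum poly_in_intros(9) subf_subr K c)
    moreover have "g \<noteq> 0" using c(2) cg by fastforce
    moreover have "poly g x \<in> ?M" using c(3) by (simp add: g_def poly_sum poly_monom)
    ultimately show ?thesis by (auto simp: alg_mod_def)
  next
    case False
    then obtain Q0 b where b: "subf Q0" "K \<subseteq> Q0" "Q0 \<subseteq> R" "b \<in> R" "\<not> alg_mod Q0 ?M b" and Qeq: "Q = localization (poly_ring_at Q0 b) {0}"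
      using QQ by auto
    define E where "E = poly_ring_at Q0 b"
    note t = transcendental_fraction_field[OF R b(1,3-5), folded E_def]
    have E: "subr E" "E \<subseteq> R" and EQ: "E \<subseteq> Q" using t localization_incl[OF zero_prime[OF t(1)] t(1)] by (auto simp: Qeq E_def)
    have fr: "\<exists>e\<in>E. e \<noteq> 0 \<and> e * q \<in> E" if q: "q \<in> Q" for q
    proof -
      obtain a e where "q = a / e" "a \<in> E" "e \<in> E - {0}" using q by (auto simp: Qeq E_def localization_def)
      then show ?thesis by (intro bexI[of _ e]) auto
    qed
    have ME: "submod E ?M" by (rule submod_mono[OF sub E(2)])
    define ss where "ss = ms @ [1]"
    define L where "L = lspan E ?M ss"
    have sL: "submod E L" unfolding L_def by (rule lspan_submod[OF E(1) ME])
    have subML: "?M \<subseteq> L" unfolding L_def by (rule lspan_base[OF E(1)])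
    have one: "1 \<in> L" unfolding L_def by (rule lspan_mem[OF E(1) ME]) (simp add: ss_def)
    have allQ: "z \<in> lspan Q ?M ss" if "z \<in> R" for z
      using all[OF that] lspan_mono[OF sQ MQ, of ms ss] by (auto simp: ss_def)
    have ssR: "set ss \<subseteq> R" using ms(2) subr_one[OF sR] by (auto simp: ss_def)
    have LR: "L \<subseteq> R" unfolding L_def
      by (rule lspan_least) (use ssR sR E iM in \<open>auto simp: submod_def ideal_in_def intro: subr_intros\<close>)
    \<comment> \<open>One \<open>f\<close> clears the denominators of the ring generators and of all
      products of two module generators. Multiplying two elements of \<open>L\<close> then costs
      only one further factor \<open>f\<close>, which makes \<open>V\<close> below a ring.\<close>
    define xs where "xs = as @ concat (map (\<lambda>s. map (\<lambda>s'. s * s') ss) ss)"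
    have xsL: "set xs \<subseteq> lspan Q ?M ss"
    proof
      fix y assume "y \<in> set xs"
      then have "y \<in> R" using as ssR subr_mult[OF sR] by (auto simp: xs_def subset_iff)
      then show "y \<in> lspan Q ?M ss" by (rule allQ)
    qed
    from clear_list[OF E(1) fr ME xsL] obtain f where f: "f \<in> E" "f \<noteq> 0" "\<And>y. y \<in> set xs \<Longrightarrow> f * y \<in> L"
      unfolding L_def by auto
    have fR: "f \<in> R" using f E by auto
    have mulL: "f * (y * z) \<in> L" if y: "y \<in> L" and z: "z \<in> L" for y z
    proof -
      have 1: "(f * s) * z \<in> L" if s: "s \<in> set ss" for s
      proof (rule lspan_mult_closed[OF sL _ _ z[unfolded L_def]])
        show "(f * s) * s' \<in> L" if "s' \<in> set ss" for s'
          using f(3)[of "s * s'"] s that by (auto simp: xs_def mult.assoc)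
        show "(f * s) * m \<in> L" if "m \<in> ?M" for m
          using ideal_inD(4)[OF iM _ that, of "f * s"] subr_mult[OF sR fR] s ssR subML by auto
      qed
      have "(f * z) * y \<in> L"
      proof (rule lspan_mult_closed[OF sL _ _ y[unfolded L_def]])
        show "(f * z) * s \<in> L" if "s \<in> set ss" for s using 1[OF that] by (simp add: mult_ac)
        show "(f * z) * m \<in> L" if "m \<in> ?M" for m
          using ideal_inD(4)[OF iM _ that, of "f * z"] subr_mult[OF sR fR] z LR subML by auto
      qed
      then show ?thesis by (simp add: mult_ac)
    qed
    have fL: "f ^ k * y \<in> L" if "y \<in> L" for k y
      by (rule submodD(3)[OF sL subr_power[OF E(1) f(1)] that])
    define V where "V = {z \<in> R. \<exists>N. f ^ N * z \<in> L}"
    have "subr V"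
    proof (rule subrI)
      show "1 \<in> V" using one subr_one[OF sR] by (auto simp: V_def intro!: exI[of _ 0])
    next
      fix y z assume "y \<in> V" "z \<in> V"
      then obtain m n where mn: "y \<in> R" "z \<in> R" "f ^ m * y \<in> L" "f ^ n * z \<in> L" by (auto simp: V_def)
      have "f ^ n * (f ^ m * y) + f ^ m * (f ^ n * z) \<in> L" using fL mn submodD(2)[OF sL] by auto
      also have "f ^ n * (f ^ m * y) + f ^ m * (f ^ n * z) = f ^ (m + n) * (y + z)" by (simp add: power_add algebra_simps)
      finally show "y + z \<in> V" using mn subr_add[OF sR] unfolding V_def by blast
      have "f * ((f ^ m * y) * (f ^ n * z)) \<in> L" by (rule mulL[OF mn(3,4)])
      also have "f * ((f ^ m * y) * (f ^ n * z)) = f ^ Suc (m + n) * (y * z)" by (simp add: power_add mult_ac)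
      finally show "y * z \<in> V" using mn subr_mult[OF sR] unfolding V_def by blast
    next
      fix y assume "y \<in> V"
      then obtain m where m: "y \<in> R" "f ^ m * y \<in> L" by (auto simp: V_def)
      have "f ^ m * (- y) \<in> L" using submod_diff[OF E(1) sL submodD(1)[OF sL] m(2)] by simp
      then show "- y \<in> V" using m subr_uminus[OF sR] unfolding V_def by blast
    qed
    moreover have "k \<in> V" if "k \<in> K" for k
    proof -
      have "k \<in> E" using that b(2) poly_ring_at_subr(2)[OF subf_subr[OF b(1)], of b] by (auto simp: E_def)
      from submodD(3)[OF sL this one] show ?thesis using that K by (auto simp: V_def intro!: exI[of _ 0])
    qed
    moreover have "a \<in> V" if "a \<in> set as" for a
      using f(3)[of a] that as by (auto simp: V_def xs_def intro!: exI[of _ 1])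
    ultimately have genV: "generate_ring ambient (K \<union> set as) \<subseteq> V" by (intro generate_ring_min) auto
    have RV: "\<exists>N. f ^ N * z \<in> L" if z: "z \<in> R" for z
    proof -
      obtain y where y: "y \<in> generate_ring ambient (K \<union> set as)" "z - y \<in> ?M" using gen[OF z] by auto
      then obtain N where N: "f ^ N * y \<in> L" using genV by (auto simp: V_def)
      have "f ^ N * (z - y) \<in> L" using fL subML y by auto
      then have "f ^ N * y + f ^ N * (z - y) \<in> L" using N submodD(2)[OF sL] by auto
      then show ?thesis by (auto simp: algebra_simps)
    qed
    \<comment> \<open>Nonzero elements of the field \<open>Q\<close> are units of \<open>R\<close>.
      This independence from the maximal ideal lets \<open>common_denominator\<close> return an
      honest element of \<open>E\<close> and not just one modulo nonunits.\<close>
    have MQ0: "y = 0" if "y \<in> ?M" "y \<in> Q" for y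
      using that subf_inverse[OF Q(1)] Q(3) by (auto simp: nonunits_def)
    obtain c where c: "c \<in> E" "c \<noteq> 0" "\<And>z. z \<in> Q \<Longrightarrow> z \<in> L \<Longrightarrow> c * z \<in> E"
      using common_denominator[OF E(1) Q(1) EQ fr MQ MQ0, of ms] unfolding L_def ss_def by auto
    have tr: "g = 0" if "poly_in Q0 g" "poly g b = 0" for g
      using that b(5) ideal_inD(2)[OF iM] by (auto simp: alg_mod_def)
    obtain z where z: "z \<in> Q" "\<And>N. c * f ^ N * z \<notin> E"
      using transcendental_unbounded_denominators[OF b(1) tr c(1,2)[unfolded E_def] f(1,2)[unfolded E_def]]
      unfolding E_def Qeq by metis
    obtain N where N: "f ^ N * z \<in> L" using RV z(1) Q(3) by auto
    have "f ^ N * z \<in> Q" using z(1) f(1) EQ by (auto intro!: subr_mult subr_power sQ)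
    then have "c * (f ^ N * z) \<in> E" using c(3) N by auto
    then show ?thesis using z(2)[of N] by (simp add: mult.assoc)
  qed
qed

section \<open>Valuation rings and local rings of a regular curve\<close>

text \<open>Valuation rings of rank at most one; fields are included.\<close>

definition arch_val :: "'l::field set \<Rightarrow> 'l set \<Rightarrow> bool" where
  "arch_val V F \<longleftrightarrow> subf F \<and> local_in V \<and> V \<subseteq> F \<and> (\<forall>f\<in>F. f \<notin> V \<longrightarrow> inverse f \<in> nonunits V) \<and>
    (\<forall>\<mu>\<in>nonunits V. \<forall>b\<in>F. b \<noteq> 0 \<longrightarrow> (\<exists>k. \<mu> ^ k / b \<in> V))"

lemma nonunitsD: "x \<in> nonunits V \<Longrightarrow> x \<in> V" "x \<in> nonunits V \<Longrightarrow> x \<noteq> 0 \<Longrightarrow> inverse x \<notin> V"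
  by (auto simp: nonunits_def)

lemma local_nonunits_maximal:
  assumes R: "local_in R" shows "maximalideal M (subring_rec R) \<longleftrightarrow> M = nonunits R"
proof -
  have s: "subr R" using R by (simp add: local_in_def)
  have le: "J \<subseteq> nonunits R" if J: "ideal_in R J" "1 \<notin> J" for J
  proof
    fix x assume x: "x \<in> J"
    have "inverse x * x \<in> J" if "inverse x \<in> R" using ideal_inD(4)[OF J(1) that x] .
    then have "inverse x \<notin> R" if "x \<noteq> 0" using J(2) that by auto
    then show "x \<in> nonunits R" using ideal_inD(1)[OF J(1) x] by (auto simp: nonunits_def)
  qed
  have "1 \<notin> nonunits R" using subr_one[OF s] by (auto simp: nonunits_def)
  then show ?thesis using R le unfolding maximalideal_iff[OF s] local_in_def by blast
qed

lemma genideal_eq: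
  assumes R: "subr R" and S: "S \<subseteq> R" and I: "ideal_in R I" "S \<subseteq> I" "\<And>J. ideal_in R J \<Longrightarrow> S \<subseteq> J \<Longrightarrow> I \<subseteq> J"
  shows "Idl\<^bsub>subring_rec R\<^esub> S = I"
proof -
  interpret cring "subring_rec R" by (rule cring_subring_rec[OF R])
  show ?thesis
  proof
    show "Idl\<^bsub>subring_rec R\<^esub> S \<subseteq> I" by (rule genideal_minimal) (use I ideal_iff[OF R] in auto)
    have "ideal_in R (Idl\<^bsub>subring_rec R\<^esub> S)" using genideal_ideal[of S] S ideal_iff[OF R] by auto
    moreover have "S \<subseteq> Idl\<^bsub>subring_rec R\<^esub> S" using genideal_self[of S] S by auto
    ultimately show "I \<subseteq> Idl\<^bsub>subring_rec R\<^esub> S" by (rule I(3))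
  qed
qed

lemma principal_ideal_in:
  assumes R: "subr R" "t \<in> R" shows "ideal_in R ((*) t ` R)"
  unfolding ideal_in_def
proof (intro conjI ballI)
  show "(*) t ` R \<subseteq> R" using subr_mult[OF R(1)] R(2) by auto
  show "0 \<in> (*) t ` R" using subr_zero[OF R(1)] by force
  fix x assume "x \<in> (*) t ` R" then obtain r where r: "x = t * r" "r \<in> R" by auto
  show "x + y \<in> (*) t ` R" if y: "y \<in> (*) t ` R" for y
  proof -
    obtain q where q: "y = t * q" "q \<in> R" using y by auto
    have "x + y = t * (r + q)" using r q by (simp add: distrib_left)
    then show ?thesis using subr_add[OF R(1)] r q by auto
  qed
next
  fix r x assume "r \<in> R" "x \<in> (*) t ` R"
  then obtain q where q: "r \<in> R" "x = t * q" "q \<in> R" by auto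
  have "r * x = t * (r * q)" using q by (simp add: mult_ac)
  then show "r * x \<in> (*) t ` R" using subr_mult[OF R(1)] q by auto
qed

lemma mem_principal: "subr R \<Longrightarrow> t \<in> (*) t ` R"
  by (auto simp: image_iff intro!: bexI[of _ 1] subr_one)

lemma genideal_singleton:
  assumes R: "subr R" "t \<in> R" shows "Idl\<^bsub>subring_rec R\<^esub> {t} = (*) t ` R"
proof (rule genideal_eq[OF R(1) _ principal_ideal_in[OF R]])
  show "{t} \<subseteq> (*) t ` R" using mem_principal[OF R(1)] by simp
  show "(*) t ` R \<subseteq> J" if "ideal_in R J" "{t} \<subseteq> J" for J using ideal_inD(5)[OF that(1)] that(2) by auto
qed (use R in auto)

lemma genideal_empty:
  assumes R: "subr R" shows "Idl\<^bsub>subring_rec R\<^esub> {} = {0}"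
  by (rule genideal_eq[OF R]) (use prime_in_ideal[OF zero_prime[OF R]] ideal_inD(2) in auto)

lemma arch_val_field:
  assumes "subf F" shows "arch_val F F"
proof -
  have s: "subr F" by (rule subf_subr[OF assms])
  have n: "nonunits F = {0}" using subf_inverse[OF assms] subr_zero[OF s] by (auto simp: nonunits_def)
  have "local_in F" unfolding local_in_def n using s prime_in_ideal[OF zero_prime[OF s]] by auto
  moreover have "\<exists>k. (0::'a) ^ k / b \<in> F" for b using subr_zero[OF s] by (intro exI[of _ 1]) auto
  ultimately show ?thesis using assms by (auto simp: arch_val_def n)
qed

text \<open>Every nonzero \<open>a\<close> is a unit times a power of \<open>t\<close>: for the
  least \<open>n\<close> with \<open>a / t ^ n\<close> outside \<open>R\<close>, the quotient by the
  preceding power is in \<open>R\<close> but not divisible by \<open>t\<close>. The least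
  \<open>n\<close> is not \<open>0\<close> because \<open>a\<close> is in \<open>R\<close>.\<close>

lemma arch_val_dvr:
  assumes R: "local_in R" and t: "t \<in> R" "t \<noteq> 0" "nonunits R = (*) t ` R"
    and sep: "\<And>a. a \<in> R \<Longrightarrow> a \<noteq> 0 \<Longrightarrow> \<exists>n. a / t ^ n \<notin> R"
  shows "arch_val R (localization R {0})"
proof -
  let ?F = "localization R {0}"
  have s: "subr R" using R by (simp add: local_in_def)
  have dec: "\<exists>n u. a = u * t ^ n \<and> u \<in> R \<and> inverse u \<in> R \<and> u \<noteq> 0" if a: "a \<in> R" "a \<noteq> 0" for a
  proof -
    define n where "n = (LEAST n. a / t ^ n \<notin> R)"
    have n1: "a / t ^ n \<notin> R" unfolding n_def by (rule LeastI_ex[OF sep[OF a]])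
    then obtain m where m: "n = Suc m" using a by (cases n) auto
    have u: "a / t ^ m \<in> R" using not_less_Least[of m "\<lambda>n. a / t ^ n \<notin> R"] m n_def by auto
    have "a / t ^ m \<notin> nonunits R"
    proof
      assume "a / t ^ m \<in> nonunits R"
      then obtain r where "a / t ^ m = t * r" "r \<in> R" using t(3) by auto
      then have "a / t ^ n = r" using t(2) m by (simp add: field_simps)
      then show False using n1 \<open>r \<in> R\<close> by simp
    qed
    then have "inverse (a / t ^ m) \<in> R" using u by (auto simp: nonunits_def)
    then show ?thesis using u a t(2) by (intro exI[of _ m] exI[of _ "a / t ^ m"]) auto
  qed
  have val: "inverse f \<in> nonunits R" if f: "f \<in> ?F" "f \<notin> R" for f
  proof -
    obtain a b where ab: "f = a / b" "a \<in> R" "b \<in> R" "b \<noteq> 0" using f(1) by (auto simp: localization_def)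
    have a0: "a \<noteq> 0" using ab f(2) subr_zero[OF s] by auto
    obtain n u where nu: "a = u * t ^ n" "u \<in> R" "inverse u \<in> R" "u \<noteq> 0" using dec[OF ab(2) a0] by auto
    obtain m v where mv: "b = v * t ^ m" "v \<in> R" "inverse v \<in> R" "v \<noteq> 0" using dec[OF ab(3,4)] by auto
    have "n < m"
    proof (rule ccontr)
      assume "\<not> n < m"
      then have "t ^ n = t ^ m * t ^ (n - m)" by (simp flip: power_add)
      then have "f = u * inverse v * t ^ (n - m)" using ab nu mv t(2) by (simp add: field_simps)
      then show False using f(2) subr_mult[OF s] subr_power[OF s] nu mv t(1) by auto
    qed
    then have "t ^ m = t * t ^ (m - Suc n) * t ^ n" by (simp flip: power_add power_Suc)
    then have "b = (v * t * t ^ (m - Suc n)) * t ^ n" unfolding mv(1) by (simp add: mult_ac)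
    then have "inverse f = ((v * t * t ^ (m - Suc n)) * t ^ n) / (u * t ^ n)" using ab(1) nu(1) by simp
    then have "inverse f = t * (v * inverse u * t ^ (m - Suc n))" using t(2) by (simp add: divide_inverse mult_ac)
    moreover have "v * inverse u * t ^ (m - Suc n) \<in> R" by (intro subr_mult subr_power s mv nu t)
    ultimately show ?thesis unfolding t(3) by blast
  qed
  have arch: "\<exists>k. \<mu> ^ k / b \<in> R" if mu: "\<mu> \<in> nonunits R" and b: "b \<in> ?F" "b \<noteq> 0" for \<mu> b
  proof -
    obtain a d where ab: "b = a / d" "a \<in> R" "d \<in> R" "d \<noteq> 0" using b(1) by (auto simp: localization_def)
    have a0: "a \<noteq> 0" using ab b(2) by auto
    obtain n u where nu: "a = u * t ^ n" "u \<in> R" "inverse u \<in> R" "u \<noteq> 0" using dec[OF ab(2) a0] by auto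
    obtain r where r: "\<mu> = t * r" "r \<in> R" using mu t(3) by auto
    have "\<mu> ^ n / b = (t ^ n * r ^ n) / ((u * t ^ n) / d)" unfolding ab(1) nu(1) r(1) by (simp add: power_mult_distrib)
    also have "\<dots> = r ^ n * (d * inverse u)" using t(2) by (simp add: divide_inverse mult_ac)
    also have "\<dots> \<in> R" by (intro subr_mult subr_power s ab nu r)
    finally show ?thesis by (rule exI[of "\<lambda>k. \<mu> ^ k / b \<in> R"])
  qed
  show ?thesis unfolding arch_val_def
    using fraction_field_subf[OF s] R localization_incl[OF zero_prime[OF s] s] val arch by blast
qed

text \<open>If all \<open>a / t ^ n\<close> were in \<open>R\<close>, they would generate an
  ascending chain of principal ideals. Where the chain stops, cancelling \<open>a / t ^ n\<close>
  leaves the inverse of the nonunit \<open>t\<close> in \<open>R\<close>.\<close>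

lemma noetherian_principal_separated:
  assumes R: "local_in R" and noeth: "noetherian_ring (subring_rec R)" and t: "t \<in> nonunits R" "t \<noteq> 0"
    and a: "a \<in> R" "a \<noteq> 0"
  shows "\<exists>n. a / t ^ n \<notin> R"
proof (rule ccontr)
  assume "\<not> ?thesis"
  then have all: "\<And>n. a / t ^ n \<in> R" by auto
  have s: "subr R" using R by (simp add: local_in_def)
  have tR: "t \<in> R" using t by (auto simp: nonunits_def)
  interpret noetherian_ring "subring_rec R" by fact
  define I where "I n = (*) (a / t ^ n) ` R" for n
  have I: "ideal (I n) (subring_rec R)" for n unfolding ideal_iff[OF s] I_def by (rule principal_ideal_in[OF s all])
  have step: "I n \<subseteq> I (Suc n)" for n
  proof
    fix x assume "x \<in> I n"
    then obtain r where r: "x = a / t ^ n * r" "r \<in> R" by (auto simp: I_def)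
    have "x = a / t ^ Suc n * (t * r)" using r t(2) by (simp add: field_simps)
    then show "x \<in> I (Suc n)" unfolding I_def using subr_mult[OF s tR r(2)] by blast
  qed
  then have mono: "m \<le> n \<Longrightarrow> I m \<subseteq> I n" for m n by (rule lift_Suc_mono_le)
  have "I m \<subseteq> I n \<or> I n \<subseteq> I m" for m n using mono[of m n] mono[of n m] by linarith
  then have "subset.chain {I. ideal I (subring_rec R)} (range I)"
    unfolding pred_on.chain_def using I by auto
  then have "\<Union>(range I) \<in> range I" using ideal_chain_is_trivial[of "range I"] by auto
  then obtain n where n: "\<Union>(range I) = I n" by auto
  have "a / t ^ Suc n \<in> I (Suc n)" unfolding I_def by (rule mem_principal[OF s])
  then have "a / t ^ Suc n \<in> I n" using n by auto
  then obtain r where "a / t ^ Suc n = a / t ^ n * r" "r \<in> R" by (auto simp: I_def)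
  then have "inverse t = r" using a t(2) by (simp add: field_simps)
  then show False using t nonunitsD(2) \<open>r \<in> R\<close> by blast
qed

lemma krull_dim_le:
  assumes R: "subr R"
    and "\<And>q. (\<And>i. i \<le> Suc n \<Longrightarrow> prime_in R (q i)) \<Longrightarrow> (\<And>i. i \<le> n \<Longrightarrow> q i \<subset> q (Suc i)) \<Longrightarrow> False"
  shows "krull_dim (subring_rec R) \<le> enat n"
  unfolding krull_dim_def
proof (rule Sup_least)
  fix d assume "d \<in> {enat n |n. \<exists>\<pp>. (\<forall>i\<le>n. primeideal (\<pp> i) (subring_rec R)) \<and> (\<forall>i<n. \<pp> i \<subset> \<pp> (Suc i))}"
  then obtain m q where m: "d = enat m" "\<And>i. i \<le> m \<Longrightarrow> prime_in R (q i)" "\<And>i. i < m \<Longrightarrow> q i \<subset> q (Suc i)"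
    by (auto simp: primeideal_iff[OF R])
  have "m \<le> n"
  proof (rule ccontr)
    assume "\<not> m \<le> n"
    then show False by (intro assms(2)[of q] m) auto
  qed
  then show "d \<le> enat n" using m(1) by simp
qed

text \<open>Without a chain of three primes the Krull dimension is at most one, so regularity
  provides at most one generator of the maximal ideal. An empty set of generators, or the generator
  \<open>0\<close>, makes the ring a field.\<close>

lemma regular_local_dim_le_1:
  assumes R: "local_in R" and reg: "regular_local_ring (subring_rec R)"
    and dim: "\<not> (\<exists>a b c. prime_in R a \<and> prime_in R b \<and> prime_in R c \<and> a \<subset> b \<and> b \<subset> c)"
  shows "arch_val R (localization R {0})"
proof -
  have s: "subr R" using R by (simp add: local_in_def)
  obtain S where S: "S \<subseteq> R" "finite S" "maximalideal (Idl\<^bsub>subring_rec R\<^esub> S) (subring_rec R)" "enat (card S) = krull_dim (subring_rec R)"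
    and noeth: "noetherian_ring (subring_rec R)"
    using reg by (auto simp: regular_local_ring_def)
  have max: "Idl\<^bsub>subring_rec R\<^esub> S = nonunits R" using S(3) local_nonunits_maximal[OF R] by auto
  have "krull_dim (subring_rec R) \<le> enat 1"
  proof (rule krull_dim_le[OF s])
    fix q :: "nat \<Rightarrow> 'a set"
    assume "\<And>i. i \<le> Suc 1 \<Longrightarrow> prime_in R (q i)" "\<And>i. i \<le> 1 \<Longrightarrow> q i \<subset> q (Suc i)"
    then have "prime_in R (q 0)" "prime_in R (q 1)" "prime_in R (q (Suc 1))" "q 0 \<subset> q 1" "q 1 \<subset> q (Suc 1)"
      by (metis One_nat_def le_SucI order_refl zero_le)+
    then show False using dim by blast
  qed
  then have c1: "card S \<le> 1" using S(4)[symmetric] by simp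
  have fieldcase: ?thesis if "nonunits R \<subseteq> {0}"
  proof -
    have f: "subf R" using that s unfolding subf_def
    proof (intro conjI ballI)
      fix x assume x: "x \<in> R"
      show "inverse x \<in> R"
      proof (cases "x = 0")
        case False then show ?thesis using that x local_unit[of x R] by auto
      qed (use x in simp)
    qed
    have "localization R {0} = R" using localization_incl[OF zero_prime[OF s] s] subf_divide[OF f] by (auto simp: localization_def)
    then show ?thesis using arch_val_field[OF f] by simp
  qed
  show ?thesis
  proof (cases "S = {}")
    case True
    then show ?thesis using fieldcase max genideal_empty[OF s] by simp
  next
    case False
    then have "card S = 1" using c1 S(2) by (metis card_0_eq le_antisym less_one not_le)
    then obtain t where t: "S = {t}" by (auto simp: card_1_singleton_iff)
    have tR: "t \<in> R" using t S by auto
    have nt: "nonunits R = (*) t ` R" using max t genideal_singleton[OF s tR] by simp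
    have tn: "t \<in> nonunits R" unfolding nt by (rule mem_principal[OF s])
    show ?thesis
    proof (cases "t = 0")
      case True then show ?thesis using nt fieldcase by auto
    next
      case False
      show ?thesis by (rule arch_val_dvr[OF R tR False nt noetherian_principal_separated[OF R noeth tn False]])
    qed
  qed
qed

text \<open>Both parts of the axiom are tested on p-power iterates, which lie in \<open>F\<close>.
  The existence of a uniformizer does not pass to roots in this way and is not claimed here.\<close>

lemma arch_val_radicial:
  fixes V F L :: "'l::field set"
  assumes p: "prime p" "CHAR('l) = p" and V: "arch_val V F" and L: "subf L" "radicial p F L"
  defines "B \<equiv> {x \<in> L. \<exists>n. x ^ p ^ n \<in> V}"
  shows "arch_val B L" "radicial p V B" "subr B"
proof -
  have p0: "p > 0" using p by (simp add: prime_gt_0_nat)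
  have Vl: "local_in V" "V \<subseteq> F" "subf F" using V by (auto simp: arch_val_def)
  have sV: "subr V" using Vl by (simp add: local_in_def)
  have FL: "F \<subseteq> L" using L by (simp add: radicial_def)
  have "B = L \<inter> {x. \<exists>n. x ^ p ^ n \<in> V}" by (auto simp: B_def)
  then show sB: "subr B" using subr_power_root[OF p sV] subf_subr[OF L(1)] by (auto simp: subr_def)
  have "V \<subseteq> B" using Vl(2) FL by (auto simp: B_def intro!: exI[of _ 0])
  then show rad: "radicial p V B" by (auto simp: radicial_def B_def)
  note rl = radicial_local[OF p Vl(1) sB rad]
  have val: "inverse f \<in> nonunits B" if f: "f \<in> L" "f \<notin> B" for f
  proof -
    obtain n where n: "f ^ p ^ n \<in> F" using L(2) f by (auto simp: radicial_def)
    have "f ^ p ^ n \<notin> V" using f by (auto simp: B_def)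
    then have "inverse (f ^ p ^ n) \<in> nonunits V" using V n by (auto simp: arch_val_def)
    then have "inverse f ^ p ^ n \<in> nonunits V" by (simp add: power_inverse)
    moreover have "inverse f \<in> L" using subf_inverse[OF L(1) f(1)] .
    ultimately have "inverse f \<in> rad_ideal p B (nonunits V)" using nonunitsD(1) by (auto simp: rad_ideal_def B_def)
    then show ?thesis using rl(1) by simp
  qed
  have arch: "\<exists>k. \<mu> ^ k / b \<in> B" if mu: "\<mu> \<in> nonunits B" and b: "b \<in> L" "b \<noteq> 0" for \<mu> b
  proof -
    obtain n where n: "\<mu> ^ p ^ n \<in> nonunits V" using mu rl(1) by (auto simp: rad_ideal_def)
    obtain j where j: "b ^ p ^ j \<in> F" using L(2) b by (auto simp: radicial_def)
    have "b ^ p ^ j \<noteq> 0" using b by simp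
    then obtain k where k: "(\<mu> ^ p ^ n) ^ k / b ^ p ^ j \<in> V" using V n j unfolding arch_val_def by blast
    define v where "v = \<mu> ^ p ^ n"
    have v: "v \<in> V" "v ^ k / b ^ p ^ j \<in> V" using n k nonunitsD(1) by (auto simp: v_def)
    \<comment> \<open>Only \<open>b ^ p ^ j\<close> is known to divide a power of \<open>v\<close>
      in \<open>V\<close>. The p-power of \<open>v ^ k / b\<close> has exactly that denominator and
      extra factors of \<open>v\<close> in its numerator, so it lies in \<open>V\<close>.\<close>
    have "p ^ j = Suc (p ^ j - 1)" using p0 by simp
    then have "(v ^ k) ^ p ^ j = v ^ k * (v ^ k) ^ (p ^ j - 1)" by (metis power_Suc)
    then have "(v ^ k / b) ^ p ^ j = (v ^ k / b ^ p ^ j) * (v ^ k) ^ (p ^ j - 1)" by (simp add: power_divide)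
    also have "\<dots> \<in> V" by (intro subr_mult subr_power sV v)
    finally have "(v ^ k / b) ^ p ^ j \<in> V" .
    moreover have "v ^ k / b \<in> L" using v(1) Vl(2) FL b by (intro subf_divide L subr_power subf_subr) auto
    ultimately have "\<mu> ^ (p ^ n * k) / b \<in> B" by (auto simp: B_def v_def power_mult)
    then show ?thesis by auto
  qed
  show "arch_val B L" unfolding arch_val_def using L rl(2) val arch by (auto simp: B_def)
qed

text \<open>An element of \<open>B\<close> satisfies the monic equation given by its p-power lying
  in \<open>A\<close>. Conversely, if an integral \<open>x\<close> were outside \<open>B\<close>,
  its inverse would be a nonunit of \<open>B\<close>, and dividing the equation by the top power of
  \<open>x\<close> would place \<open>1\<close> among the nonunits.\<close>

lemma integral_closure_arch_val:
  assumes B: "arch_val B L" and A: "subr A" "A \<subseteq> B" and rad: "radicial p A B" and p0: "p > 0"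
  shows "integral_closure L A = B"
proof (intro equalityI subsetI)
  have lB: "local_in B" "B \<subseteq> L" using B by (auto simp: arch_val_def)
  have sB: "subr B" and iB: "ideal_in B (nonunits B)" using lB by (auto simp: local_in_def)
  fix x
  {
    assume x: "x \<in> B"
    then obtain n where n: "x ^ p ^ n \<in> A" using rad by (auto simp: radicial_def)
    define f where "f = Polynomial.monom 1 (p ^ n) - [:x ^ p ^ n:]"
    have d: "Polynomial.degree f = p ^ n" unfolding f_def
    proof (rule antisym)
      show "Polynomial.degree (Polynomial.monom 1 (p ^ n) - [:x ^ p ^ n:]) \<le> p ^ n"
        by (intro degree_diff_le) (auto simp: degree_monom_eq)
      show "p ^ n \<le> Polynomial.degree (Polynomial.monom 1 (p ^ n) - [:x ^ p ^ n:])"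
        using p0 by (intro le_degree) (simp add: coeff_pCons split: nat.split)
    qed
    have "Polynomial.lead_coeff f = 1" unfolding d using p0 by (simp add: f_def coeff_pCons split: nat.split)
    moreover have "poly_in A f" unfolding f_def by (intro poly_in_intros A n subr_one)
    moreover have "poly f x = 0" by (simp add: f_def poly_monom)
    ultimately show "x \<in> integral_closure L A" using x lB by (auto simp: integral_closure_def poly_in_def)
  }
  assume x: "x \<in> integral_closure L A"
  then obtain f where f: "poly_in A f" "Polynomial.lead_coeff f = 1" "poly f x = 0" and xL: "x \<in> L"
    by (auto simp: integral_closure_def poly_in_def)
  show "x \<in> B"
  proof (rule ccontr)
    assume xB: "x \<notin> B"
    then have y: "inverse x \<in> nonunits B" using B xL by (auto simp: arch_val_def)
    have x0: "x \<noteq> 0" using xB subr_zero[OF sB] by auto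
    define d where "d = Polynomial.degree f"
    have "poly f x = x ^ d + (\<Sum>i<d. Polynomial.coeff f i * x ^ i)"
      using f(2) by (simp add: poly_altdef d_def lessThan_Suc_atMost[symmetric])
    then have "0 = inverse x ^ d * (x ^ d + (\<Sum>i<d. Polynomial.coeff f i * x ^ i))" using f(3) by simp
    also have "\<dots> = 1 + (\<Sum>i<d. Polynomial.coeff f i * (inverse x ^ d * x ^ i))"
      using x0 by (simp add: distrib_left sum_distrib_left power_inverse mult_ac)
    also have "(\<Sum>i<d. Polynomial.coeff f i * (inverse x ^ d * x ^ i)) = (\<Sum>i<d. Polynomial.coeff f i * inverse x ^ (d - i))"
    proof (rule sum.cong)
      fix i assume "i \<in> {..<d}"
      then have "inverse x ^ d = inverse x ^ (d - i) * inverse x ^ i" by (simp flip: power_add)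
      then have "inverse x ^ d * x ^ i = inverse x ^ (d - i)" using x0 by (simp add: power_inverse)
      then show "Polynomial.coeff f i * (inverse x ^ d * x ^ i) = Polynomial.coeff f i * inverse x ^ (d - i)" by simp
    qed simp
    finally have "1 = - (\<Sum>i<d. Polynomial.coeff f i * inverse x ^ (d - i))" by (simp add: add_eq_0_iff)
    moreover have "(\<Sum>i\<in>I. Polynomial.coeff f i * inverse x ^ (d - i)) \<in> nonunits B" if "finite I" "I \<subseteq> {..<d}" for I
      using that
    proof (induction I rule: finite_induct)
      case empty then show ?case using ideal_inD(2)[OF iB] by simp
    next
      case (insert i I)
      have "inverse x ^ (d - i) \<in> nonunits B" by (rule ideal_in_power[OF sB iB y]) (use insert in auto)
      then have "Polynomial.coeff f i * inverse x ^ (d - i) \<in> nonunits B"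
        using ideal_inD(4)[OF iB] f(1) A by (auto simp: poly_in_def)
      then show ?case using insert ideal_inD(3)[OF iB] by auto
    qed
    then have "(\<Sum>i<d. Polynomial.coeff f i * inverse x ^ (d - i)) \<in> nonunits B" by auto
    ultimately have "1 \<in> nonunits B" using ideal_in_uminus[OF sB iB] by metis
    then show False using local_prime[OF lB(1)] by (auto simp: prime_in_def)
  qed
qed

lemma irreducible_closed_closure:
  assumes "x \<in> topspace T" shows "irreducible_closed T (T closure_of {x})"
  unfolding irreducible_closed_def
proof (intro conjI allI impI)
  have x: "x \<in> T closure_of {x}" using assms by (meson closure_of_subset empty_subsetI insert_subset subsetD singletonI)
  show "closedin T (T closure_of {x})" by simp
  show "T closure_of {x} \<noteq> {}" using x by auto
  fix A B assume AB: "closedin T A \<and> closedin T B \<and> T closure_of {x} \<subseteq> A \<union> B"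
  then have "x \<in> A \<or> x \<in> B" using x by auto
  then show "T closure_of {x} \<subseteq> A \<or> T closure_of {x} \<subseteq> B"
    using AB closure_of_minimal[of "{x}" A T] closure_of_minimal[of "{x}" B T] by auto
qed

section \<open>Dimension, normalization and residues at a point of the curve\<close>

context base_change_setting
begin

lemma specialization:
  assumes U: "affine_open C U" and xy: "x \<in> U" "y \<in> U"
  shows "x \<in> top_space C closure_of {y} \<longleftrightarrow> pr U y \<subseteq> pr U x"
proof
  assume x: "x \<in> top_space C closure_of {y}"
  show "pr U y \<subseteq> pr U x"
  proof
    fix g assume g: "g \<in> pr U y"
    show "g \<in> pr U x"
    proof (rule ccontr)
      assume gx: "g \<notin> pr U x"
      have "g \<in> sections C U" using g by (simp add: pr_def)
      from C_basic_open[OF U this] have "openin (top_space C) {x \<in> U. g \<notin> pr U x}" .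
      moreover have "x \<in> {x \<in> U. g \<notin> pr U x}" using gx xy by auto
      ultimately obtain y' where "y' \<in> {y}" "y' \<in> {x \<in> U. g \<notin> pr U x}" using x unfolding in_closure_of by meson
      then have "g \<notin> pr U y" by simp
      then show False using g by simp
    qed
  qed
next
  assume le: "pr U y \<subseteq> pr U x"
  show "x \<in> top_space C closure_of {y}" unfolding in_closure_of
  proof (intro conjI allI impI)
    show "x \<in> points C" using xy affine_points[OF U] by auto
    fix W assume W: "x \<in> W \<and> openin (top_space C) W"
    then obtain g where g: "g \<notin> pr U x" "{z \<in> U. g \<notin> pr U z} \<subseteq> W"
      using C_basis[OF U _ _ xy(1), of W] by auto
    then have "y \<in> W" using le xy by auto
    then show "\<exists>z. z \<in> {y} \<and> z \<in> W" by auto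
  qed
qed

text \<open>Contraction to the sections is strictly monotone on the primes of a localization. Three
  nested primes thus become three points whose closures are strictly nested irreducible closed sets,
  contradicting topological dimension one.\<close>

lemma stalk_dim:
  assumes dim: "top_dim (top_space C) = 1" and P: "P \<in> points C"
    and abc: "prime_in (stalk C P) a" "prime_in (stalk C P) b" "prime_in (stalk C P) c" "a \<subset> b" "b \<subset> c"
  shows False
proof -
  obtain U where U: "affine_open C U" "P \<in> U" using ex_affine[OF P] by auto
  define R where "R = sections C U"
  have R: "subr R" unfolding R_def by (rule sections_subr[OF affine_points[OF U(1)]])
  have st: "stalk C P = localization R (pr U P)" "prime_in R (pr U P)" using affine_stalk[OF U] by (auto simp: R_def)
  have RS: "R \<subseteq> stalk C P" using localization_incl[OF st(2) R] st(1) by simp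
  have strict: "a \<inter> R \<subset> b \<inter> R" if ab: "prime_in (stalk C P) a" "prime_in (stalk C P) b" "a \<subset> b" for a b
  proof -
    obtain x where x: "x \<in> b" "x \<notin> a" using ab by auto
    have "x \<in> stalk C P" using x ideal_inD(1)[OF prime_in_ideal[OF ab(2)]] by auto
    then obtain r s where rs: "x = r / s" "r \<in> R" "s \<in> R - pr U P" using st(1) by (auto simp: localization_def)
    have s0: "s \<noteq> 0" using rs ideal_inD(2)[OF prime_in_ideal[OF st(2)]] by auto
    have "inverse s \<in> stalk C P" unfolding st(1) using rs subr_one[OF R] by (intro localizationI[of _ 1 s]) (auto simp: field_simps)
    then have "r \<notin> a" using ideal_inD(5)[OF prime_in_ideal[OF ab(1)], of "inverse s" r] x rs by (auto simp: divide_inverse)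
    moreover have "r = x * s" using rs s0 by simp
    then have "r \<in> b" using ideal_inD(5)[OF prime_in_ideal[OF ab(2)], of s x] x rs RS by auto
    ultimately show ?thesis using rs ab by auto
  qed
  have pc: "prime_in R (q \<inter> R)" if "prime_in (stalk C P) q" for q by (rule prime_in_contract[OF R RS that])
  have ex: "\<exists>x\<in>U. pr U x = q \<inter> R" if "prime_in (stalk C P) q" for q
    using pc[OF that] affine_homeo(3)[OF U(1), folded R_def] by (metis (mono_tags, lifting) imageE mem_Collect_eq)
  obtain x y z where xyz: "x \<in> U" "y \<in> U" "z \<in> U" "pr U x = a \<inter> R" "pr U y = b \<inter> R" "pr U z = c \<inter> R"
    using ex[OF abc(1)] ex[OF abc(2)] ex[OF abc(3)] by auto
  let ?T = "top_space C"
  \<comment> \<open>Larger primes have smaller closures, so the chain begins with the point of the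
    largest prime \<open>c\<close>.\<close>
  define Z where "Z i = ?T closure_of {if i = 0 then z else if i = Suc 0 then y else x}" for i :: nat
  have sub: "?T closure_of {v} \<subset> ?T closure_of {u}" if uv: "u \<in> U" "v \<in> U" "pr U u \<subset> pr U v" for u v
  proof
    have "v \<in> ?T closure_of {u}" using specialization[OF U(1) uv(2,1)] uv(3) by auto
    then show "?T closure_of {v} \<subseteq> ?T closure_of {u}" by (intro closure_of_minimal) auto
    have "u \<notin> ?T closure_of {v}" using specialization[OF U(1) uv(1,2)] uv(3) by auto
    moreover have "u \<in> ?T closure_of {u}" using specialization[OF U(1) uv(1,1)] by auto
    ultimately show "?T closure_of {v} \<noteq> ?T closure_of {u}" by auto
  qed
  have "irreducible_closed ?T (Z i)" for i unfolding Z_def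
    by (rule irreducible_closed_closure) (use xyz affine_points[OF U(1)] in auto)
  moreover have "Z i \<subset> Z (Suc i)" if "i < 2" for i
    using that sub[of x y] sub[of y z] xyz strict[OF abc(1,2,4)] strict[OF abc(2,3,5)]
    by (cases i) (auto simp: Z_def numeral_2_eq_2)
  ultimately have "enat 2 \<in> {enat n | n. \<exists>Z. (\<forall>i\<le>n. irreducible_closed ?T (Z i)) \<and> (\<forall>i<n. Z i \<subset> Z (Suc i))}" by blast
  then have "enat 2 \<le> top_dim ?T" unfolding top_dim_def by (rule Sup_upper)
  then show False using dim by (simp add: one_enat_def)
qed

lemma stalk_fraction_field:
  assumes P: "P \<in> points C" shows "localization (stalk C P) {0} = fun_field C"
proof (intro equalityI subsetI)
  obtain U where U: "affine_open C U" "P \<in> U" using ex_affine[OF P] by auto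
  fix x
  {
    assume "x \<in> localization (stalk C P) {0}"
    then show "x \<in> fun_field C" using stalk_fun_field[OF P] subf_divide[OF fun_field_subf] by (auto simp: localization_def)
  }
  assume "x \<in> fun_field C"
  moreover have "fun_field C = localization (sections C U) {0}" using U by (simp add: affine_open_def)
  moreover have "sections C U \<subseteq> stalk C P" using U by (auto simp: sections_def)
  ultimately show "x \<in> localization (stalk C P) {0}" unfolding localization_def by blast
qed

lemma stalk_arch_val:
  assumes "top_dim (top_space C) = 1" "regular_scheme C" "P \<in> points C"
  shows "arch_val (stalk C P) (fun_field C)"
proof -
  have "regular_local_ring (subring_rec (stalk C P))" using assms by (auto simp: regular_scheme_def regular_at_def)
  from regular_local_dim_le_1[OF stalk_local[OF assms(3)] this] show ?thesis
    using stalk_dim[OF assms(1,3)] stalk_fraction_field[OF assms(3)] by metis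
qed

text \<open>The local ring of the normalized base change over \<open>P\<close>.\<close>

definition nrm :: "'x \<Rightarrow> 'l set" where
  "nrm P = {x \<in> bc (fun_field C). \<exists>n. x ^ p ^ n \<in> stalk C P}"

lemma nrm_arch_val:
  assumes P: "P \<in> points C" and av: "arch_val (stalk C P) (fun_field C)"
  shows "arch_val (nrm P) (bc (fun_field C))" "radicial p (stalk C P) (nrm P)" "bc (stalk C P) \<subseteq> nrm P"
    "radicial p (bc (stalk C P)) (nrm P)" "subr (nrm P)"
proof -
  have KF: "K \<subseteq> fun_field C" using stalk_over[OF P] stalk_fun_field[OF P] by auto
  have r: "radicial p (fun_field C) (bc (fun_field C))" by (rule bc_radicial[OF subf_subr[OF fun_field_subf] KF])
  have sf: "subf (bc (fun_field C))" by (rule radicial_subf[OF r fun_field_subf bc_subr p0])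
  note a = arch_val_radicial[OF p av sf r, folded nrm_def]
  show "arch_val (nrm P) (bc (fun_field C))" "radicial p (stalk C P) (nrm P)" "subr (nrm P)" by (rule a)+
  show 1: "bc (stalk C P) \<subseteq> nrm P"
    using bc_mono[OF stalk_fun_field[OF P]] stalk_bc(1)[OF P] by (auto simp: nrm_def radicial_def)
  show "radicial p (bc (stalk C P)) (nrm P)" using 1 a(2) bc_incl(1)[of "stalk C P"] by (auto simp: radicial_def) blast
qed

text \<open>The points of the normalization over \<open>pt P\<close> are the primes of
  \<open>nrm P\<close> over the maximal ideal of the local ring below. The extension is radicial, so
  there is just one, namely the ideal of nonunits, and localizing there changes nothing.\<close>

lemma normal_point_stalk:
  assumes P: "P \<in> points C" and av: "arch_val (stalk C P) (fun_field C)"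
  shows "stalk (normalized_scheme C') (normal_point C' (pt P)) = nrm P"
proof -
  let ?A = "bc (stalk C P)" and ?B = "nrm P"
  define IC where "IC = integral_closure (fun_field C')"
  note n = nrm_arch_val[OF P av]
  have stA: "stalk C' (pt P) = ?A" by (rule stalk_C'[OF P])
  have IC: "IC ?A = ?B" unfolding IC_def fun_field_C' by (rule integral_closure_arch_val[OF n(1) bc_subr n(3,4) p0])
  have lA: "local_in ?A" by (rule stalk_bc(3)[OF P])
  note rl = radicial_local[OF p lA n(5,4)]
  note rp = radicial_prime[OF p bc_subr n(5,4) local_prime[OF lA]]
  obtain U where U: "affine_open C U" "P \<in> U" using ex_affine[OF P] by auto
  have U': "affine_open C' (pt ` U)" "pt P \<in> pt ` U" using affine_open_C'[OF U(1)] U by auto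
  have ptP: "pt P \<in> points C'" using P C'_points by auto
  have rel: "(pt P, q) \<in> rel_spec_points IC C' \<longleftrightarrow> q = nonunits ?B" for q
  proof -
    have "(pt P, q) \<in> rel_spec_points IC C' \<longleftrightarrow> prime_in ?B q \<and> q \<inter> ?A = nonunits ?A"
      using ptP by (simp add: rel_spec_points_def stA IC primeideal_iff n(5))
    also have "\<dots> \<longleftrightarrow> q = nonunits ?B" using rp(1,2)[unfolded rl(1)] rp(3)[of q, unfolded rl(1)] by metis
    finally show ?thesis .
  qed
  have top: "points (normalized_scheme C') = \<Union>{{(x, \<qq>) \<in> rel_spec_points IC C'. x \<in> U \<and> f \<notin> \<qq>} | U f. affine_open C' U \<and> f \<in> IC (sections C' U)}"
    by (simp add: normalized_scheme_def rel_spec_def IC_def)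
  have "sections C' (pt ` U) \<subseteq> fun_field C'" by (auto simp: sections_def)
  have one: "1 \<in> IC (sections C' (pt ` U))"
  proof -
    have sL: "subr (bc (fun_field C))" by simp
    have sS: "subr (sections C' (pt ` U))"
    proof -
      have "subr (stalk C' z)" if "z \<in> pt ` U" for z using that stalk_C' affine_points[OF U(1)] by auto
      then show ?thesis using sL unfolding sections_def fun_field_C' subr_def by auto
    qed
    have "poly_in (sections C' (pt ` U)) [:-1, 1:]" by (intro poly_in_intros sS subr_intros)
    moreover have "Polynomial.lead_coeff [:-1, 1:: 'l:] = 1" "poly [:-1, 1::'l:] 1 = 0" by auto
    ultimately show ?thesis unfolding IC_def integral_closure_def poly_in_def
      using subr_one[OF sL] by (auto simp: fun_field_C' intro!: exI[of _ "[:-1, 1:]"])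
  qed
  have "normal_point C' (pt P) = (pt P, nonunits ?B)"
    unfolding normal_point_def
  proof (rule the_equality)
    have "1 \<notin> nonunits ?B" using subr_one[OF n(5)] by (auto simp: nonunits_def)
    then have "(pt P, nonunits ?B) \<in> {(x, \<qq>) \<in> rel_spec_points IC C'. x \<in> pt ` U \<and> 1 \<notin> \<qq>}" using rel U' by auto
    then have "(pt P, nonunits ?B) \<in> points (normalized_scheme C')" unfolding top using U'(1) one by blast
    then show "(pt P, nonunits ?B) \<in> points (normalized_scheme C') \<and> fst (pt P, nonunits ?B) = pt P" by simp
    fix z assume z: "z \<in> points (normalized_scheme C') \<and> fst z = pt P"
    then obtain q where q: "z = (pt P, q)" by (cases z) auto
    have "z \<in> rel_spec_points IC C'" using z unfolding top by auto
    then show "z = (pt P, nonunits ?B)" using rel q by auto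
  qed
  then show ?thesis by (simp add: normalized_scheme_def rel_spec_def IC_def[symmetric] stA IC rl(3))
qed

text \<open>The prime of a closed point is maximal: a prime containing it and the denominator
  \<open>s\<close> would be a point in the closure of \<open>P\<close> different from
  \<open>P\<close>. Hence \<open>1 - s * r\<close> lies in it for some section \<open>r\<close>, and
  \<open>a / s\<close> is congruent to \<open>a * r\<close>.\<close>

lemma closed_point_residue:
  assumes P: "P \<in> points C" "closedin (top_space C) {P}" and U: "affine_open C U" "P \<in> U" and x: "x \<in> stalk C P"
  shows "\<exists>y\<in>sections C U. x - y \<in> nonunits (stalk C P)"
proof -
  define R where "R = sections C U"
  define m where "m = pr U P"
  have R: "subr R" unfolding R_def by (rule sections_subr[OF affine_points[OF U(1)]])
  have st: "stalk C P = localization R m" "prime_in R m" using affine_stalk[OF U] by (auto simp: R_def m_def)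
  note im = prime_in_ideal[OF st(2)]
  obtain a s where as: "x = a / s" "a \<in> R" "s \<in> R" "s \<notin> m" using x st(1) by (auto simp: localization_def)
  have s0: "s \<noteq> 0" using as ideal_inD(2)[OF im] by auto
  define I where "I = {u + s * r | u r. u \<in> m \<and> r \<in> R}"
  have I: "ideal_in R I" unfolding ideal_in_def
  proof (intro conjI ballI)
    show "I \<subseteq> R" using as ideal_inD(1)[OF im] by (auto simp: I_def intro: subr_intros R)
    show "0 \<in> I" unfolding I_def using ideal_inD(2)[OF im] subr_zero[OF R] by force
    fix i assume "i \<in> I" then obtain u r where u: "i = u + s * r" "u \<in> m" "r \<in> R" by (auto simp: I_def)
    show "i + j \<in> I" if "j \<in> I" for j
    proof -
      obtain v q where v: "j = v + s * q" "v \<in> m" "q \<in> R" using \<open>j \<in> I\<close> by (auto simp: I_def)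
      have "i + j = (u + v) + s * (r + q)" using u v by (simp add: algebra_simps)
      moreover have "u + v \<in> m" "r + q \<in> R" using u v ideal_inD(3)[OF im] subr_add[OF R] by auto
      ultimately show ?thesis unfolding I_def by blast
    qed
  next
    fix q i assume q: "q \<in> R" and "i \<in> I"
    then obtain u r where u: "i = u + s * r" "u \<in> m" "r \<in> R" by (auto simp: I_def)
    have "q * i = q * u + s * (q * r)" using u by (simp add: algebra_simps)
    moreover have "q * u \<in> m" "q * r \<in> R" using u q ideal_inD(4)[OF im] subr_mult[OF R] by auto
    ultimately show "q * i \<in> I" unfolding I_def by blast
  qed
  have mI: "m \<subseteq> I"
  proof
    fix u assume "u \<in> m"
    moreover have "u = u + s * 0" by simp
    ultimately show "u \<in> I" unfolding I_def using subr_zero[OF R] by blast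
  qed
  have sI: "s \<in> I"
  proof -
    have "s = 0 + s * 1" by simp
    then show ?thesis unfolding I_def using subr_one[OF R] ideal_inD(2)[OF im] by blast
  qed
  have "1 \<in> I"
  proof (rule ccontr)
    assume "1 \<notin> I"
    then obtain q where q: "prime_in R q" "I \<subseteq> q" using ex_prime_above[OF R I] by auto
    have "q \<in> pr U ` U" using q affine_homeo(3)[OF U(1), folded R_def] by simp
    then obtain y where y: "q = pr U y" "y \<in> U" by (rule imageE)
    then have "y \<in> top_space C closure_of {P}" using specialization[OF U(1) y(2) U(2)] mI q by (auto simp: m_def)
    then have "y = P" using closure_of_closedin[OF P(2)] by auto
    then show False using y q sI as by (auto simp: m_def)
  qed
  then obtain u r where u: "1 = u + s * r" "u \<in> m" "r \<in> R" by (auto simp: I_def)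
  have "x - a * r = (a * u) / s" using as s0 u(1) by (simp add: field_simps) (metis distrib_left mult.commute mult.right_neutral mult.assoc)
  moreover have "a * u \<in> m" using ideal_inD(4)[OF im] as u by auto
  ultimately have "x - a * r \<in> nonunits (stalk C P)" unfolding st(1) localization_nonunits[OF R st(2)] using as by blast
  moreover have "a * r \<in> R" using as u subr_mult[OF R] by auto
  ultimately show ?thesis by (auto simp: R_def)
qed

end

section \<open>Principal maximal ideals and regularity\<close>

text \<open>The archimedean axiom makes some power of \<open>t\<close> divisible by
  \<open>b\<close>. For the least such power the quotient is not divisible by \<open>t\<close>,
  hence is a unit.\<close>

lemma principal_decomposition:
  assumes B: "arch_val B L" and t: "t \<in> B" "t \<noteq> 0" "nonunits B = (*) t ` B" and b: "b \<in> B" "b \<noteq> 0"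
  obtains n u where "b * u = t ^ n" "u \<in> B" "inverse u \<in> B" "u \<noteq> 0"
proof -
  have lB: "local_in B" "B \<subseteq> L" using B by (auto simp: arch_val_def)
  have s: "subr B" using lB by (simp add: local_in_def)
  have tn: "t \<in> nonunits B" unfolding t(3) by (rule mem_principal[OF s])
  have ex: "\<exists>n. t ^ n / b \<in> B" using B tn b lB unfolding arch_val_def by blast
  define n where "n = (LEAST n. t ^ n / b \<in> B)"
  define u where "u = t ^ n / b"
  have u: "u \<in> B" unfolding u_def n_def by (rule LeastI_ex[OF ex])
  have "u \<notin> nonunits B"
  proof
    assume un: "u \<in> nonunits B"
    then obtain r where r: "u = t * r" "r \<in> B" using t(3) by auto
    show False
    proof (cases n)
      case 0
      then have "inverse u = b" by (simp add: u_def)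
      then show False using un b nonunitsD(2)[of u B] by (auto simp: u_def 0)
    next
      case (Suc m)
      then have "t ^ m / b = r" using r(1) t(2) b(2) by (simp add: u_def field_simps)
      then have "n \<le> m" unfolding n_def using r(2) by (intro Least_le) simp
      then show False using Suc by simp
    qed
  qed
  then show thesis using that[of u n] u b t(2) local_unit[of u B] by (auto simp: u_def)
qed

text \<open>The value \<open>t = 0\<close> is allowed and is the case of a field, of dimension zero
  with an empty set of generators. Otherwise a nonzero prime contains a power of \<open>t\<close>,
  and a nonzero ideal is generated by the least power of \<open>t\<close> in it.\<close>

lemma regular_of_principal:
  assumes B: "arch_val B L" and t: "t \<in> B" "nonunits B = (*) t ` B"
  shows "regular_local_ring (subring_rec B)"
proof -
  have lB: "local_in B" "B \<subseteq> L" using B by (auto simp: arch_val_def)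
  have s: "subr B" using lB by (simp add: local_in_def)
  have cr: "cring (subring_rec B)" by (rule cring_subring_rec[OF s])
  interpret cring "subring_rec B" by (rule cr)
  have max: "maximalideal M (subring_rec B) \<longleftrightarrow> M = nonunits B" for M by (rule local_nonunits_maximal[OF lB(1)])
  have tn: "t \<in> nonunits B" unfolding t(2) by (rule mem_principal[OF s])
  have pB: "prime_in B (nonunits B)" by (rule local_prime[OF lB(1)])
  have le: "q \<subseteq> nonunits B" if q: "prime_in B q" for q
  proof
    fix x assume x: "x \<in> q"
    have "inverse x * x \<in> q" if "inverse x \<in> B" using ideal_inD(4)[OF prime_in_ideal[OF q] that x] .
    then have "inverse x \<notin> B" if "x \<noteq> 0" using q that by (auto simp: prime_in_def)
    then show "x \<in> nonunits B" using ideal_inD(1)[OF prime_in_ideal[OF q] x] by (auto simp: nonunits_def)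
  qed
  have pr: "q = {0} \<or> q = nonunits B" if q: "prime_in B q" for q
  proof (cases "t = 0 \<or> q \<subseteq> {0}")
    case True then show ?thesis using le[OF q] t(2) ideal_inD(2)[OF prime_in_ideal[OF q]] by auto
  next
    case False
    then obtain b where b: "b \<in> q" "b \<noteq> 0" by auto
    have "b \<in> B" using b ideal_inD(1)[OF prime_in_ideal[OF q]] by auto
    then obtain n u where "b * u = t ^ n" "u \<in> B" using principal_decomposition[OF B t(1) _ t(2), of b] False b by metis
    then have "t ^ n \<in> q" using ideal_inD(5)[OF prime_in_ideal[OF q], of u b] b by auto
    then have "t \<in> q" using prime_in_power[OF s q t(1)] by auto
    then show ?thesis using le[OF q] t(2) ideal_inD(5)[OF prime_in_ideal[OF q]] by auto
  qed
  have "noetherian_ring (subring_rec B)"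
  proof (rule noetherian_ringI)
    fix I assume "ideal I (subring_rec B)"
    then have I: "ideal_in B I" by (simp add: ideal_iff[OF s])
    show "\<exists>G\<subseteq>carrier (subring_rec B). finite G \<and> I = Idl\<^bsub>subring_rec B\<^esub> G"
    proof (cases "I \<subseteq> {0}")
      case True
      then have "I = {0}" using ideal_inD(2)[OF I] by auto
      then show ?thesis using genideal_empty[OF s] by (intro exI[of _ "{}"]) auto
    next
      case False
      then obtain b where b: "b \<in> I" "b \<noteq> 0" by auto
      have bB: "b \<in> B" using b ideal_inD(1)[OF I] by auto
      show ?thesis
      proof (cases "t = 0")
        case True
        then have "inverse b \<in> B" using local_unit[OF bB] t(2) b by auto
        then have "1 \<in> I" using ideal_inD(4)[OF I _ b(1), of "inverse b"] b by auto
        then have "I = B" by (rule ideal_in_one[OF I])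
        moreover have "Idl\<^bsub>subring_rec B\<^esub> {1} = (*) 1 ` B" by (rule genideal_singleton[OF s subr_one[OF s]])
        ultimately show ?thesis using subr_one[OF s] by (intro exI[of _ "{1}"]) auto
      next
        case t0: False
        have "\<exists>n. t ^ n \<in> I"
          using principal_decomposition[OF B t(1) t0 t(2) bB b(2)] ideal_inD(5)[OF I _ b(1)] by metis
        define n where "n = (LEAST n. t ^ n \<in> I)"
        have n: "t ^ n \<in> I" unfolding n_def by (rule LeastI_ex) fact
        have "I = (*) (t ^ n) ` B"
        proof
          show "(*) (t ^ n) ` B \<subseteq> I" using ideal_inD(5)[OF I _ n] by auto
          show "I \<subseteq> (*) (t ^ n) ` B"
          proof
            fix x assume x: "x \<in> I"
            have xB: "x \<in> B" using x ideal_inD(1)[OF I] by auto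
            show "x \<in> (*) (t ^ n) ` B"
            proof (cases "x = 0")
              case True then show ?thesis using subr_zero[OF s] by force
            next
              case False
              obtain m u where mu: "x * u = t ^ m" "u \<in> B" "inverse u \<in> B" "u \<noteq> 0"
                using principal_decomposition[OF B t(1) t0 t(2) xB False] by metis
              have "t ^ m \<in> I" using ideal_inD(5)[OF I mu(2) x] mu(1) by simp
              then have "n \<le> m" unfolding n_def by (rule Least_le)
              then have "t ^ m = t ^ n * t ^ (m - n)" by (simp flip: power_add)
              then have "x = t ^ n * (t ^ (m - n) * inverse u)" using mu by (simp add: field_simps)
              moreover have "t ^ (m - n) * inverse u \<in> B" by (intro subr_mult subr_power s t mu)
              ultimately show ?thesis by blast
            qed
          qed
        qed
        then show ?thesis using genideal_singleton[OF s subr_power[OF s t(1)], of n] subr_power[OF s t(1)]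
          by (intro exI[of _ "{t ^ n}"]) auto
      qed
    qed
  qed
  moreover have "\<exists>S\<subseteq>carrier (subring_rec B). finite S \<and> maximalideal (Idl\<^bsub>subring_rec B\<^esub> S) (subring_rec B) \<and> enat (card S) = krull_dim (subring_rec B)"
  proof (cases "t = 0")
    case True
    have "krull_dim (subring_rec B) \<le> enat 0"
    proof (rule krull_dim_le[OF s])
      fix q :: "nat \<Rightarrow> 'a set"
      assume "\<And>i. i \<le> Suc 0 \<Longrightarrow> prime_in B (q i)" "\<And>i. i \<le> 0 \<Longrightarrow> q i \<subset> q (Suc i)"
      then have "prime_in B (q 0)" "prime_in B (q (Suc 0))" "q 0 \<subset> q (Suc 0)" by auto
      then show False using pr[of "q 0"] pr[of "q (Suc 0)"] t(2) True subr_zero[OF s] by auto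
    qed
    then have "krull_dim (subring_rec B) = 0" by (simp flip: zero_enat_def)
    moreover have "nonunits B = {0}" using t(2) True subr_zero[OF s] by auto
    then have "Idl\<^bsub>subring_rec B\<^esub> {} = nonunits B" using genideal_empty[OF s] by simp
    ultimately show ?thesis using max by (intro exI[of _ "{}"]) (auto simp: zero_enat_def)
  next
    case False
    have ne: "{0} \<subset> nonunits B" using ideal_inD(2)[OF prime_in_ideal[OF pB]] tn False by auto
    have "krull_dim (subring_rec B) = enat 1"
    proof (rule antisym)
      show "krull_dim (subring_rec B) \<le> enat 1"
      proof (rule krull_dim_le[OF s])
        fix q :: "nat \<Rightarrow> 'a set"
        assume "\<And>i. i \<le> Suc 1 \<Longrightarrow> prime_in B (q i)" "\<And>i. i \<le> 1 \<Longrightarrow> q i \<subset> q (Suc i)"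
        then have "prime_in B (q 0)" "prime_in B (q 1)" "prime_in B (q (Suc 1))" "q 0 \<subset> q 1" "q 1 \<subset> q (Suc 1)"
          by (metis One_nat_def le_SucI order_refl zero_le)+
        then show False using pr[of "q 0"] pr[of "q 1"] pr[of "q (Suc 1)"] ne by auto
      qed
      have "\<exists>\<pp>. (\<forall>i\<le>1. primeideal (\<pp> i) (subring_rec B)) \<and> (\<forall>i<(1::nat). \<pp> i \<subset> \<pp> (Suc i))"
        using zero_prime[OF s] pB ne
        by (intro exI[of _ "\<lambda>i. if i = 0 then {0} else nonunits B"]) (auto simp: primeideal_iff[OF s])
      then have "enat 1 \<in> {enat n |n. \<exists>\<pp>. (\<forall>i\<le>n. primeideal (\<pp> i) (subring_rec B)) \<and> (\<forall>i<n. \<pp> i \<subset> \<pp> (Suc i))}" by blast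
      then show "enat 1 \<le> krull_dim (subring_rec B)" unfolding krull_dim_def by (rule Sup_upper)
    qed
    moreover have "Idl\<^bsub>subring_rec B\<^esub> {t} = nonunits B" using genideal_singleton[OF s t(1)] t(2) by simp
    ultimately show ?thesis using max t(1) by (intro exI[of _ "{t}"]) auto
  qed
  moreover have "\<exists>!M. maximalideal M (subring_rec B)" using max by simp
  ultimately show ?thesis using cr unfolding regular_local_ring_def by blast
qed

section \<open>Finiteness of the normalization\<close>

text \<open>The assumption \<open>gen\<close> says that \<open>A\<close> is a localization of \<open>Kbar[as]\<close>.\<close>

locale normalization_setting =
  fixes p :: nat and Kbar A B L :: "'l::field set" and as :: "'l list"
  assumes p: "prime p" "CHAR('l) = p"
    and Kbar: "subf Kbar" "\<And>x. x \<in> Kbar \<Longrightarrow> \<exists>y\<in>Kbar. y ^ p = x" "Kbar \<subseteq> A"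
    and A: "local_in A" and B: "arch_val B L" and rad: "radicial p A B"
    and frac: "\<And>q. q \<in> L \<Longrightarrow> \<exists>e\<in>A. e \<noteq> 0 \<and> e * q \<in> A"
    and res: "\<And>b. b \<in> B \<Longrightarrow> \<exists>\<alpha>\<in>Kbar. b - \<alpha> \<in> nonunits B"
    and as: "set as \<subseteq> A"
    and gen: "\<And>T. subr T \<Longrightarrow> Kbar \<subseteq> T \<Longrightarrow> set as \<subseteq> T \<Longrightarrow>
       (\<And>x. x \<in> T \<Longrightarrow> x \<in> A \<Longrightarrow> x \<noteq> 0 \<Longrightarrow> inverse x \<in> A \<Longrightarrow> inverse x \<in> T) \<Longrightarrow> A \<subseteq> T"
begin

lemma A_subr: "subr A" using A by (simp add: local_in_def)
lemma A_le_B: "A \<subseteq> B" using rad by (simp add: radicial_def)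
lemma B_local: "local_in B" "B \<subseteq> L" "subf L" using B by (auto simp: arch_val_def)
lemma B_subr: "subr B" and B_nonunits: "ideal_in B (nonunits B)" using B_local by (auto simp: local_in_def)
lemma Kbar_subr: "subr Kbar" by (rule subf_subr[OF Kbar(1)])

text \<open>The constants are p-th powers because \<open>Kbar\<close> is perfect, and each generator
  has its p-th power in the base. Localization adds nothing, since \<open>inverse x\<close> equals
  \<open>x ^ (p - 1)\<close> times the p-th power of \<open>inverse x\<close>.\<close>

lemma finite_over_frobenius: "\<exists>ms. A \<subseteq> lspan (frob_image p A) {0} ms"
proof -
  let ?E = "frob_image p A"
  have E: "subr ?E" "?E \<subseteq> A" using frob_image_subr[OF p A_subr] by auto
  have z: "submod T {0}" for T :: "'l set" by (simp add: submod_def)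
  have pw: "\<exists>N>0. a ^ N \<in> lspan ?E {0} (map ((^) a) [0..<N])" if a: "a \<in> set as" for a
  proof (intro exI conjI)
    show p0: "p > 0" using p by (simp add: prime_gt_0_nat)
    have "1 \<in> lspan ?E {0} (map ((^) a) [0..<p])" by (rule lspan_mem[OF E(1) z]) (use p0 in force)
    moreover have "a ^ p \<in> ?E" using a as by (auto simp: frob_image_def)
    ultimately have "a ^ p * 1 \<in> lspan ?E {0} (map ((^) a) [0..<p])" using submodD(3)[OF lspan_submod[OF E(1) z]] by blast
    then show "a ^ p \<in> lspan ?E {0} (map ((^) a) [0..<p])" by simp
  qed
  obtain ms where ms: "1 \<in> set ms" "set ms \<subseteq> A" "\<And>a z. a \<in> set as \<Longrightarrow> z \<in> lspan ?E {0} ms \<Longrightarrow> a * z \<in> lspan ?E {0} ms"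
    using finite_monomial_span[OF A_subr E z as pw] by metis
  let ?W = "lspan ?E {0} ms"
  note sW = lspan_submod[OF E(1) z, of ms]
  define T where "T = {r \<in> A. \<forall>z\<in>?W. r * z \<in> ?W}"
  have T: "subr T" unfolding T_def by (rule multiplier_subr[OF A_subr E(1) sW])
  have ET: "?E \<subseteq> T" using submodD(3)[OF sW] E(2) by (auto simp: T_def)
  have "A \<subseteq> T"
  proof (rule gen[OF T])
    show "Kbar \<subseteq> T"
    proof
      fix k assume "k \<in> Kbar"
      then obtain y where y: "y \<in> Kbar" "y ^ p = k" using Kbar(2) by auto
      then have "k \<in> ?E" using Kbar(3) by (auto simp: frob_image_def)
      then show "k \<in> T" using ET by auto
    qed
    show "set as \<subseteq> T" using as ms(3) by (auto simp: T_def)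
    fix x assume x: "x \<in> T" "x \<in> A" "x \<noteq> 0" "inverse x \<in> A"
    obtain q where q: "p = Suc q" using prime_gt_0_nat[OF p(1)] by (cases p) auto
    have "inverse x = x ^ q * inverse x ^ p" using x(3) by (simp add: q power_inverse field_simps)
    moreover have "inverse x ^ p \<in> T" using ET x(4) by (auto simp: frob_image_def)
    ultimately show "inverse x \<in> T" using subr_mult[OF T subr_power[OF T x(1)]] by metis
  qed
  moreover have "1 \<in> ?W" by (rule lspan_mem[OF E(1) z ms(1)])
  ultimately have "A \<subseteq> ?W" by (force simp: T_def)
  then show ?thesis by blast
qed

lemma conductor: "\<exists>c\<in>A. c \<noteq> 0 \<and> (\<forall>b\<in>B. c * b \<in> A)"
proof -
  obtain ms where ms: "A \<subseteq> lspan (frob_image p A) {0} ms" using finite_over_frobenius by auto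
  have "A \<subseteq> L" using A_le_B B_local by auto
  from frobenius_conductor[OF p A_subr B_local(3) this frac ms] show ?thesis
    using rad B_local(2) unfolding radicial_def by blast
qed

lemma nonunits_power:
  assumes "\<mu> \<in> nonunits B" "b \<in> L" "b \<noteq> 0"
  shows "\<exists>N>0. \<mu> ^ N \<in> (*) b ` B"
proof -
  obtain k where k: "\<mu> ^ k / b \<in> B" using B assms unfolding arch_val_def by blast
  have "\<mu> ^ Suc k = b * (\<mu> * (\<mu> ^ k / b))" using assms(3) by simp
  moreover have "\<mu> * (\<mu> ^ k / b) \<in> B" using subr_mult[OF B_subr nonunitsD(1)[OF assms(1)] k] .
  ultimately show ?thesis by (intro exI[of _ "Suc k"]) (metis image_eqI zero_less_Suc)
qed

text \<open>Subtracting residues turns the generators into nonunits of \<open>B\<close>, and some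
  power of each falls into the ideal \<open>d B\<close>. Finitely many monomials then span, and
  stability under inverses extends this to the localization \<open>A\<close>.\<close>

lemma finite_modulo:
  assumes d: "d \<noteq> 0" "\<And>b. b \<in> B \<Longrightarrow> d * b \<in> A"
  shows "\<exists>ms. A \<subseteq> lspan Kbar ((*) d ` B) ms"
proof -
  let ?I = "(*) d ` B"
  have dA: "d \<in> A" using d(2)[OF subr_one[OF B_subr]] by simp
  have dL: "d \<in> L" using dA A_le_B B_local by auto
  have IA: "?I \<subseteq> A" using d(2) by auto
  have dB: "d \<in> B" using dA A_le_B by auto
  have subI: "submod A ?I"
    by (rule submod_mono[OF ideal_in_submod[OF principal_ideal_in[OF B_subr dB]] A_le_B])
  have subK: "submod Kbar ?I" by (rule submod_mono[OF subI Kbar(3)])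
  obtain al where al: "\<And>a. a \<in> set as \<Longrightarrow> al a \<in> Kbar \<and> a - al a \<in> nonunits B"
    using res as A_le_B by (metis subsetD)
  define ys where "ys = map (\<lambda>a. a - al a) as"
  have ysA: "set ys \<subseteq> A" using al as Kbar(3) subr_diff[OF A_subr] by (auto simp: ys_def subset_iff)
  have ysN: "y \<in> nonunits B" if "y \<in> set ys" for y using that al by (auto simp: ys_def)
  have pw: "\<exists>N>0. y ^ N \<in> lspan Kbar ?I (map ((^) y) [0..<N])" if y: "y \<in> set ys" for y
    using nonunits_power[OF ysN[OF y] dL d(1)] lspan_base[OF Kbar_subr] by (meson subsetD)
  obtain ms where ms: "1 \<in> set ms" "set ms \<subseteq> A" "\<And>a z. a \<in> set ys \<Longrightarrow> z \<in> lspan Kbar ?I ms \<Longrightarrow> a * z \<in> lspan Kbar ?I ms"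
    using finite_monomial_span[OF A_subr Kbar_subr Kbar(3) subI ysA pw] by metis
  let ?W = "lspan Kbar ?I ms"
  note sW = lspan_submod[OF Kbar_subr subK, of ms]
  have IW: "?I \<subseteq> ?W" by (rule lspan_base[OF Kbar_subr])
  have WA: "?W \<subseteq> A" by (rule lspan_least) (use IA ms(2) A_subr Kbar(3) in \<open>auto simp: submod_def intro: subr_intros\<close>)
  define T where "T = {r \<in> A. \<forall>z\<in>?W. r * z \<in> ?W}"
  have T: "subr T" unfolding T_def by (rule multiplier_subr[OF A_subr Kbar_subr sW])
  have KT: "Kbar \<subseteq> T" using submodD(3)[OF sW] Kbar(3) by (auto simp: T_def)
  have IT: "?I \<subseteq> T"
  proof
    fix x assume x: "x \<in> ?I"
    have "x * z \<in> ?W" if "z \<in> ?W" for z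
      using submodD(3)[OF subI _ x, of z] WA IW that by (auto simp: mult.commute)
    then show "x \<in> T" using x IA by (auto simp: T_def)
  qed
  have "A \<subseteq> T"
  proof (rule gen[OF T KT])
    show "set as \<subseteq> T"
    proof
      fix a assume a: "a \<in> set as"
      have "a - al a \<in> T" using a ms(3) ysA by (auto simp: T_def ys_def)
      moreover have "al a \<in> T" using al[OF a] KT by auto
      ultimately have "(a - al a) + al a \<in> T" by (rule subr_add[OF T])
      then show "a \<in> T" by simp
    qed
    fix x assume x: "x \<in> T" "x \<in> A" "x \<noteq> 0" "inverse x \<in> A"
    obtain \<xi> where xi: "\<xi> \<in> Kbar" "x - \<xi> \<in> nonunits B" using res x(2) A_le_B by blast
    have xi0: "\<xi> \<noteq> 0" using xi nonunitsD(2)[of x B] x A_le_B by auto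
    \<comment> \<open>Finite geometric series: \<open>x\<close> is the constant \<open>\<xi>\<close>
      minus a nonunit with a power in \<open>d B\<close>, so up to that ideal the inverse of
      \<open>x\<close> is a polynomial in \<open>\<mu>\<close>.\<close>
    define \<mu> where "\<mu> = \<xi> - x"
    have mu: "\<mu> \<in> nonunits B" using ideal_in_uminus[OF B_subr B_nonunits xi(2)] by (simp add: \<mu>_def)
    have muT: "\<mu> \<in> T" unfolding \<mu>_def using xi KT x by (intro subr_diff[OF T]) auto
    obtain N where N: "\<mu> ^ N \<in> ?I" using nonunits_power[OF mu dL d(1)] by auto
    define s where "s = (\<Sum>i<N. \<mu> ^ (N - Suc i) * \<xi> ^ i)"
    have sT: "s \<in> T" unfolding s_def using xi KT muT by (intro subr_sum[OF T] subr_mult[OF T] subr_power[OF T]) auto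
    have "\<xi> ^ N - \<mu> ^ N = x * s" unfolding s_def power_diff_sumr2 by (simp add: \<mu>_def)
    then have "\<xi> ^ N * inverse x = s + inverse x * \<mu> ^ N" using x(3) by (simp add: field_simps)
    then have "inverse x = inverse \<xi> ^ N * (s + inverse x * \<mu> ^ N)"
      using xi0 by (simp add: power_inverse flip: mult.assoc) (metis mult.assoc mult.commute mult_1 power_not_zero right_inverse)
    moreover have "inverse x * \<mu> ^ N \<in> T" using submodD(3)[OF subI x(4) N] IT by auto
    moreover have "inverse \<xi> ^ N \<in> T" using subf_inverse[OF Kbar(1) xi(1)] KT by (intro subr_power[OF T]) auto
    ultimately show "inverse x \<in> T" using subr_mult[OF T] subr_add[OF T sT] by metis
  qed
  moreover have "1 \<in> ?W" by (rule lspan_mem[OF Kbar_subr subK ms(1)])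
  ultimately have "A \<subseteq> ?W" by (force simp: T_def)
  then show ?thesis by blast
qed

text \<open>If the maximal ideal of \<open>B\<close> were not principal, there would be elements \<open>\<beta>\<^sub>0, \<beta>\<^sub>1, \<dots>\<close> of strictly
  decreasing valuation; their multiples by the conductor would be linearly independent in a
  finite-dimensional quotient of \<open>A\<close>.\<close>

lemma nonunits_principal: "\<exists>t\<in>B. nonunits B = (*) t ` B"
proof (rule ccontr)
  assume not: "\<not> ?thesis"
  have zn: "0 \<in> nonunits B" by (rule ideal_inD(2)[OF B_nonunits])
  have "nonunits B \<noteq> (*) 0 ` B" using not subr_zero[OF B_subr] by auto
  then obtain b0 where b0: "b0 \<in> nonunits B" "b0 \<noteq> 0" using zn subr_zero[OF B_subr] by auto
  have step: "\<exists>b'. (b' \<in> nonunits B \<and> b' \<noteq> 0) \<and> b / b' \<in> nonunits B" if b: "b \<in> nonunits B \<and> b \<noteq> 0" for b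
  proof -
    have "(*) b ` B \<subseteq> nonunits B" using ideal_inD(5)[OF B_nonunits] b by auto
    then obtain b' where b': "b' \<in> nonunits B" "b' \<notin> (*) b ` B" using not nonunitsD(1) b by blast
    have nd: "b' / b \<notin> B"
    proof
      assume "b' / b \<in> B"
      moreover have "b' = b * (b' / b)" using b by simp
      ultimately show False using b' by (metis image_eqI)
    qed
    have "b' / b \<in> L" using b b' nonunitsD(1) B_local by (intro subf_divide) auto
    then have "inverse (b' / b) \<in> nonunits B" using B nd unfolding arch_val_def by blast
    moreover have "b' \<noteq> 0" using nd subr_zero[OF B_subr] by auto
    ultimately show ?thesis using b' by (auto simp: inverse_divide)
  qed
  obtain \<beta> where \<beta>0: "\<beta> 0 = b0" and \<beta>: "\<And>n. \<beta> n \<in> nonunits B \<and> \<beta> n \<noteq> 0" "\<And>n. \<beta> n / \<beta> (Suc n) \<in> nonunits B"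
  proof -
    \<comment> \<open>The clause for \<open>n = 0\<close> pins the first member of the sequence to
      \<open>b0\<close>, from which the modulus \<open>d\<close> is built.\<close>
    have "\<exists>f. \<forall>n. ((f n \<in> nonunits B \<and> f n \<noteq> 0) \<and> (n = 0 \<longrightarrow> f n = b0)) \<and> f n / f (Suc n) \<in> nonunits B"
    proof (rule dependent_nat_choice)
      show "\<exists>x. (x \<in> nonunits B \<and> x \<noteq> 0) \<and> ((0::nat) = 0 \<longrightarrow> x = b0)" using b0 by auto
      show "\<exists>y. ((y \<in> nonunits B \<and> y \<noteq> 0) \<and> (Suc n = 0 \<longrightarrow> y = b0)) \<and> x / y \<in> nonunits B"
        if "(x \<in> nonunits B \<and> x \<noteq> 0) \<and> (n = 0 \<longrightarrow> x = b0)" for x and n :: nat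
        using step[of x] that by auto
    qed
    then show thesis using that by blast
  qed
  have ratio: "\<beta> i / \<beta> j \<in> B" if "i \<le> j" for i j
    using that
  proof (induction rule: dec_induct)
    case base then show ?case using \<beta>(1) subr_one[OF B_subr] by simp
  next
    case (step n)
    have "\<beta> i / \<beta> (Suc n) = (\<beta> i / \<beta> n) * (\<beta> n / \<beta> (Suc n))" using \<beta>(1)[of n] by simp
    then show ?case using subr_mult[OF B_subr step(3) nonunitsD(1)[OF \<beta>(2)[of n]]] by (simp only:)
  qed
  obtain c where c: "c \<in> A" "c \<noteq> 0" "\<And>b. b \<in> B \<Longrightarrow> c * b \<in> A" using conductor by auto
  \<comment> \<open>The modulus is the conductor multiple of \<beta>0, so the later multiples
    \<open>c * \<beta> i\<close> have strictly smaller valuation than \<open>d\<close>.\<close>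
  define d where "d = c * b0"
  have d: "d \<noteq> 0" "\<And>b. b \<in> B \<Longrightarrow> d * b \<in> A"
    using c b0 subr_mult[OF B_subr nonunitsD(1)[OF b0(1)]] by (auto simp: d_def mult.assoc)
  obtain ms where ms: "A \<subseteq> lspan Kbar ((*) d ` B) ms" using finite_modulo[OF d] by blast
  \<comment> \<open>The index \<open>0\<close> is left out because \<open>c * \<beta> 0\<close> is
    \<open>d\<close> itself. There is one more index than spanning elements.\<close>
  let ?N = "{1..Suc (length ms)}"
  have dB: "d \<in> B" using d(2)[OF subr_one[OF B_subr]] A_le_B by auto
  have "Kbar \<subseteq> B" using Kbar(3) A_le_B by auto
  then have subK: "submod Kbar ((*) d ` B)"
    by (rule submod_mono[OF ideal_in_submod[OF principal_ideal_in[OF B_subr dB]]])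
  have mem: "c * \<beta> i \<in> lspan Kbar ((*) d ` B) ms" for i using c(3) \<beta>(1)[of i] nonunitsD(1) ms by blast
  have "\<exists>e. (\<forall>i\<in>?N. e i \<in> Kbar) \<and> (\<exists>i\<in>?N. e i \<noteq> 0) \<and> (\<Sum>i\<in>?N. e i * (c * \<beta> i)) \<in> (*) d ` B"
    by (rule linear_dependence[OF Kbar(1) subK _ _ mem]) auto
  then obtain e where e: "\<And>i. i \<in> ?N \<Longrightarrow> e i \<in> Kbar" "\<exists>i\<in>?N. e i \<noteq> 0" "(\<Sum>i\<in>?N. e i * (c * \<beta> i)) \<in> (*) d ` B" by blast
  define J where "J = {i \<in> ?N. e i \<noteq> 0}"
  have J: "finite J" "J \<noteq> {}" using e(2) by (auto simp: J_def)
  \<comment> \<open>The term with the largest index has the strictly smallest valuation. After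
    division by its predecessor \<open>\<beta> l\<close> every other term lies in \<open>B\<close>,
    so the last one would too, contrary to the choice of the sequence.\<close>
  define m where "m = Max J"
  have mJ: "m \<in> J" "\<And>i. i \<in> J \<Longrightarrow> i \<le> m" unfolding m_def using J by auto
  have mN: "m \<in> ?N" "e m \<noteq> 0" using mJ by (auto simp: J_def)
  obtain l where l: "m = Suc l" using mN(1) by (cases m) auto
  obtain b where b: "(\<Sum>i\<in>?N. e i * (c * \<beta> i)) = d * b" "b \<in> B" using e(3) by auto
  have "(\<Sum>i\<in>?N. e i * (c * \<beta> i)) = (\<Sum>i\<in>J. e i * (c * \<beta> i))" by (rule sum.mono_neutral_right) (auto simp: J_def)
  also have "\<dots> = c * (\<Sum>i\<in>J. e i * \<beta> i)" by (simp add: sum_distrib_left mult_ac)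
  finally have "c * (\<Sum>i\<in>J. e i * \<beta> i) = c * (b0 * b)" using b(1) by (simp add: d_def mult.assoc)
  then have "(\<Sum>i\<in>J. e i * \<beta> i) = b0 * b" using c(2) by simp
  moreover have "(\<Sum>i\<in>J. e i * \<beta> i) = e m * \<beta> m + (\<Sum>i\<in>J-{m}. e i * \<beta> i)" using J mJ(1) by (simp add: sum.remove)
  ultimately have "e m * \<beta> m = b0 * b - (\<Sum>i\<in>J-{m}. e i * \<beta> i)" by (simp add: algebra_simps)
  then have "e m * \<beta> m / \<beta> l = (\<beta> 0 / \<beta> l) * b - (\<Sum>i\<in>J-{m}. e i * (\<beta> i / \<beta> l))"
    by (simp add: \<beta>0 diff_divide_distrib sum_divide_distrib)
  also have "\<dots> \<in> B"
  proof (intro subr_diff[OF B_subr] subr_mult[OF B_subr] subr_sum[OF B_subr] ratio b)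
    fix i assume i: "i \<in> J - {m}"
    then have "i \<le> m" "i \<noteq> m" using mJ(2) by auto
    then show "i \<le> l" using l by simp
    show "e i \<in> B" using i e(1) \<open>Kbar \<subseteq> B\<close> by (auto simp: J_def)
  qed simp
  finally have *: "e m * \<beta> m / \<beta> l \<in> B" .
  have "inverse (e m) \<in> B" using subf_inverse[OF Kbar(1) e(1)[OF mN(1)]] \<open>Kbar \<subseteq> B\<close> by auto
  from subr_mult[OF B_subr this *] have "inverse (e m) * (e m * \<beta> m / \<beta> l) \<in> B" .
  also have "inverse (e m) * (e m * \<beta> m / \<beta> l) = \<beta> m / \<beta> l" using mN(2) by (simp add: field_simps)
  finally have "\<beta> m / \<beta> l \<in> B" .
  then have "inverse (\<beta> l / \<beta> (Suc l)) \<in> B" using l by simp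
  moreover have "\<beta> l / \<beta> (Suc l) \<noteq> 0" using \<beta>(1)[of l] \<beta>(1)[of "Suc l"] by simp
  ultimately show False using nonunitsD(2)[OF \<beta>(2)[of l]] by blast
qed

lemma eq_of_uniformizer:
  assumes x: "x \<in> A" "nonunits B = (*) x ` B"
  shows "A = B"
proof
  show "A \<subseteq> B" by (rule A_le_B)
  obtain c where c: "c \<in> A" "c \<noteq> 0" "\<And>b. b \<in> B \<Longrightarrow> c * b \<in> A" using conductor by auto
  have xn: "x \<in> nonunits B" unfolding x(2) by (rule mem_principal[OF B_subr])
  have ap: "\<exists>a\<in>A. b - a \<in> (*) (x ^ n) ` B" if b: "b \<in> B" for b n
  proof (induction n)
    case 0 then show ?case using b subr_zero[OF A_subr] by (intro bexI[of _ 0]) auto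
  next
    case (Suc n)
    then obtain a y where a: "a \<in> A" "b - a = x ^ n * y" "y \<in> B" by auto
    obtain \<alpha> where al: "\<alpha> \<in> Kbar" "y - \<alpha> \<in> nonunits B" using res[OF a(3)] by auto
    then obtain z where z: "y - \<alpha> = x * z" "z \<in> B" using x(2) by auto
    have "b - (a + x ^ n * \<alpha>) = x ^ n * (y - \<alpha>)" using a(2) by (simp add: algebra_simps)
    also have "\<dots> = x ^ Suc n * z" unfolding z(1) by (simp add: mult_ac)
    finally have "b - (a + x ^ n * \<alpha>) \<in> (*) (x ^ Suc n) ` B" using z(2) by blast
    moreover have "a + x ^ n * \<alpha> \<in> A" using a al Kbar(3) by (intro subr_intros A_subr x) auto
    ultimately show ?case by blast
  qed
  have cL: "c \<in> L" using c(1) A_le_B B_local by auto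
  obtain N where N: "x ^ N \<in> (*) c ` B" using nonunits_power[OF xn cL c(2)] by auto
  then obtain w where w: "x ^ N = c * w" "w \<in> B" by auto
  show "B \<subseteq> A"
  proof
    fix b assume b: "b \<in> B"
    obtain a y where a: "a \<in> A" "b - a = x ^ N * y" "y \<in> B" using ap[OF b, of N] by auto
    have "x ^ N * y \<in> A" using c(3)[OF subr_mult[OF B_subr w(2) a(3)]] by (simp add: w(1) mult.assoc)
    from subr_add[OF A_subr a(1) this] show "b \<in> A" by (simp add: a(2)[symmetric])
  qed
qed

lemma regular_of_field:
  assumes "nonunits B = {0}" shows "regular_local_ring (subring_rec A)"
proof -
  have n: "nonunits A = {0}"
  proof -
    have "nonunits B \<inter> A = nonunits A"
      using radicial_prime(2)[OF p A_subr B_subr rad local_prime[OF A]] radicial_local(1)[OF p A B_subr rad] by simp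
    then show ?thesis using assms subr_zero[OF A_subr] by auto
  qed
  have "subf A" unfolding subf_def
  proof (intro conjI ballI)
    fix x assume "x \<in> A" then show "inverse x \<in> A" using local_unit[of x A] n by (cases "x = 0") auto
  qed (rule A_subr)
  from regular_of_principal[OF arch_val_field[OF this] subr_zero[OF A_subr]] show ?thesis
    using n subr_zero[OF A_subr] by force
qed

lemma regular_of_uniformizer:
  assumes "x \<in> A" "nonunits B = (*) x ` B"
  shows "regular_local_ring (subring_rec A)"
  using eq_of_uniformizer[OF assms] regular_of_principal[OF B] assms by auto

end

section \<open>Functionals on quotient modules and Kaehler differentials\<close>

text \<open>The part of the module axioms that is needed to handle iterated quotients.\<close>

definition premod :: "'l::field set \<Rightarrow> ('l, 'm) module \<Rightarrow> bool" where
  "premod B M \<longleftrightarrow> abelian_group M \<and> (\<forall>a\<in>B. \<forall>x\<in>carrier M. a \<odot>\<^bsub>M\<^esub> x \<in> carrier M) \<and>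
     (\<forall>a\<in>B. \<forall>x\<in>carrier M. \<forall>y\<in>carrier M. a \<odot>\<^bsub>M\<^esub> (x \<oplus>\<^bsub>M\<^esub> y) = a \<odot>\<^bsub>M\<^esub> x \<oplus>\<^bsub>M\<^esub> a \<odot>\<^bsub>M\<^esub> y)"

text \<open>Semilinear along \<rho>: the target is the field with scalars acting through the residue
  map, which is how \<open>Kbar\<close> becomes a module over \<open>B\<close>.\<close>

definition functional :: "'l::field set \<Rightarrow> ('l \<Rightarrow> 'l) \<Rightarrow> ('l, 'm) module \<Rightarrow> ('m \<Rightarrow> 'l) \<Rightarrow> bool" where
  "functional B \<rho> M \<phi> \<longleftrightarrow> (\<forall>x\<in>carrier M. \<forall>y\<in>carrier M. \<phi> (x \<oplus>\<^bsub>M\<^esub> y) = \<phi> x + \<phi> y) \<and>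
     (\<forall>a\<in>B. \<forall>x\<in>carrier M. \<phi> (a \<odot>\<^bsub>M\<^esub> x) = \<rho> a * \<phi> x)"

lemma functional_zero:
  assumes "premod B M" "functional B \<rho> M \<phi>" shows "\<phi> \<zero>\<^bsub>M\<^esub> = 0"
proof -
  interpret abelian_group M using assms by (simp add: premod_def)
  have "\<phi> (\<zero>\<^bsub>M\<^esub> \<oplus>\<^bsub>M\<^esub> \<zero>\<^bsub>M\<^esub>) = \<phi> \<zero>\<^bsub>M\<^esub> + \<phi> \<zero>\<^bsub>M\<^esub>" using assms(2) zero_closed unfolding functional_def by blast
  then have "\<phi> \<zero>\<^bsub>M\<^esub> = \<phi> \<zero>\<^bsub>M\<^esub> + \<phi> \<zero>\<^bsub>M\<^esub>" by (simp only: l_zero zero_closed)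
  then show ?thesis by (simp only: add_cancel_right_right)
qed

lemma kernel_submodule:
  assumes M: "premod B M" and f: "functional B \<rho> M \<phi>"
  shows "submodule {x \<in> carrier M. \<phi> x = 0} (subring_rec B) M"
proof -
  interpret abelian_group M using M by (simp add: premod_def)
  note z = functional_zero[OF M f]
  have neg: "\<phi> (\<ominus>\<^bsub>M\<^esub> x) = - \<phi> x" if "x \<in> carrier M" for x
  proof -
    have "\<phi> (\<ominus>\<^bsub>M\<^esub> x \<oplus>\<^bsub>M\<^esub> x) = \<phi> (\<ominus>\<^bsub>M\<^esub> x) + \<phi> x" using f that by (auto simp: functional_def)
    then show ?thesis using z that by (simp add: l_neg eq_neg_iff_add_eq_0)
  qed
  have "subgroup {x \<in> carrier M. \<phi> x = 0} (add_monoid M)"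
  proof (rule add.subgroupI)
    show "{x \<in> carrier M. \<phi> x = 0} \<noteq> {}" using z by auto
    show "a \<oplus>\<^bsub>M\<^esub> b \<in> {x \<in> carrier M. \<phi> x = 0}" if "a \<in> {x \<in> carrier M. \<phi> x = 0}" "b \<in> {x \<in> carrier M. \<phi> x = 0}" for a b
      using that f by (auto simp: functional_def)
  qed (use neg in auto)
  then show ?thesis using M f by (auto simp: submodule_def submodule_axioms_def functional_def premod_def)
qed

lemma carrier_submodule: "premod B M \<Longrightarrow> submodule (carrier M) (subring_rec B) M"
  using kernel_submodule[of B M "\<lambda>_. 0" "\<lambda>_. 0"] by (simp add: functional_def)

lemma module_span_submodule:
  assumes M: "premod B M" and G: "G \<subseteq> carrier M"
  shows "submodule (module_span (subring_rec B) M G) (subring_rec B) M"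
proof -
  interpret abelian_group M using M by (simp add: premod_def)
  let ?S = "{N. submodule N (subring_rec B) M \<and> G \<subseteq> N}"
  have "subgroup (\<Inter>?S) (add_monoid M)"
    by (rule add.subgroups_Inter) (use carrier_submodule[OF M] G in \<open>auto simp: submodule_def\<close>)
  then show ?thesis unfolding module_span_def
    by (auto simp: submodule_def submodule_axioms_def)
qed

lemma module_span_least: "submodule N (subring_rec B) M \<Longrightarrow> G \<subseteq> N \<Longrightarrow> module_span (subring_rec B) M G \<subseteq> N"
  by (auto simp: module_span_def)

lemma quot_module_properties:
  assumes M: "premod B M" and N: "submodule N (subring_rec B) M"
  shows "carrier (quot_module M N) = (\<lambda>x. N +>\<^bsub>M\<^esub> x) ` carrier M"
    and "x \<in> carrier M \<Longrightarrow> y \<in> carrier M \<Longrightarrow> (N +>\<^bsub>M\<^esub> x) \<oplus>\<^bsub>quot_module M N\<^esub> (N +>\<^bsub>M\<^esub> y) = N +>\<^bsub>M\<^esub> (x \<oplus>\<^bsub>M\<^esub> y)"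
    and "a \<in> B \<Longrightarrow> x \<in> carrier M \<Longrightarrow> a \<odot>\<^bsub>quot_module M N\<^esub> (N +>\<^bsub>M\<^esub> x) = N +>\<^bsub>M\<^esub> (a \<odot>\<^bsub>M\<^esub> x)"
    and "premod B (quot_module M N)"
    and "x \<in> carrier M \<Longrightarrow> y \<in> N +>\<^bsub>M\<^esub> x \<Longrightarrow> \<exists>n\<in>N. n \<in> carrier M \<and> y = n \<oplus>\<^bsub>M\<^esub> x"
    and "x \<in> carrier M \<Longrightarrow> x \<in> N +>\<^bsub>M\<^esub> x"
proof -
  have ag: "abelian_group M" using M by (simp add: premod_def)
  interpret abelian_group M by (rule ag)
  have "additive_subgroup N M" using N by (simp add: additive_subgroup_def submodule_def)
  then have as: "abelian_subgroup N M" using ag by (rule abelian_subgroupI3)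
  interpret abelian_subgroup N M by (rule as)
  have NM: "N \<subseteq> carrier M" by (rule a_subset)
  show car: "carrier (quot_module M N) = (\<lambda>x. N +>\<^bsub>M\<^esub> x) ` carrier M"
    by (auto simp: quot_module_def A_RCOSETS_def')
  show add: "(N +>\<^bsub>M\<^esub> x) \<oplus>\<^bsub>quot_module M N\<^esub> (N +>\<^bsub>M\<^esub> y) = N +>\<^bsub>M\<^esub> (x \<oplus>\<^bsub>M\<^esub> y)"
    if "x \<in> carrier M" "y \<in> carrier M" for x y
    using a_rcos_sum[OF that] by (simp add: quot_module_def)
  show el: "\<exists>n\<in>N. n \<in> carrier M \<and> y = n \<oplus>\<^bsub>M\<^esub> x" if "x \<in> carrier M" "y \<in> N +>\<^bsub>M\<^esub> x" for x y
    using that NM by (auto simp: a_r_coset_def')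
  show self: "x \<in> N +>\<^bsub>M\<^esub> x" if "x \<in> carrier M" for x using a_rcos_self[OF that] .
  show sm: "a \<odot>\<^bsub>quot_module M N\<^esub> (N +>\<^bsub>M\<^esub> x) = N +>\<^bsub>M\<^esub> (a \<odot>\<^bsub>M\<^esub> x)" if a: "a \<in> B" and x: "x \<in> carrier M" for a x
  proof -
    have "N +>\<^bsub>M\<^esub> (a \<odot>\<^bsub>M\<^esub> y) = N +>\<^bsub>M\<^esub> (a \<odot>\<^bsub>M\<^esub> x)" if y: "y \<in> N +>\<^bsub>M\<^esub> x" for y
    proof -
      obtain n where n: "n \<in> N" "n \<in> carrier M" "y = n \<oplus>\<^bsub>M\<^esub> x" using el[OF x y] by auto
      have an: "a \<odot>\<^bsub>M\<^esub> n \<in> N" using N a n by (auto simp: submodule_def submodule_axioms_def)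
      have ax: "a \<odot>\<^bsub>M\<^esub> x \<in> carrier M" using M a x by (auto simp: premod_def)
      have "a \<odot>\<^bsub>M\<^esub> y = a \<odot>\<^bsub>M\<^esub> n \<oplus>\<^bsub>M\<^esub> a \<odot>\<^bsub>M\<^esub> x" using M a n x by (auto simp: premod_def)
      then have "a \<odot>\<^bsub>M\<^esub> y \<in> N +>\<^bsub>M\<^esub> (a \<odot>\<^bsub>M\<^esub> x)" using an by (auto simp: a_r_coset_def')
      then show ?thesis using a_repr_independence[OF _ ax a_subgroup] by metis
    qed
    then have "(\<Union>y\<in>N +>\<^bsub>M\<^esub> x. N +>\<^bsub>M\<^esub> (a \<odot>\<^bsub>M\<^esub> y)) = (\<Union>y\<in>N +>\<^bsub>M\<^esub> x. N +>\<^bsub>M\<^esub> (a \<odot>\<^bsub>M\<^esub> x))"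
      by (intro SUP_cong refl)
    also have "\<dots> = N +>\<^bsub>M\<^esub> (a \<odot>\<^bsub>M\<^esub> x)"
    proof -
      have "N +>\<^bsub>M\<^esub> x \<noteq> {}" using self[OF x] by blast
      then show ?thesis by (simp only: UN_constant if_False)
    qed
    finally show ?thesis by (simp add: quot_module_def)
  qed
  have zero: "\<zero>\<^bsub>quot_module M N\<^esub> = N +>\<^bsub>M\<^esub> \<zero>\<^bsub>M\<^esub>"
    using a_coset_add_zero[OF NM] by (simp add: quot_module_def)
  have "abelian_group (quot_module M N)"
  proof (rule abelian_groupI)
    show "\<exists>y\<in>carrier (quot_module M N). y \<oplus>\<^bsub>quot_module M N\<^esub> x = \<zero>\<^bsub>quot_module M N\<^esub>"
      if xQ: "x \<in> carrier (quot_module M N)" for x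
    proof -
      obtain v where v: "x = N +>\<^bsub>M\<^esub> v" "v \<in> carrier M" using xQ car by auto
      show ?thesis using v by (intro bexI[of _ "N +>\<^bsub>M\<^esub> (\<ominus>\<^bsub>M\<^esub> v)"]) (auto simp: add zero l_neg car)
    qed
  qed (auto simp: car add zero a_ac)
  then show "premod B (quot_module M N)" unfolding premod_def
    using M by (auto simp: car sm add premod_def)
qed

text \<open>The value on a coset is read off from a chosen representative; the choice does not
  matter because \<phi> vanishes on \<open>N\<close>.\<close>

lemma quot_functional:
  assumes M: "premod B M" and N: "submodule N (subring_rec B) M" and f: "functional B \<rho> M \<phi>"
    and ker: "N \<subseteq> {x \<in> carrier M. \<phi> x = 0}"
  obtains \<psi> where "functional B \<rho> (quot_module M N) \<psi>" "\<And>x. x \<in> carrier M \<Longrightarrow> \<psi> (N +>\<^bsub>M\<^esub> x) = \<phi> x"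
proof -
  note q = quot_module_properties[OF M N]
  define \<psi> where "\<psi> Y = \<phi> (SOME x. x \<in> Y)" for Y
  have v: "\<psi> (N +>\<^bsub>M\<^esub> x) = \<phi> x" if x: "x \<in> carrier M" for x
  proof -
    have "(SOME y. y \<in> N +>\<^bsub>M\<^esub> x) \<in> N +>\<^bsub>M\<^esub> x" using q(6)[OF x] by (rule someI)
    from q(5)[OF x this] obtain n where n: "n \<in> N" "n \<in> carrier M" "(SOME y. y \<in> N +>\<^bsub>M\<^esub> x) = n \<oplus>\<^bsub>M\<^esub> x" by auto
    then show ?thesis using f ker x by (auto simp: \<psi>_def functional_def)
  qed
  have ag: "abelian_group M" using M by (simp add: premod_def)
  have cl: "x \<oplus>\<^bsub>M\<^esub> y \<in> carrier M" if "x \<in> carrier M" "y \<in> carrier M" for x y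
    using abelian_monoid.a_closed[OF abelian_group.axioms(1)[OF ag] that] .
  have "functional B \<rho> (quot_module M N) \<psi>"
    using f M cl by (auto simp: functional_def premod_def q(1) q(2) q(3) v)
  then show thesis using that v by blast
qed

section \<open>The free module behind the differentials and the functionals induced by
  derivations\<close>

lemma lookup_smult: "Poly_Mapping.lookup (Poly_Mapping.map ((*) b) w) x = (b :: 'l::field) * Poly_Mapping.lookup w x"
  by transfer (auto simp: when_def)

lemma free_module_premod:
  assumes B: "subr B" shows "premod B (free_module B)"
proof -
  have ag: "abelian_group (free_module B)"
  proof (rule abelian_groupI)
    show "\<exists>y\<in>carrier (free_module B). y \<oplus>\<^bsub>free_module B\<^esub> x = \<zero>\<^bsub>free_module B\<^esub>" if "x \<in> carrier (free_module B)" for x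
      using that subr_uminus[OF B] by (intro bexI[of _ "- x"]) (auto simp: free_module_def)
    show "x \<oplus>\<^bsub>free_module B\<^esub> y \<in> carrier (free_module B)" if "x \<in> carrier (free_module B)" "y \<in> carrier (free_module B)" for x y
      using that subr_add[OF B] Poly_Mapping.keys_add[of x y] by (auto simp: free_module_def lookup_add)
  qed (auto simp: free_module_def add_ac subr_zero[OF B])
  have "a \<odot>\<^bsub>free_module B\<^esub> x \<in> carrier (free_module B)" if "a \<in> B" "x \<in> carrier (free_module B)" for a x
    using that subr_mult[OF B] by (auto simp: free_module_def lookup_smult in_keys_iff subset_iff)
  moreover have "Poly_Mapping.map ((*) a) (x + y) = Poly_Mapping.map ((*) a) x + Poly_Mapping.map ((*) a) y" for a and x y :: "'a \<Rightarrow>\<^sub>0 'a"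
    by (rule poly_mapping_eqI) (simp add: lookup_smult lookup_add distrib_left)
  ultimately show ?thesis using ag by (auto simp: premod_def free_module_def)
qed

text \<open>A point derivation \<open>\<delta>\<close> of \<open>B\<close> over \<open>k\<close>, with values in \<open>k\<close> viewed as a \<open>B\<close>-module through \<open>\<rho>\<close>,
  factors through the universal derivation.\<close>

lemma kaehler_coker_derivation:
  fixes k A B :: "'l::field set"
  assumes B: "subr B" and k: "k \<subseteq> B" and AB: "A \<subseteq> B"
    and rho: "\<And>x y. x \<in> B \<Longrightarrow> y \<in> B \<Longrightarrow> \<rho> (x + y) = \<rho> x + \<rho> y" "\<And>x y. x \<in> B \<Longrightarrow> y \<in> B \<Longrightarrow> \<rho> (x * y) = \<rho> x * \<rho> y"
      "\<And>x. x \<in> k \<Longrightarrow> \<rho> x = x" "\<rho> 1 = 1"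
    and der: "\<And>x y. x \<in> B \<Longrightarrow> y \<in> B \<Longrightarrow> \<delta> (x + y) = \<delta> x + \<delta> y"
      "\<And>x y. x \<in> B \<Longrightarrow> y \<in> B \<Longrightarrow> \<delta> (x * y) = \<rho> x * \<delta> y + \<rho> y * \<delta> x" "\<And>x. x \<in> k \<Longrightarrow> \<delta> x = 0"
    and A: "\<And>x. x \<in> A \<Longrightarrow> \<delta> x = 0"
    and dim: "vs_dim k (kaehler_coker k A B) = 0" and x: "x \<in> B"
  shows "\<delta> x = 0"
proof (rule ccontr)
  assume nz: "\<delta> x \<noteq> 0"
  have "\<rho> 0 = \<rho> 0 + \<rho> 0" using rho(1)[OF subr_zero[OF B] subr_zero[OF B]] by (simp only: add_0_left)
  then have r0: "\<rho> 0 = 0" by (simp only: add_cancel_right_right)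
  have rm: "\<rho> (- a) = - \<rho> a" if "a \<in> B" for a using rho(1)[of a "- a"] that subr_uminus[OF B] r0 by (simp add: eq_neg_iff_add_eq_0 add.commute)
  \<comment> \<open>The functional that sends the symbol of \<open>x\<close> to
    \<open>\<delta> x\<close>. It descends twice: to the differentials because \<delta> is a
    derivation, and to the cokernel because \<delta> vanishes on \<open>A\<close>.\<close>
  define D where "D w = (\<Sum>x\<in>Poly_Mapping.keys w. \<rho> (Poly_Mapping.lookup w x) * \<delta> x)" for w :: "'l \<Rightarrow>\<^sub>0 'l"
  let ?F = "free_module B"
  have F: "premod B ?F" by (rule free_module_premod[OF B])
  have Dsup: "D w = (\<Sum>x\<in>S. \<rho> (Poly_Mapping.lookup w x) * \<delta> x)" if "finite S" "Poly_Mapping.keys w \<subseteq> S" for w S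
    unfolding D_def using that r0 by (intro sum.mono_neutral_left) (auto simp: in_keys_iff)
  have Dadd: "D (v + w) = D v + D w" if vw: "v \<in> carrier ?F" "w \<in> carrier ?F" for v w
  proof -
    let ?S = "Poly_Mapping.keys v \<union> Poly_Mapping.keys w"
    have S: "finite ?S" "Poly_Mapping.keys v \<subseteq> ?S" "Poly_Mapping.keys w \<subseteq> ?S" "Poly_Mapping.keys (v + w) \<subseteq> ?S"
      using Poly_Mapping.keys_add[of v w] by auto
    have "\<rho> (Poly_Mapping.lookup (v + w) x) = \<rho> (Poly_Mapping.lookup v x) + \<rho> (Poly_Mapping.lookup w x)" for x
      using vw rho(1) by (simp add: lookup_add free_module_def)
    then show ?thesis using Dsup[OF S(1,4)] Dsup[OF S(1,2)] Dsup[OF S(1,3)] by (simp add: distrib_right sum.distrib)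
  qed
  have Dsm: "D (Poly_Mapping.map ((*) a) w) = \<rho> a * D w" if aw: "a \<in> B" "w \<in> carrier ?F" for a w
  proof -
    have "Poly_Mapping.keys (Poly_Mapping.map ((*) a) w) \<subseteq> Poly_Mapping.keys w" by (auto simp: in_keys_iff lookup_smult)
    from Dsup[OF _ this] have "D (Poly_Mapping.map ((*) a) w) = (\<Sum>x\<in>Poly_Mapping.keys w. \<rho> (a * Poly_Mapping.lookup w x) * \<delta> x)"
      by (simp add: lookup_smult)
    also have "\<dots> = \<rho> a * D w" unfolding D_def sum_distrib_left
      by (rule sum.cong) (use aw rho(2) in \<open>auto simp: free_module_def mult.assoc\<close>)
    finally show ?thesis .
  qed
  have fD: "functional B \<rho> ?F D" using Dadd Dsm by (auto simp: functional_def free_module_def)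
  have Ds: "D (Poly_Mapping.single y b) = \<rho> b * \<delta> y" for y b
    using Dsup[of "{y}" "Poly_Mapping.single y b"] by simp
  have sC: "Poly_Mapping.single y b \<in> carrier ?F" if "y \<in> B" "b \<in> B" for y b
    using that subr_zero[OF B] by (auto simp: free_module_def lookup_single when_def)
  have neg: "- v \<in> carrier ?F" if "v \<in> carrier ?F" for v
    using that subr_uminus[OF B] by (auto simp: free_module_def)
  have D0: "D 0 = 0" by (simp add: D_def)
  have Dneg: "D (- v) = - D v" if "v \<in> carrier ?F" for v
    using Dadd[OF that neg[OF that]] D0 by (simp add: eq_neg_iff_add_eq_0 add.commute)
  have addC: "v + w \<in> carrier ?F" if "v \<in> carrier ?F" "w \<in> carrier ?F" for v w
    using that subr_add[OF B] Poly_Mapping.keys_add[of v w] by (auto simp: free_module_def lookup_add)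
  have diffC: "v - w \<in> carrier ?F" "D (v - w) = D v - D w" if "v \<in> carrier ?F" "w \<in> carrier ?F" for v w
    using addC[OF that(1) neg[OF that(2)]] Dadd[OF that(1) neg[OF that(2)]] Dneg[OF that(2)] by auto
  have o: "1 \<in> B" by (rule subr_one[OF B])
  have rel: "kaehler_relations k B \<subseteq> {w \<in> carrier ?F. D w = 0}"
  proof
    fix w assume "w \<in> kaehler_relations k B"
    then consider (add) y z where "w = Poly_Mapping.single (y + z) 1 - Poly_Mapping.single y 1 - Poly_Mapping.single z 1" "y \<in> B" "z \<in> B"
      | (mult) y z where "w = Poly_Mapping.single (y * z) 1 - Poly_Mapping.single z y - Poly_Mapping.single y z" "y \<in> B" "z \<in> B"
      | (const) c where "w = Poly_Mapping.single c 1" "c \<in> k"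
      unfolding kaehler_relations_def by blast
    then show "w \<in> {w \<in> carrier ?F. D w = 0}"
    proof cases
      case add
      then show ?thesis using der(1) rho(4) subr_add[OF B] by (simp add: diffC sC o Ds)
    next
      case mult
      then show ?thesis using der(2) rho(4) subr_mult[OF B] by (simp add: diffC sC o Ds)
    next
      case const
      then show ?thesis using der(3) k by (auto simp: sC o Ds)
    qed
  qed
  define N where "N = kaehler_kernel k B"
  have relF: "kaehler_relations k B \<subseteq> carrier ?F" using rel by auto
  have N: "submodule N (subring_rec B) ?F" "N \<subseteq> {w \<in> carrier ?F. D w = 0}" unfolding N_def kaehler_kernel_def
    by (rule module_span_submodule[OF F relF], rule module_span_least[OF kernel_submodule[OF F fD] rel])
  obtain D1 where D1: "functional B \<rho> (kaehler k B) D1" "\<And>w. w \<in> carrier ?F \<Longrightarrow> D1 (N +>\<^bsub>?F\<^esub> w) = D w"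
    using quot_functional[OF F N(1) fD N(2)] unfolding kaehler_def N_def by metis
  note q = quot_module_properties[OF F N(1)]
  let ?\<Omega> = "kaehler k B"
  have Om: "premod B ?\<Omega>" using q(4) by (simp add: kaehler_def N_def)
  have dC: "kaehler_d k B y \<in> carrier ?\<Omega>" "D1 (kaehler_d k B y) = \<delta> y" if "y \<in> B" for y
    using q(1) D1(2)[OF sC[OF that o]] sC[OF that o] rho(4) by (auto simp: kaehler_def kaehler_d_def N_def Ds)
  define M where "M = module_span (subring_rec B) ?\<Omega> (kaehler_d k B ` A)"
  have dA: "kaehler_d k B ` A \<subseteq> carrier ?\<Omega>" "kaehler_d k B ` A \<subseteq> {w \<in> carrier ?\<Omega>. D1 w = 0}" using dC A AB by auto
  have M: "submodule M (subring_rec B) ?\<Omega>" "M \<subseteq> {w \<in> carrier ?\<Omega>. D1 w = 0}" unfolding M_def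
    by (rule module_span_submodule[OF Om dA(1)], rule module_span_least[OF kernel_submodule[OF Om D1(1)] dA(2)])
  let ?Q = "kaehler_coker k A B"
  have Qeq: "?Q = quot_module ?\<Omega> M" by (simp add: kaehler_coker_def M_def)
  obtain D2 where D2: "functional B \<rho> ?Q D2" "\<And>w. w \<in> carrier ?\<Omega> \<Longrightarrow> D2 (M +>\<^bsub>?\<Omega>\<^esub> w) = D1 w"
    using quot_functional[OF Om M(1) D1(1) M(2)] unfolding Qeq by metis
  note q2 = quot_module_properties[OF Om M(1)]
  have Q: "premod B ?Q" using q2(4) by (simp add: Qeq)
  define \<xi> where "\<xi> = M +>\<^bsub>?\<Omega>\<^esub> kaehler_d k B x"
  have xi: "\<xi> \<in> carrier ?Q" "D2 \<xi> = \<delta> x" using q2(1) dC[OF x] D2(2) by (auto simp: Qeq \<xi>_def)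
  \<comment> \<open>The descended functional takes the nonzero value \<open>\<delta> x\<close> at
    the class of \<open>dx\<close> and is linear over \<open>k\<close>. That class alone is
    therefore an independent set, which dimension zero forbids.\<close>
  have "lin_indep k ?Q {\<xi>}" unfolding lin_indep_def
  proof (intro allI impI)
    fix c assume c: "(\<forall>s\<in>{\<xi>}. c s \<in> k) \<and> finsum ?Q (\<lambda>s. c s \<odot>\<^bsub>?Q\<^esub> s) {\<xi>} = \<zero>\<^bsub>?Q\<^esub>"
    interpret abelian_group ?Q using Q by (simp add: premod_def)
    have cB: "c \<xi> \<in> B" using c k by auto
    have cl: "c \<xi> \<odot>\<^bsub>?Q\<^esub> \<xi> \<in> carrier ?Q" using Q cB xi(1) by (auto simp: premod_def)
    then have "finsum ?Q (\<lambda>s. c s \<odot>\<^bsub>?Q\<^esub> s) {\<xi>} = c \<xi> \<odot>\<^bsub>?Q\<^esub> \<xi>" by (subst finsum_insert) auto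
    then have "D2 (c \<xi> \<odot>\<^bsub>?Q\<^esub> \<xi>) = 0" using c functional_zero[OF Q D2(1)] by simp
    moreover have "D2 (c \<xi> \<odot>\<^bsub>?Q\<^esub> \<xi>) = c \<xi> * \<delta> x" using D2(1) cB xi rho(3) c by (auto simp: functional_def)
    ultimately show "\<forall>s\<in>{\<xi>}. c s = 0" using nz by simp
  qed
  then have "enat (card {\<xi>}) \<in> {enat (card S) | S. finite S \<and> S \<subseteq> carrier ?Q \<and> lin_indep k ?Q S}" using xi(1) by blast
  then have "enat (card {\<xi>}) \<le> vs_dim k ?Q" unfolding vs_dim_def by (rule Sup_upper)
  then show False using dim by (simp add: zero_enat_def)
qed

section \<open>The residue map and the point derivation defined by a uniformizer\<close>

context normalization_setting
begin

definition residue :: "'l \<Rightarrow> 'l" where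
  "residue b = (THE \<alpha>. \<alpha> \<in> Kbar \<and> b - \<alpha> \<in> nonunits B)"

lemma Kbar_le_B: "Kbar \<subseteq> B" using Kbar(3) A_le_B by auto

lemma residue_unique: "\<alpha> \<in> Kbar \<Longrightarrow> b - \<alpha> \<in> nonunits B \<Longrightarrow> residue b = \<alpha>"
  unfolding residue_def
proof (rule the_equality)
  fix \<beta> assume a: "\<alpha> \<in> Kbar" "b - \<alpha> \<in> nonunits B" and b: "\<beta> \<in> Kbar \<and> b - \<beta> \<in> nonunits B"
  have "(b - \<alpha>) - (b - \<beta>) \<in> nonunits B" by (rule ideal_in_diff[OF B_subr B_nonunits a(2)]) (use b in simp)
  then have n: "\<beta> - \<alpha> \<in> nonunits B" by simp
  have "\<beta> - \<alpha> \<in> Kbar" using a b subr_diff[OF Kbar_subr] by auto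
  then have "inverse (\<beta> - \<alpha>) \<in> B" using subf_inverse[OF Kbar(1)] Kbar_le_B by auto
  then show "\<beta> = \<alpha>" using nonunitsD(2)[OF n] by auto
qed simp

lemma residue: "b \<in> B \<Longrightarrow> residue b \<in> Kbar" "b \<in> B \<Longrightarrow> b - residue b \<in> nonunits B"
  using res residue_unique by metis+

lemma residue_Kbar: "k \<in> Kbar \<Longrightarrow> residue k = k"
  by (rule residue_unique) (use ideal_inD(2)[OF B_nonunits] in auto)

lemma residue_add: "x \<in> B \<Longrightarrow> y \<in> B \<Longrightarrow> residue (x + y) = residue x + residue y"
proof (rule residue_unique)
  assume xy: "x \<in> B" "y \<in> B"
  show "residue x + residue y \<in> Kbar" using residue xy subr_add[OF Kbar_subr] by auto
  have "(x - residue x) + (y - residue y) \<in> nonunits B" using ideal_inD(3)[OF B_nonunits] residue xy by auto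
  then show "x + y - (residue x + residue y) \<in> nonunits B" by (simp add: algebra_simps)
qed

lemma residue_mult: "x \<in> B \<Longrightarrow> y \<in> B \<Longrightarrow> residue (x * y) = residue x * residue y"
proof (rule residue_unique)
  assume xy: "x \<in> B" "y \<in> B"
  show "residue x * residue y \<in> Kbar" using residue xy subr_mult[OF Kbar_subr] by auto
  have "x * (y - residue y) + residue y * (x - residue x) \<in> nonunits B"
    using ideal_inD(3)[OF B_nonunits ideal_inD(4)[OF B_nonunits xy(1) residue(2)[OF xy(2)]] ideal_inD(4)[OF B_nonunits _ residue(2)[OF xy(1)]]]
      residue(1)[OF xy(2)] Kbar_le_B by auto
  then show "x * y - residue x * residue y \<in> nonunits B" by (simp add: algebra_simps)
qed

lemma regular_of_vs_dim:
  assumes dim: "vs_dim Kbar (kaehler_coker Kbar A B) = 0"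
  shows "regular_local_ring (subring_rec A)"
proof -
  obtain t where t: "t \<in> B" "nonunits B = (*) t ` B" using nonunits_principal by auto
  show ?thesis
  proof (cases "t = 0")
    case True
    then have "nonunits B = {0}" using t(2) subr_zero[OF B_subr] by auto
    then show ?thesis by (rule regular_of_field)
  next
    case False
    define \<delta> where "\<delta> b = residue ((b - residue b) / t)" for b
    have quo: "(b - residue b) / t \<in> B" if b: "b \<in> B" for b
    proof -
      have "b - residue b \<in> (*) t ` B" using residue(2)[OF b] t(2) by simp
      then show ?thesis using False by auto
    qed
    have o: "1 \<in> Kbar" by (rule subr_one[OF Kbar_subr])
    have d1: "\<delta> (x + y) = \<delta> x + \<delta> y" if xy: "x \<in> B" "y \<in> B" for x y
    proof -
      have "(x + y - residue (x + y)) / t = (x - residue x) / t + (y - residue y) / t"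
        unfolding residue_add[OF xy] by (simp add: diff_divide_distrib add_divide_distrib)
      then show ?thesis unfolding \<delta>_def using residue_add[OF quo quo] xy by simp
    qed
    have d2: "\<delta> (x * y) = residue x * \<delta> y + residue y * \<delta> x" if xy: "x \<in> B" "y \<in> B" for x y
    proof -
      have ryB: "residue y \<in> B" using residue(1)[OF xy(2)] Kbar_le_B by auto
      \<comment> \<open>The product rule at a point: the increment of \<open>x * y\<close> is
        \<open>x\<close> times the increment of \<open>y\<close> plus the value of \<open>y\<close>
        times the increment of \<open>x\<close>. Dividing by \<open>t\<close> and taking residues
        gives the rule for \<delta>.\<close>
      have "(x * y - residue (x * y)) / t = x * ((y - residue y) / t) + residue y * ((x - residue x) / t)"
        unfolding residue_mult[OF xy] using False by (simp add: field_simps)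
      moreover have "residue (x * ((y - residue y) / t)) = residue x * \<delta> y"
        unfolding \<delta>_def by (rule residue_mult[OF xy(1) quo[OF xy(2)]])
      moreover have "residue (residue y * ((x - residue x) / t)) = residue y * \<delta> x"
        unfolding \<delta>_def using residue_mult[OF ryB quo[OF xy(1)]] residue_Kbar[OF residue(1)[OF xy(2)]] by simp
      ultimately show ?thesis
        using residue_add[OF subr_mult[OF B_subr xy(1) quo[OF xy(2)]] subr_mult[OF B_subr ryB quo[OF xy(1)]]]
        by (simp add: \<delta>_def)
    qed
    have d3: "\<delta> k = 0" if "k \<in> Kbar" for k
      using residue_Kbar[OF that] residue_Kbar[OF subr_zero[OF Kbar_subr]] by (simp add: \<delta>_def)
    have tn: "t \<in> nonunits B" unfolding t(2) by (rule mem_principal[OF B_subr])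
    have "residue t = 0" by (rule residue_unique) (use tn subr_zero[OF Kbar_subr] in auto)
    then have dt: "\<delta> t = 1" using False residue_Kbar[OF o] by (simp add: \<delta>_def)
    have "\<exists>a\<in>A. \<delta> a \<noteq> 0"
    proof (rule ccontr)
      assume "\<not> (\<exists>a\<in>A. \<delta> a \<noteq> 0)"
      then have "\<delta> t = 0"
        by (intro kaehler_coker_derivation[OF B_subr Kbar_le_B A_le_B residue_add residue_mult residue_Kbar residue_Kbar[OF o] d1 d2 d3 _ dim t(1)]) auto
      then show False using dt by simp
    qed
    then obtain a where a: "a \<in> A" "\<delta> a \<noteq> 0" by auto
    have aB: "a \<in> B" using a A_le_B by auto
    \<comment> \<open>Its residue is \<open>\<delta> a\<close>, which is nonzero, so
      \<open>u\<close> is a unit. Hence \<open>a - residue a = t * u\<close> is a uniformizer of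
      \<open>B\<close> lying in \<open>A\<close>.\<close>
    define u where "u = (a - residue a) / t"
    have uB: "u \<in> B" unfolding u_def by (rule quo[OF aB])
    have "u \<notin> nonunits B" using a(2) residue_unique[of 0 u] subr_zero[OF Kbar_subr] by (auto simp: \<delta>_def u_def)
    then have iu: "inverse u \<in> B" "u \<noteq> 0" using local_unit[OF uB] subr_zero[OF B_subr] by (auto simp: nonunits_def)
    have x: "a - residue a = t * u" using False by (simp add: u_def)
    have xA: "a - residue a \<in> A" using a(1) residue(1)[OF aB] Kbar(3) subr_diff[OF A_subr] by auto
    have "(*) t ` B = (*) (t * u) ` B"
    proof (intro equalityI subsetI)
      fix z assume "z \<in> (*) t ` B"
      then obtain r where r: "z = t * r" "r \<in> B" by auto
      have "z = (t * u) * (inverse u * r)" using r iu by simp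
      then show "z \<in> (*) (t * u) ` B" using subr_mult[OF B_subr iu(1) r(2)] by blast
    next
      fix z assume "z \<in> (*) (t * u) ` B"
      then obtain r where r: "z = t * u * r" "r \<in> B" by auto
      then have "z = t * (u * r)" by (simp add: mult.assoc)
      then show "z \<in> (*) t ` B" using subr_mult[OF B_subr uB r(2)] by blast
    qed
    then have "nonunits B = (*) (a - residue a) ` B" using t(2) x by simp
    from regular_of_uniformizer[OF xA this] show ?thesis .
  qed
qed

end

text \<open>Over the algebraically closed field the polynomial splits into linear factors. Their
  values at \<open>y\<close> multiply to an element of the prime \<open>q\<close>, so one of the
  linear values is in \<open>q\<close>; a nonzero constant cannot be.\<close>

lemma prime_root_of_poly:
  fixes B :: "'l::field set"
  assumes Kbar: "algebraic_closure (subring_rec Kbar) K" "subf Kbar" and B: "subr B" "Kbar \<subseteq> B" and q: "prime_in B q" and y: "y \<in> B"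
  shows "poly_in Kbar g \<Longrightarrow> g \<noteq> 0 \<Longrightarrow> poly g y \<in> q \<Longrightarrow> \<exists>\<alpha>\<in>Kbar. y - \<alpha> \<in> q"
proof (induction "Polynomial.degree g" arbitrary: g rule: less_induct)
  case less
  have d: "Polynomial.degree g > 0"
  proof (rule ccontr)
    assume "\<not> Polynomial.degree g > 0"
    then obtain c where c: "g = [:c:]" using degree_eq_zeroE by auto
    have cK: "c \<in> Kbar" using less(2) unfolding c poly_in_def by (metis coeff_pCons_0)
    have "c \<noteq> 0" "c \<in> q" using c less(3,4) by auto
    moreover have "inverse c \<in> B" using subf_inverse[OF Kbar(2) cK] B by auto
    ultimately have "1 \<in> q" using ideal_inD(4)[OF prime_in_ideal[OF q], of "inverse c" c] by simp
    then show False using q by (simp add: prime_in_def)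
  qed
  obtain r where r: "r \<in> Kbar" "poly g r = 0" using algebraic_closure_root[OF Kbar less(2) d] by auto
  obtain h where h: "poly_in Kbar h" and g: "g = [:-r,1:] * h"
    using poly_in_root_factor[OF Kbar(2) less(2) r] by metis
  have h0: "h \<noteq> 0" using g less(3) by auto
  have "poly g y = (y - r) * poly h y" using arg_cong[OF g, of "\<lambda>f. poly f y"] by (simp add: algebra_simps)
  then have "(y - r) * poly h y \<in> q" using less(4) by simp
  moreover have "y - r \<in> B" using y r B by (auto intro: subr_intros)
  moreover have "poly h y \<in> B" by (rule poly_in_poly[OF B(1,2) h y])
  ultimately have "y - r \<in> q \<or> poly h y \<in> q" using q by (auto simp: prime_in_def)
  then show ?case
  proof
    assume "poly h y \<in> q"
    moreover have "Polynomial.degree h < Polynomial.degree g"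
      using arg_cong[OF g, of Polynomial.degree] degree_mult_eq[of "[:-r,1:]" h] h0 by simp
    ultimately show ?thesis using less(1)[OF _ h h0] by blast
  qed (use r in auto)
qed

theorem proposition3p17:
  fixes K Kbar :: "'l::field set" and p :: nat
    and C :: "('x, 'l) int_scheme" and P :: 'x
  assumes "subfield K ambient" and "CHAR('l) = p" and "p > 0"
    and "\<not> perfect_subfield K" and "separably_closed K"
    and "subfield Kbar ambient" and "algebraic_closure (subring_rec Kbar) K"
    and "integral_curve K C" and "geometrically_integral K Kbar C" and "regular_scheme C"
    and "P \<in> points C" and "closedin (top_space C) {P}"
    and "differential_degree Kbar C P = 1"
  shows "regular_at (base_change Kbar C) (geom_point Kbar C P)"
proof -
  have pr: "prime p" using prime_CHAR_semidom[where 'a = 'l] assms(2,3) by simp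
  have K: "subf K" and Kb: "subf Kbar" using assms(1,6) by (auto intro: subfield_imp_subf)
  have KK: "K \<subseteq> Kbar"
    using subfieldE(3)[OF algebraic_closure.axioms(2)[OF assms(7)]] by simp
  \<comment> \<open>Used twice: with \<open>n = p\<close> it says that \<open>Kbar\<close> is
    perfect, and with a power of \<open>p\<close> it brings residues of p-power iterates back to
    residues.\<close>
  have rootp: "\<exists>y\<in>Kbar. y ^ n = x" if x: "x \<in> Kbar" and n: "n > 0" for x n
  proof -
    define f where "f = Polynomial.monom 1 n - [:x:]"
    have "poly_in Kbar f" unfolding f_def by (intro poly_in_intros subf_subr Kb x subr_one)
    moreover have "n \<le> Polynomial.degree f" unfolding f_def
      using n by (intro le_degree) (simp add: coeff_pCons split: nat.split)
    then have "Polynomial.degree f > 0" using n by simp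
    ultimately obtain y where "y \<in> Kbar" "poly f y = 0" using algebraic_closure_root[OF assms(7) Kb] by blast
    then show ?thesis by (auto simp: f_def poly_monom)
  qed
  have radK: "radicial p K Kbar" unfolding radicial_def
    using KK algebraic_closure_root_over[OF assms(7) Kb] separably_closed_radicial[OF K assms(5) pr assms(2)] by metis
  have CC: "integral_scheme C" "scheme_over K C" "finite_type K C" "top_dim (top_space C) = 1"
    using assms(8) by (auto simp: integral_curve_def)
  interpret base_change_setting p K Kbar C
    by unfold_locales (use pr assms(2) Kb radK CC in auto)
  note P = assms(11)
  define A B L where "A = bc (stalk C P)" and "B = nrm P" and "L = bc (fun_field C)"
  have av: "arch_val (stalk C P) (fun_field C)" by (rule stalk_arch_val[OF CC(4) assms(10) P])
  note n = nrm_arch_val[OF P av, folded A_def B_def L_def]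
  have lA: "local_in A" unfolding A_def by (rule stalk_bc(3)[OF P])
  have lB: "local_in B" using n(1) by (simp add: arch_val_def)
  obtain U where U: "affine_open C U" "P \<in> U" using ex_affine[OF P] by auto
  obtain S where S: "finite S" "sections C U = generate_ring ambient (K \<union> S)" using CC(3) U(1) by (auto simp: finite_type_def)
  obtain as where as: "set as = S" using finite_list[OF S(1)] by auto
  have secst: "sections C U \<subseteq> stalk C P" using U by (auto simp: sections_def)
  have Ssec: "S \<subseteq> sections C U" using S(2) generate_ring_incl[of "K \<union> S"] by auto
  have stA: "stalk C P \<subseteq> A" unfolding A_def by (rule bc_incl)
  have KA: "Kbar \<subseteq> A" unfolding A_def by (rule bc_incl)
  have mB: "nonunits (stalk C P) \<subseteq> nonunits B"
    using radicial_prime(2)[OF pr assms(2) stalk_subr[OF P] n(5,2) local_prime[OF stalk_local[OF P]]]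
      radicial_local(1)[OF pr assms(2) stalk_local[OF P] n(5,2)] by blast
  have residues: "\<exists>\<alpha>\<in>Kbar. b - \<alpha> \<in> nonunits B" if b: "b \<in> B" for b
  proof -
    \<comment> \<open>The residue is found for an iterate in the local ring of \<open>C\<close>,
      where Zariski's lemma and closedness of \<open>P\<close> apply. If \<beta> is the matching
      root of that residue, additivity of Frobenius makes a power of \<open>b - \<beta>\<close> a
      nonunit of \<open>B\<close>.\<close>
    obtain m where m: "b ^ p ^ m \<in> stalk C P" using n(2) b by (auto simp: radicial_def)
    have "alg_mod K (nonunits (stalk C P)) (b ^ p ^ m)"
    proof (rule residue_field_algebraic[OF stalk_local[OF P] K stalk_over[OF P] _ _ m])
      show "set as \<subseteq> stalk C P" using as Ssec secst by auto
      show "\<exists>y\<in>generate_ring ambient (K \<union> set as). x - y \<in> nonunits (stalk C P)" if "x \<in> stalk C P" for x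
        using closed_point_residue[OF P assms(12) U that] S(2) as by simp
    qed
    then obtain g where g: "poly_in K g" "g \<noteq> 0" "poly g (b ^ p ^ m) \<in> nonunits B" using mB by (auto simp: alg_mod_def)
    have KbB: "Kbar \<subseteq> B" using KA n(3) by auto
    obtain \<alpha> where al: "\<alpha> \<in> Kbar" "b ^ p ^ m - \<alpha> \<in> nonunits B"
      using prime_root_of_poly[OF assms(7) Kb n(5) KbB local_prime[OF lB] subr_power[OF n(5) b] poly_in_mono[OF KK g(1)] g(2,3)] by auto
    obtain \<beta> where be: "\<beta> \<in> Kbar" "\<beta> ^ p ^ m = \<alpha>" using rootp[OF al(1), of "p ^ m"] assms(3) by auto
    have "(b - \<beta>) ^ p ^ m \<in> nonunits B" using al be frob_diff[OF pr assms(2), of b \<beta> m] by simp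
    moreover have "b - \<beta> \<in> B" using subr_diff[OF n(5) b] be KbB by auto
    ultimately have "b - \<beta> \<in> nonunits B" using prime_in_power[OF n(5) local_prime[OF lB]] by blast
    then show ?thesis using be by auto
  qed
  interpret N: normalization_setting p Kbar A B L as
  proof
    \<comment> \<open>The function field is the localization of the local ring at its zero ideal,
      and its base change has denominators already from the local ring.\<close>
    show "\<exists>e\<in>A. e \<noteq> 0 \<and> e * q \<in> A" if "q \<in> L" for q
      using bc_localization[OF stalk_subr[OF P] zero_prime[OF stalk_subr[OF P]], of q] that stA
      unfolding L_def A_def stalk_fraction_field[OF P] by blast
    show "set as \<subseteq> A" using as Ssec secst stA by auto
    fix T assume T: "subr T" "Kbar \<subseteq> T" "set as \<subseteq> T"
      "\<And>x. x \<in> T \<Longrightarrow> x \<in> A \<Longrightarrow> x \<noteq> 0 \<Longrightarrow> inverse x \<in> A \<Longrightarrow> inverse x \<in> T"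
    have secT: "sections C U \<subseteq> T" unfolding S(2) by (rule generate_ring_min[OF T(1)]) (use T KK as in auto)
    \<comment> \<open>A denominator \<open>s\<close> on the affine set is a unit of the local ring,
      so the closure of \<open>T\<close> under inverses taken in \<open>A\<close> supplies
      \<open>inverse s\<close>.\<close>
    have "stalk C P \<subseteq> T"
    proof
      fix x assume "x \<in> stalk C P"
      then obtain a s where x: "x = a / s" "a \<in> sections C U" "s \<in> sections C U" "s \<notin> pr U P"
        using affine_stalk(2)[OF U] by (auto simp: localization_def)
      have "s \<notin> nonunits (stalk C P)" using x by (auto simp: pr_def)
      then have "inverse s \<in> A" "s \<noteq> 0" using x secst stA by (auto simp: nonunits_def)
      then have "inverse s \<in> T" using T(4)[of s] x secT secst stA by auto
      then show "x \<in> T" using x secT subr_mult[OF T(1)] by (auto simp: divide_inverse)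
    qed
    then show "A \<subseteq> T" unfolding A_def by (rule bc_least[OF T(1) _ T(2)])
  qed (use pr assms(2,3) Kb rootp KA lA n residues in auto)
  have "vs_dim Kbar (kaehler_coker Kbar A B) = 0"
  proof -
    have "1 + vs_dim Kbar (kaehler_coker Kbar A B) = 1"
      using assms(13) unfolding differential_degree_def Let_def geom_point_eq[OF P] stalk_C'[OF P]
        normal_point_stalk[OF P av] A_def B_def .
    then show ?thesis by (cases "vs_dim Kbar (kaehler_coker Kbar A B)") (auto simp: one_enat_def zero_enat_def)
  qed
  from N.regular_of_vs_dim[OF this] show ?thesis
    unfolding regular_at_def geom_point_eq[OF P] stalk_C'[OF P] A_def .
qed

end
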